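(* (1) The following decision problem can be decided in nondeterministic space $\mathcal{O}\big((n+k)^2\,|\Sigma|\,(1+\log|Q|)+|u|(1+\log|\Sigma|)\big)$, where $n=|Q^*\circ u|\le|\Sigma|^{|u|}$ is the size of the orbit of the input word. Input: an $S$-automaton $\mathcal{T}=(Q,\Sigma,\delta)$, a natural number $k\ge 1$ and a word $u\in\Sigma^*$. Question: is $u$ $k$-expandable with respect to $\mathcal{T}$? (2) For every fixed $S$-automaton $\mathcal{T}=(Q,\Sigma,\delta)$ (a constant, not part of the input), the following decision problem can be decided in nondeterministic space $2^{\mathcal{O}(|u|+\log k)}$. Input: a natural number $k\ge 1$ and a word $u\in\Sigma^*$. Question: is $u$ $k$-expandable with respect to $\mathcal{T}$?
   Context: An alphabet is a non-empty finite set; $\Sigma^*$ is the set of finite words over $\Sigma$, including the empty word $\varepsilon$; $|u|$ is the length of a word $u$. An $S$-automaton is a triple $\mathcal{T}=(Q,\Sigma,\delta)$ with a finite set $Q$ of states, an alphabet $\Sigma$ and a transition set $\delta\subseteq Q\times\Sigma\times\Sigma\times Q$ that is deterministic: for all $q\in Q$, $a\in\Sigma$ there is at most one transition $(q,a,b,p)\in\delta$ (with $b\in\Sigma,p\in Q$). It need not be complete. A transition $(q,a,b,p)$ goes from $q$ to $p$, reads $a$ and outputs $b$. Each $q\in Q$ induces a partial length-preserving function $q\circ\colon\Sigma^*\to\Sigma^*$: $q\circ a_1\dots a_m=b_1\dots b_m$ if there is a run $q=q_0,q_1,\dots,q_m$ with $(q_{i-1},a_i,b_i,q_i)\in\delta$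 for all $i$; it is undefined if no such run exists. For $\boldsymbol{q}=q_\ell\dots q_1\in Q^*$, $\boldsymbol{q}\circ$ is the composition of partial functions applying $q_1\circ$ first and $q_\ell\circ$ last; $\varepsilon\circ$ is the identity. The orbit of $u\in\Sigma^*$ is $Q^*\circ u=\{\boldsymbol{q}\circ u\mid \boldsymbol{q}\in Q^*,\ \boldsymbol{q}\circ\text{ defined on }u\}$. For $k\ge1$ and $x\in\Sigma^*$, the word $u$ is $k$-expandable by $x$ if $|Q^*\circ ux|-|Q^*\circ u|\ge k$; $u$ is $k$-expandable if it is $k$-expandable by some $x\in\Sigma^*$. Nondeterministic space is the usual notion for nondeterministic Turing machines with a read-only input tape. *)

theory Defs
  imports Complex_Main
begin

section \<open>S-automata, orbits and expandability\<close>

record ('q, 'a) automaton =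
  states :: "'q set"
  alphabet :: "'a set"
  transitions :: "('q \<times> 'a \<times> 'a \<times> 'q) set"

definition s_automaton :: "('q, 'a) automaton \<Rightarrow> bool" where
  "s_automaton T \<longleftrightarrow>
     finite (states T) \<and> finite (alphabet T) \<and> alphabet T \<noteq> {} \<and>
     transitions T \<subseteq> states T \<times> alphabet T \<times> alphabet T \<times> states T \<and>
     (\<forall>q a b p b' p'. (q, a, b, p) \<in> transitions T \<longrightarrow> (q, a, b', p') \<in> transitions T
        \<longrightarrow> b = b' \<and> p = p')"

text \<open>\<open>run T q u v p\<close>: there is a run from \<open>q\<close> to \<open>p\<close> with input \<open>u\<close> and output \<open>v\<close>.\<close>

inductive run :: "('q, 'a) automaton \<Rightarrow> 'q \<Rightarrow> 'a list \<Rightarrow> 'a list \<Rightarrow> 'q \<Rightarrow> bool"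
  for T where
  run_Nil: "run T q [] [] q"
| run_Cons: "(q, a, b, r) \<in> transitions T \<Longrightarrow> run T r u v p \<Longrightarrow> run T q (a # u) (b # v) p"

text \<open>By determinism the output word is unique; \<open>None\<close> stands for ``undefined''.\<close>

definition act :: "('q, 'a) automaton \<Rightarrow> 'q \<Rightarrow> 'a list \<Rightarrow> 'a list option" where
  "act T q u = (if \<exists>v p. run T q u v p then Some (THE v. \<exists>p. run T q u v p) else None)"

text \<open>A state word \<open>q\<^sub>l \<dots> q\<^sub>1\<close> is the list \<open>[q\<^sub>l, \<dots>, q\<^sub>1]\<close>, so the last list entry acts first.\<close>

fun act_word :: "('q, 'a) automaton \<Rightarrow> 'q list \<Rightarrow> 'a list \<Rightarrow> 'a list option" where
  "act_word T [] u = Some u"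
| "act_word T (q # qs) u = Option.bind (act_word T qs u) (act T q)"

definition orbit :: "('q, 'a) automaton \<Rightarrow> 'a list \<Rightarrow> 'a list set" where
  "orbit T u = {v. \<exists>qs \<in> lists (states T). act_word T qs u = Some v}"

text \<open>The difference is taken in the integers: as \<open>T\<close> need not be complete, the orbit of
  \<open>u @ x\<close> may be smaller than that of \<open>u\<close>.\<close>

definition expandable_by :: "('q, 'a) automaton \<Rightarrow> nat \<Rightarrow> 'a list \<Rightarrow> 'a list \<Rightarrow> bool" where
  "expandable_by T k u x \<longleftrightarrow> int (card (orbit T (u @ x))) - int (card (orbit T u)) \<ge> int k"

definition expandable :: "('q, 'a) automaton \<Rightarrow> nat \<Rightarrow> 'a list \<Rightarrow> bool" where
  "expandable T k u \<longleftrightarrow> (\<exists>x \<in> lists (alphabet T). expandable_by T k u x)"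


section \<open>Nondeterministic Turing machines with a read-only input tape\<close>

text \<open>
  A machine has a two-way read-only input tape, delimited by end markers, and a fixed number of
  one-way infinite work tapes. Control states and work symbols are natural numbers; the work
  symbol \<open>0\<close> is the blank. Since the set of transitions is required to be finite, only finitely
  many states, work symbols and input symbols are relevant.
\<close>

datatype 'i cell = Left_End | Symbol 'i | Right_End

datatype move = Move_Left | Stay | Move_Right

text \<open>A transition \<open>(q, i, rs, q', d, acts)\<close> applies in state \<open>q\<close> when \<open>i\<close> is scanned on the input
  tape and the list \<open>rs\<close> on the work tapes; the machine enters \<open>q'\<close>, moves the input head by \<open>d\<close>,
  and on the \<open>j\<close>-th work tape writes and moves as prescribed by the \<open>j\<close>-th entry of \<open>acts\<close>.\<close>

type_synonym 'i ntm_transition =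
  "nat \<times> 'i cell \<times> nat list \<times> nat \<times> move \<times> (nat \<times> move) list"

record 'i ntm =
  work_tapes :: nat
  start_state :: nat
  accept_state :: nat
  ntm_transitions :: "'i ntm_transition set"

definition wf_ntm :: "'i ntm \<Rightarrow> bool" where
  "wf_ntm M \<longleftrightarrow> finite (ntm_transitions M) \<and>
     (\<forall>(q, i, rs, q', d, acts) \<in> ntm_transitions M.
        length rs = work_tapes M \<and> length acts = work_tapes M)"

text \<open>A work tape is the list of all cells visited so far (never shrinking), together with the
  head position; a configuration consists of the control state, the input head position and the
  work tapes.\<close>

type_synonym tape = "nat list \<times> nat"

type_synonym config = "nat \<times> nat \<times> tape list"

fun input_cell :: "'i list \<Rightarrow> nat \<Rightarrow> 'i cell" where
  "input_cell w h =
     (if h = 0 then Left_End else if h \<le> length w then Symbol (w ! (h - 1)) else Right_End)"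

text \<open>The input head stays between the end markers, at positions \<open>0\<close> and \<open>length w + 1\<close>.\<close>

fun move_input :: "'i list \<Rightarrow> move \<Rightarrow> nat \<Rightarrow> nat" where
  "move_input w Move_Left h = h - 1"
| "move_input w Stay h = h"
| "move_input w Move_Right h = min (h + 1) (length w + 1)"

fun read_tape :: "tape \<Rightarrow> nat" where
  "read_tape (cs, h) = cs ! h"

fun move_tape :: "move \<Rightarrow> tape \<Rightarrow> tape" where
  "move_tape Move_Left (cs, h) = (cs, h - 1)"
| "move_tape Stay (cs, h) = (cs, h)"
| "move_tape Move_Right (cs, h) = (if h + 1 < length cs then cs else cs @ [0], h + 1)"

fun act_tape :: "tape \<Rightarrow> nat \<times> move \<Rightarrow> tape" where
  "act_tape (cs, h) (b, d) = move_tape d (cs[h := b], h)"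

inductive ntm_step :: "'i ntm \<Rightarrow> 'i list \<Rightarrow> config \<Rightarrow> config \<Rightarrow> bool" for M w where
  "(q, input_cell w h, map read_tape ts, q', d, acts) \<in> ntm_transitions M \<Longrightarrow>
   ntm_step M w (q, h, ts) (q', move_input w d h, map2 act_tape ts acts)"

definition initial_config :: "'i ntm \<Rightarrow> config" where
  "initial_config M = (start_state M, 0, replicate (work_tapes M) ([0], 0))"

definition reachable_config :: "'i ntm \<Rightarrow> 'i list \<Rightarrow> config \<Rightarrow> bool" where
  "reachable_config M w c \<longleftrightarrow> (ntm_step M w)\<^sup>*\<^sup>* (initial_config M) c"

definition accepts :: "'i ntm \<Rightarrow> 'i list \<Rightarrow> bool" where
  "accepts M w \<longleftrightarrow> (\<exists>h ts. reachable_config M w (accept_state M, h, ts))"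

text \<open>The number of visited work tape cells; the input tape is not counted.\<close>

fun space_of :: "config \<Rightarrow> nat" where
  "space_of (q, h, ts) = (\<Sum>(cs, _) \<leftarrow> ts. length cs)"

text \<open>
  \<open>decides_in_nspace M X enc P s\<close>: on the (encoded) instances in \<open>X\<close>, the machine \<open>M\<close> decides the
  problem \<open>P\<close> in nondeterministic space \<open>s\<close>. Acceptance means that some computation accepts,
  whereas the space bound is imposed on all computations, accepting or not. As in Papadimitriou's
  textbook definition of nondeterministic space, computations are not required to halt.
\<close>

definition decides_in_nspace ::
  "'i ntm \<Rightarrow> 'x set \<Rightarrow> ('x \<Rightarrow> 'i list) \<Rightarrow> ('x \<Rightarrow> bool) \<Rightarrow> ('x \<Rightarrow> real) \<Rightarrow> bool" where
  "decides_in_nspace M X enc P s \<longleftrightarrow> wf_ntm M \<and>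
     (\<forall>x \<in> X. (accepts M (enc x) \<longleftrightarrow> P x) \<and>
        (\<forall>c. reachable_config M (enc x) c \<longrightarrow> real (space_of c) \<le> s x))"


section \<open>Instances and their encodings\<close>

fun bin :: "nat \<Rightarrow> bool list" where
  "bin n = (if n < 2 then [n = 1] else bin (n div 2) @ [odd n])"

declare bin.simps [simp del]

text \<open>If the automaton is part of the input, states and letters are numbered from \<open>0\<close>, and all
  numbers are written in binary over a fixed three-letter alphabet, each terminated by \<open>Sep\<close>.\<close>

datatype symb = Bit bool | Sep

definition field :: "nat \<Rightarrow> symb list" where
  "field n = map Bit (bin n) @ [Sep]"

definition uniform_instances :: "((nat, nat) automaton \<times> nat \<times> nat list) set" where
  "uniform_instances = {(T, k, u). s_automaton T \<and>
     states T = {..<card (states T)} \<and> alphabet T = {..<card (alphabet T)} \<and>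
     k \<ge> 1 \<and> u \<in> lists (alphabet T)}"

definition transition_list :: "(nat, nat) automaton \<Rightarrow> (nat \<times> nat \<times> nat \<times> nat) list" where
  "transition_list T =
     [(q, a, b, p). q \<leftarrow> [0..<card (states T)], a \<leftarrow> [0..<card (alphabet T)],
                    b \<leftarrow> [0..<card (alphabet T)], p \<leftarrow> [0..<card (states T)],
                    (q, a, b, p) \<in> transitions T]"

text \<open>The additional \<open>Sep\<close> is an empty field separating the transitions from the word.\<close>

fun encode_uniform :: "(nat, nat) automaton \<times> nat \<times> nat list \<Rightarrow> symb list" where
  "encode_uniform (T, k, u) =
     field (card (states T)) @ field (card (alphabet T)) @ field k @
     concat (map (\<lambda>(q, a, b, p). field q @ field a @ field b @ field p) (transition_list T)) @
     [Sep] @ concat (map field u)"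

text \<open>If the automaton is fixed, its letters may be used directly as input symbols.\<close>

definition fixed_instances :: "('q, 'a) automaton \<Rightarrow> (nat \<times> 'a list) set" where
  "fixed_instances T = {(k, u). k \<ge> 1 \<and> u \<in> lists (alphabet T)}"

fun encode_fixed :: "nat \<times> 'a list \<Rightarrow> (bool + 'a) list" where
  "encode_fixed (k, u) = map Inl (bin k) @ map Inr u"

text \<open>The automaton may have no states; then \<open>log 2 0 = 0\<close> in the bound below.\<close>

fun uniform_bound :: "(nat, nat) automaton \<times> nat \<times> nat list \<Rightarrow> real" where
  "uniform_bound (T, k, u) =
     (real (card (orbit T u)) + real k)\<^sup>2 * real (card (alphabet T))
       * (1 + log 2 (real (card (states T))))
     + real (length u) * (1 + log 2 (real (card (alphabet T))))"

end

theory Submission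
  imports Defs
begin

text \<open>
  A lower bound \<open>N\<close> for an orbit is witnessed by a tree of \<open>N\<close> distinct words, rooted at the input
  word, whose edges are labelled by states. While the root word is read letter by letter, it
  suffices to store the parents, the current state of every edge, and for every pair of nodes
  whether their words already differ, that is, \<open>O(N\<^sup>2 + N log |Q|)\<close> bits. Since the automaton is
  deterministic, the tests \<open>|orbit u| \<ge> N\<close> can be evaluated by exhaustive search over all
  trees for \<open>N = 1, 2, \<dots>\<close>, which determines \<open>n = |orbit u|\<close> without ever using more than
  \<open>n + 1\<close> nodes. Then a tree with \<open>n + k\<close> nodes is guessed, run on \<open>u\<close>, and extended by guessed
  letters until all its words differ.

  Space \<open>s\<close> on a Turing machine amounts to registers with values up to \<open>2\<^bsup>O(s)\<^esup>\<close>, time being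
  irrelevant. Functions obtained by recursion with polynomially bounded values (as in Grzegorczyk's
  class of linear space functions) can therefore be used as single instructions. They include
  arithmetic, digits and bounded search, so that everything above can be coded by numbers.
\<close>

section \<open>Programs with choice and iteration\<close>

text \<open>A guessed tree proves only a lower bound for an orbit, but \<open>n\<close> must be
  known exactly: with too small a value the final test could succeed although \<open>u\<close> is
  not \<open>k\<close>-expandable. Hence the tests that determine \<open>n\<close> must also be
  refutable. This is possible because parents, initial states and input word fix the whole
  simulation, so that a run that gets stuck shows that no configuration exists. The tree for
  \<open>ux\<close> need not have distinct words after \<open>u\<close>, since \<open>x\<close> may
  be what separates them; its run on \<open>u\<close> only has to be defined. The space bound
  concerns every computation, including those that fail or never end. Therefore all layers below
  keep track of all visited states, guesses are bounded, and the bound \<open>L\<close> on codes is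
  doubled only as far as the current number \<open>N\<close> of nodes demands. Its exponent
  \<open>N * (N + S + bitlen Q)\<close>, with \<open>S\<close> letters and \<open>Q\<close> states,
  covers the difference matrix, the parents, the letters and the states at the nodes, and stays
  within the claimed bound for \<open>N \<le> n + k\<close>. Polynomial losses in register values
  cost only a constant factor in space, which pays for the layers of compilation.\<close>

datatype 'b com = Basic 'b | Seq "'b com" "'b com" | Alt "'b com" "'b com" | Star "'b com"

primrec sem :: "('b \<Rightarrow> 's \<Rightarrow> 's \<Rightarrow> bool) \<Rightarrow> 'b com \<Rightarrow> 's \<Rightarrow> 's \<Rightarrow> bool" where
  "sem bs (Basic b) = bs b"
| "sem bs (Seq c d) = sem bs c OO sem bs d"
| "sem bs (Alt c d) = sup (sem bs c) (sem bs d)"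
| "sem bs (Star c) = (sem bs c)\<^sup>*\<^sup>*"

text \<open>\<open>vis bs c s t\<close>: some computation of \<open>c\<close> from \<open>s\<close>, terminating or not, passes through \<open>t\<close>.\<close>

primrec vis :: "('b \<Rightarrow> 's \<Rightarrow> 's \<Rightarrow> bool) \<Rightarrow> 'b com \<Rightarrow> 's \<Rightarrow> 's \<Rightarrow> bool" where
  "vis bs (Basic b) s t \<longleftrightarrow> t = s \<or> bs b s t"
| "vis bs (Seq c d) s t \<longleftrightarrow> vis bs c s t \<or> (\<exists>r. sem bs c s r \<and> vis bs d r t)"
| "vis bs (Alt c d) s t \<longleftrightarrow> vis bs c s t \<or> vis bs d s t"
| "vis bs (Star c) s t \<longleftrightarrow> (\<exists>r. (sem bs c)\<^sup>*\<^sup>* s r \<and> (t = r \<or> vis bs c r t))"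

lemma vis_refl [simp]: "vis bs c s s"
  by (induction c arbitrary: s) auto

lemma sem_imp_vis: "sem bs c s t \<Longrightarrow> vis bs c s t"
  by (induction c arbitrary: s t) auto

text \<open>Tests make programs branch even where they compute a function. Here exactly one outcome
  survives, while \<open>V\<close> is imposed on every branch, including those that get stuck or
  never end.\<close>

definition exec :: "('b \<Rightarrow> 's \<Rightarrow> 's \<Rightarrow> bool) \<Rightarrow> 'b com \<Rightarrow> 's \<Rightarrow> 's \<Rightarrow> ('s \<Rightarrow> bool) \<Rightarrow> bool" where
  "exec bs c s s' V \<longleftrightarrow> (\<forall>t. sem bs c s t \<longleftrightarrow> t = s') \<and> (\<forall>t. vis bs c s t \<longrightarrow> V t)"

text \<open>The behaviour of a branch with a failed guard: it yields nothing, but the states it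
  passes through still count against the space bound.\<close>

definition dead :: "('b \<Rightarrow> 's \<Rightarrow> 's \<Rightarrow> bool) \<Rightarrow> 'b com \<Rightarrow> 's \<Rightarrow> ('s \<Rightarrow> bool) \<Rightarrow> bool" where
  "dead bs c s V \<longleftrightarrow> (\<forall>t. \<not> sem bs c s t) \<and> (\<forall>t. vis bs c s t \<longrightarrow> V t)"

lemma exec_mono: "exec bs c s s' V \<Longrightarrow> (\<And>t. V t \<Longrightarrow> V' t) \<Longrightarrow> exec bs c s s' V'"
  by (auto simp: exec_def)

lemma exec_final: "exec bs c s s' V \<Longrightarrow> V s'"
  by (auto simp: exec_def sem_imp_vis)

lemma exec_start: "exec bs c s s' V \<Longrightarrow> V s"
  by (auto simp: exec_def)

lemma exec_Basic: "(\<And>t. bs b s t \<longleftrightarrow> t = s') \<Longrightarrow> V s \<Longrightarrow> V s' \<Longrightarrow> exec bs (Basic b) s s' V"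
  by (auto simp: exec_def)

lemma exec_Seq: "exec bs c s s1 V \<Longrightarrow> exec bs d s1 s2 V \<Longrightarrow> exec bs (Seq c d) s s2 V"
  by (auto simp: exec_def OO_def)

lemma exec_Alt1: "exec bs c s s1 V \<Longrightarrow> dead bs d s V \<Longrightarrow> exec bs (Alt c d) s s1 V"
  by (auto simp: exec_def dead_def)

lemma exec_Alt2: "dead bs c s V \<Longrightarrow> exec bs d s s1 V \<Longrightarrow> exec bs (Alt c d) s s1 V"
  by (auto simp: exec_def dead_def)

lemma dead_Basic: "(\<And>t. \<not> bs b s t) \<Longrightarrow> V s \<Longrightarrow> dead bs (Basic b) s V"
  by (auto simp: dead_def)

lemma dead_Seq: "dead bs c s V \<Longrightarrow> dead bs (Seq c d) s V"
  by (auto simp: dead_def)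

lemma dead_Seq2: "exec bs c s s1 V \<Longrightarrow> dead bs d s1 V \<Longrightarrow> dead bs (Seq c d) s V"
  by (auto simp: dead_def exec_def)

lemma dead_Alt: "dead bs c s V \<Longrightarrow> dead bs d s V \<Longrightarrow> dead bs (Alt c d) s V"
  by (auto simp: dead_def)

text \<open>\<open>nb\<close> is meant as the negation of \<open>b\<close>. A \<open>Star\<close>
  may be left at any time; a premature exit is rejected by \<open>nb\<close>, so only the run of an
  ordinary loop has an outcome.\<close>

definition while :: "'b \<Rightarrow> 'b \<Rightarrow> 'b com \<Rightarrow> 'b com" where
  "while b nb c = Seq (Star (Seq (Basic b) c)) (Basic nb)"

lemma exec_while_false:
  assumes "\<And>t. \<not> bs b s t" "\<And>t. bs nb s t \<longleftrightarrow> t = s" "V s"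
  shows "exec bs (while b nb c) s s V"
proof -
  have *: "(bs b OO sem bs c)\<^sup>*\<^sup>* s t \<longleftrightarrow> t = s" for t
  proof
    assume "(bs b OO sem bs c)\<^sup>*\<^sup>* s t"
    then show "t = s"
      by (cases rule: converse_rtranclpE) (use assms(1) in auto)
  qed auto
  show ?thesis
    using assms by (auto simp: exec_def while_def OO_def[of _ "bs nb"] *)
qed

text \<open>Test and body are functional at \<open>s\<close>, so the iterates from \<open>s\<close>
  are \<open>s\<close> itself and the iterates from \<open>s1\<close>; the exit test discards
  \<open>s\<close>.\<close>

lemma exec_while_true:
  assumes b: "\<And>t. bs b s t \<longleftrightarrow> t = s" and nb: "\<And>t. \<not> bs nb s t"
    and c: "exec bs c s s1 V" and w: "exec bs (while b nb c) s1 s2 V"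
  shows "exec bs (while b nb c) s s2 V"
proof -
  let ?r = "bs b OO sem bs c"
  have r: "?r s t \<longleftrightarrow> t = s1" for t
    using b c by (auto simp: exec_def OO_def)
  have star: "?r\<^sup>*\<^sup>* s t \<longleftrightarrow> t = s \<or> ?r\<^sup>*\<^sup>* s1 t" for t
    by (metis r converse_rtranclpE converse_rtranclp_into_rtranclp rtranclp.rtrancl_refl)
  have V: "V s" "V s1"
    using exec_start exec_final c by metis+
  have Vc: "V t" if "vis bs c s t" for t
    using c that by (auto simp: exec_def)
  have s: "sem bs (while b nb c) s t \<longleftrightarrow> sem bs (while b nb c) s1 t" for t
    using nb by (auto simp: while_def OO_def[of _ "bs nb"] star)
  have v: "vis bs (while b nb c) s t \<Longrightarrow> V t \<or> vis bs (while b nb c) s1 t" for t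
    using nb V Vc b by (auto simp: while_def star)
  show ?thesis
    using w s v by (auto simp: exec_def)
qed

section \<open>Refinement of atomic instructions by programs\<close>

primrec basics :: "'b com \<Rightarrow> 'b set" where
  "basics (Basic b) = {b}"
| "basics (Seq c d) = basics c \<union> basics d"
| "basics (Alt c d) = basics c \<union> basics d"
| "basics (Star c) = basics c"

lemma finite_basics: "finite (basics c)"
  by (induction c) auto

primrec subst :: "('b \<Rightarrow> 'c com) \<Rightarrow> 'b com \<Rightarrow> 'c com" where
  "subst f (Basic b) = f b"
| "subst f (Seq c d) = Seq (subst f c) (subst f d)"
| "subst f (Alt c d) = Alt (subst f c) (subst f d)"
| "subst f (Star c) = Star (subst f c)"

lemma basics_subst: "basics (subst f c) = (\<Union>b\<in>basics c. basics (f b))"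
  by (induction c) auto

text \<open>Related states are required only between instructions; inside an implementation the
  states merely satisfy \<open>V\<close>. Both directions of simulation occur because acceptance
  must be neither lost nor gained. The guard \<open>G\<close> on all visited abstract states is a
  hypothesis: an implementation on tapes is correct and small only as long as the register values
  stay bounded.\<close>

definition refines ::
  "('b \<Rightarrow> 's \<Rightarrow> 's \<Rightarrow> bool) \<Rightarrow> ('c \<Rightarrow> 't \<Rightarrow> 't \<Rightarrow> bool) \<Rightarrow> ('s \<Rightarrow> bool) \<Rightarrow> ('s \<Rightarrow> 't \<Rightarrow> bool) \<Rightarrow>
   ('t \<Rightarrow> bool) \<Rightarrow> 'b com \<Rightarrow> 'c com \<Rightarrow> bool" where
  "refines bs cs G R V c c' \<longleftrightarrow> (\<forall>s t. R s t \<longrightarrow> (\<forall>s'. vis bs c s s' \<longrightarrow> G s') \<longrightarrow>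
     (\<forall>s'. sem bs c s s' \<longrightarrow> (\<exists>t'. sem cs c' t t' \<and> R s' t')) \<and>
     (\<forall>t'. sem cs c' t t' \<longrightarrow> (\<exists>s'. sem bs c s s' \<and> R s' t')) \<and>
     (\<forall>t'. vis cs c' t t' \<longrightarrow> V t'))"

text \<open>Induction on the program. The parts inherit the guard \<open>G\<close>: what the second
  component visits after an outcome of the first, or what a later iteration of a loop visits, is
  visited by the whole program.\<close>

lemma refines_subst:
  assumes "\<And>b. b \<in> basics c \<Longrightarrow> refines bs cs G R V (Basic b) (f b)"
  shows "refines bs cs G R V c (subst f c)"
  using assms
proof (induction c)
  case (Basic b)
  then show ?case by simp
next
  case (Seq c d)
  then have c: "refines bs cs G R V c (subst f c)" and d: "refines bs cs G R V d (subst f d)"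
    by auto
  show ?case
    unfolding refines_def
  proof (intro allI impI)
    fix s t
    assume R: "R s t" and G: "\<forall>s'. vis bs (Seq c d) s s' \<longrightarrow> G s'"
    have G1: "\<forall>s'. vis bs c s s' \<longrightarrow> G s'"
      and G2: "\<And>s1. sem bs c s s1 \<Longrightarrow> \<forall>s'. vis bs d s1 s' \<longrightarrow> G s'"
      using G by auto
    have c1: "(\<forall>s'. sem bs c s s' \<longrightarrow> (\<exists>t'. sem cs (subst f c) t t' \<and> R s' t')) \<and>
      (\<forall>t'. sem cs (subst f c) t t' \<longrightarrow> (\<exists>s'. sem bs c s s' \<and> R s' t')) \<and>
      (\<forall>t'. vis cs (subst f c) t t' \<longrightarrow> V t')"
      using c[unfolded refines_def] G1 R by blast
    have d1: "(\<forall>s'. sem bs d r s' \<longrightarrow> (\<exists>t'. sem cs (subst f d) t1 t' \<and> R s' t')) \<and>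
      (\<forall>t'. sem cs (subst f d) t1 t' \<longrightarrow> (\<exists>s'. sem bs d r s' \<and> R s' t')) \<and>
      (\<forall>t'. vis cs (subst f d) t1 t' \<longrightarrow> V t')" if "sem bs c s r" "R r t1" for r t1
      using d[unfolded refines_def] G2[OF that(1)] that(2) by blast
    show "(\<forall>s'. sem bs (Seq c d) s s' \<longrightarrow> (\<exists>t'. sem cs (subst f (Seq c d)) t t' \<and> R s' t')) \<and>
     (\<forall>t'. sem cs (subst f (Seq c d)) t t' \<longrightarrow> (\<exists>s'. sem bs (Seq c d) s s' \<and> R s' t')) \<and>
     (\<forall>t'. vis cs (subst f (Seq c d)) t t' \<longrightarrow> V t')"
    proof (intro conjI allI impI)
      fix s' assume "sem bs (Seq c d) s s'"
      then obtain r where r: "sem bs c s r" "sem bs d r s'" by auto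
      with c1 obtain t1 where t1: "sem cs (subst f c) t t1" "R r t1" by metis
      with d1 r obtain t2 where "sem cs (subst f d) t1 t2" "R s' t2" by metis
      with t1 show "\<exists>t'. sem cs (subst f (Seq c d)) t t' \<and> R s' t'" by auto
    next
      fix t' assume "sem cs (subst f (Seq c d)) t t'"
      then obtain r where r: "sem cs (subst f c) t r" "sem cs (subst f d) r t'" by auto
      with c1 obtain t1 where t1: "sem bs c s t1" "R t1 r" by metis
      with d1 r obtain t2 where "sem bs d t1 t2" "R t2 t'" by metis
      with t1 show "\<exists>s'. sem bs (Seq c d) s s' \<and> R s' t'" by auto
    next
      fix t' assume "vis cs (subst f (Seq c d)) t t'"
      then consider "vis cs (subst f c) t t'"
        | r where "sem cs (subst f c) t r" "vis cs (subst f d) r t'" by auto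
      then show "V t'"
      proof cases
        case 1 then show ?thesis using c1 by blast
      next
        case 2
        with c1 obtain t1 where t1: "sem bs c s t1" "R t1 r" by metis
        with d1 2 show ?thesis by metis
      qed
    qed
  qed
next
  case (Alt c d)
  then have c: "refines bs cs G R V c (subst f c)" and d: "refines bs cs G R V d (subst f d)"
    by auto
  show ?case
    unfolding refines_def
  proof (intro allI impI)
    fix s t
    assume R: "R s t" and G: "\<forall>s'. vis bs (Alt c d) s s' \<longrightarrow> G s'"
    have G1: "\<forall>s'. vis bs c s s' \<longrightarrow> G s'" and G2: "\<forall>s'. vis bs d s s' \<longrightarrow> G s'"
      using G by auto
    have c1: "(\<forall>s'. sem bs c s s' \<longrightarrow> (\<exists>t'. sem cs (subst f c) t t' \<and> R s' t')) \<and>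
      (\<forall>t'. sem cs (subst f c) t t' \<longrightarrow> (\<exists>s'. sem bs c s s' \<and> R s' t')) \<and>
      (\<forall>t'. vis cs (subst f c) t t' \<longrightarrow> V t')"
      using c[unfolded refines_def] G1 R by blast
    have d1: "(\<forall>s'. sem bs d s s' \<longrightarrow> (\<exists>t'. sem cs (subst f d) t t' \<and> R s' t')) \<and>
      (\<forall>t'. sem cs (subst f d) t t' \<longrightarrow> (\<exists>s'. sem bs d s s' \<and> R s' t')) \<and>
      (\<forall>t'. vis cs (subst f d) t t' \<longrightarrow> V t')"
      using d[unfolded refines_def] G2 R by blast
    show "(\<forall>s'. sem bs (Alt c d) s s' \<longrightarrow> (\<exists>t'. sem cs (subst f (Alt c d)) t t' \<and> R s' t')) \<and>
     (\<forall>t'. sem cs (subst f (Alt c d)) t t' \<longrightarrow> (\<exists>s'. sem bs (Alt c d) s s' \<and> R s' t')) \<and>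
     (\<forall>t'. vis cs (subst f (Alt c d)) t t' \<longrightarrow> V t')"
      using c1 d1 by simp blast
  qed
next
  case (Star c)
  then have c: "refines bs cs G R V c (subst f c)"
    by auto
  show ?case
    unfolding refines_def
  proof (intro allI impI)
    fix s t
    assume R: "R s t" and G: "\<forall>s'. vis bs (Star c) s s' \<longrightarrow> G s'"
    have G2: "\<And>s1. (sem bs c)\<^sup>*\<^sup>* s s1 \<Longrightarrow> \<forall>s'. vis bs c s1 s' \<longrightarrow> G s'"
      using G by auto
    have c1: "(\<forall>s'. sem bs c r s' \<longrightarrow> (\<exists>t'. sem cs (subst f c) t1 t' \<and> R s' t')) \<and>
      (\<forall>t'. sem cs (subst f c) t1 t' \<longrightarrow> (\<exists>s'. sem bs c r s' \<and> R s' t')) \<and>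
      (\<forall>t'. vis cs (subst f c) t1 t' \<longrightarrow> V t')" if "(sem bs c)\<^sup>*\<^sup>* s r" "R r t1" for r t1
      using c[unfolded refines_def] G2[OF that(1)] that(2) by blast
    have fw: "\<exists>t'. (sem cs (subst f c))\<^sup>*\<^sup>* t t' \<and> R s' t'" if "(sem bs c)\<^sup>*\<^sup>* s s'" for s'
      using that
    proof induction
      case base
      then show ?case using R by blast
    next
      case (step y z)
      then obtain t' where t': "(sem cs (subst f c))\<^sup>*\<^sup>* t t'" "R y t'" by blast
      with c1 step obtain t2 where "sem cs (subst f c) t' t2" "R z t2" by metis
      with t' show ?case by (meson rtranclp.rtrancl_into_rtrancl)
    qed
    have bw: "\<exists>s'. (sem bs c)\<^sup>*\<^sup>* s s' \<and> R s' t'" if "(sem cs (subst f c))\<^sup>*\<^sup>* t t'" for t'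
      using that
    proof induction
      case base
      then show ?case using R by blast
    next
      case (step y z)
      then obtain t' where t': "(sem bs c)\<^sup>*\<^sup>* s t'" "R t' y" by blast
      with c1 step obtain t2 where "sem bs c t' t2" "R t2 z" by metis
      with t' show ?case by (meson rtranclp.rtrancl_into_rtrancl)
    qed
    show "(\<forall>s'. sem bs (Star c) s s' \<longrightarrow> (\<exists>t'. sem cs (subst f (Star c)) t t' \<and> R s' t')) \<and>
     (\<forall>t'. sem cs (subst f (Star c)) t t' \<longrightarrow> (\<exists>s'. sem bs (Star c) s s' \<and> R s' t')) \<and>
     (\<forall>t'. vis cs (subst f (Star c)) t t' \<longrightarrow> V t')"
    proof (intro conjI allI impI)
      fix t' assume "vis cs (subst f (Star c)) t t'"
      then obtain r where r: "(sem cs (subst f c))\<^sup>*\<^sup>* t r" "vis cs (subst f c) r t'"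
        by auto
      with bw obtain s' where "(sem bs c)\<^sup>*\<^sup>* s s'" "R s' r" by blast
      with c1 r show "V t'" by metis
    qed (use fw bw in auto)
  qed
qed

text \<open>Flow graphs: the label \<open>None\<close> is a silent edge. The nodes from \<open>n\<close> on are fresh; no edge
  enters the entry \<open>a\<close> or leaves the exit \<open>b\<close>, which allows subgraphs to share them.\<close>

primrec csize :: "'b com \<Rightarrow> nat" where
  "csize (Basic b) = 0"
| "csize (Seq c d) = Suc (csize c + csize d)"
| "csize (Alt c d) = csize c + csize d"
| "csize (Star c) = Suc (Suc (csize c))"

primrec flow :: "'b com \<Rightarrow> nat \<Rightarrow> nat \<Rightarrow> nat \<Rightarrow> (nat \<times> 'b option \<times> nat) set" where
  "flow (Basic x) a b n = {(a, Some x, b)}"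
| "flow (Seq c d) a b n = flow c a n (Suc n) \<union> flow d n b (Suc n + csize c)"
| "flow (Alt c d) a b n = flow c a b n \<union> flow d a b (n + csize c)"
| "flow (Star c) a b n = {(a, None, n), (n, None, b), (Suc n, None, n)} \<union>
     flow c n (Suc n) (Suc (Suc n))"

lemma flow_nodes:
  "(l, x, l') \<in> flow c a b n \<Longrightarrow>
     (l = a \<or> n \<le> l \<and> l < n + csize c) \<and> (l' = b \<or> n \<le> l' \<and> l' < n + csize c)"
  by (induction c arbitrary: a b n) (auto, (fastforce)+)

lemma flow_labels: "(l, Some x, l') \<in> flow c a b n \<Longrightarrow> x \<in> basics c"
  by (induction c arbitrary: a b n) (auto, (fastforce)+)

lemma finite_flow: "finite (flow c a b n)"
  by (induction c arbitrary: a b n) auto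

definition fstep :: "('b \<Rightarrow> 's \<Rightarrow> 's \<Rightarrow> bool) \<Rightarrow> (nat \<times> 'b option \<times> nat) set \<Rightarrow>
    nat \<times> 's \<Rightarrow> nat \<times> 's \<Rightarrow> bool" where
  "fstep bs E p p' \<longleftrightarrow> (\<exists>x. (fst p, x, fst p') \<in> E \<and>
     (case x of None \<Rightarrow> snd p' = snd p | Some b \<Rightarrow> bs b (snd p) (snd p')))"

lemma fstep_mono: "(fstep bs E)\<^sup>*\<^sup>* p p' \<Longrightarrow> E \<subseteq> E' \<Longrightarrow> (fstep bs E')\<^sup>*\<^sup>* p p'"
  by (erule rtranclp_mono[THEN predicate2D, rotated]) (fastforce simp: fstep_def)

lemma flow_complete: "sem bs c s s' \<Longrightarrow> (fstep bs (flow c a b n))\<^sup>*\<^sup>* (a, s) (b, s')"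
proof (induction c arbitrary: a b n s s')
  case (Basic x)
  then show ?case by (intro r_into_rtranclp) (auto simp: fstep_def)
next
  case (Seq c d)
  then obtain r where "sem bs c s r" "sem bs d r s'" by auto
  with Seq.IH have "(fstep bs (flow c a n (Suc n)))\<^sup>*\<^sup>* (a, s) (n, r)"
    "(fstep bs (flow d n b (Suc n + csize c)))\<^sup>*\<^sup>* (n, r) (b, s')" by blast+
  then have "(fstep bs (flow (Seq c d) a b n))\<^sup>*\<^sup>* (a, s) (n, r)"
    "(fstep bs (flow (Seq c d) a b n))\<^sup>*\<^sup>* (n, r) (b, s')"
    by (auto elim: fstep_mono)
  then show ?case by auto
next
  case (Alt c d)
  then consider "sem bs c s s'" | "sem bs d s s'" by auto
  then show ?case
    by cases (auto intro: fstep_mono[OF Alt.IH(1)] fstep_mono[OF Alt.IH(2)])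
next
  case (Star c)
  let ?E = "flow (Star c) a b n"
  have 1: "fstep bs ?E (a, r) (n, r)" "fstep bs ?E (n, r) (b, r)" "fstep bs ?E (Suc n, r) (n, r)"
    for r
    by (auto simp: fstep_def)
  have 2: "(fstep bs ?E)\<^sup>*\<^sup>* (n, r) (Suc n, r')" if "sem bs c r r'" for r r'
    by (rule fstep_mono[OF Star.IH[OF that]]) auto
  have "(fstep bs ?E)\<^sup>*\<^sup>* (n, s) (n, r)" if "(sem bs c)\<^sup>*\<^sup>* s r" for r
    using that
  proof induction
    case (step y z)
    then show ?case using 2[OF step(2)] 1(3)[of z]
      by (meson rtranclp.rtrancl_into_rtrancl rtranclp_trans)
  qed auto
  then have "(fstep bs ?E)\<^sup>*\<^sup>* (n, s) (n, s')" using Star.prems by auto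
  then show ?case
    by (meson 1 converse_rtranclp_into_rtranclp rtranclp.rtrancl_into_rtrancl)
qed

text \<open>The induction needs all three cases: at the entry nothing has happened yet, at the exit
  the store is an outcome, and at a fresh node it is only known to be visited.\<close>

lemma flow_sound:
  assumes "(fstep bs (flow c a b n))\<^sup>*\<^sup>* (a, s) p" "a < n" "b < n" "a \<noteq> b"
  shows "p = (a, s) \<or> fst p = b \<and> sem bs c s (snd p) \<or>
    n \<le> fst p \<and> fst p < n + csize c \<and> vis bs c s (snd p)"
  using assms
proof (induction c arbitrary: a b n s p)
  case (Basic x)
  from Basic(1) show ?case
    by (induction rule: rtranclp_induct) (use Basic in \<open>auto simp: fstep_def\<close>)
next
  case (Seq c d)
  let ?E1 = "flow c a n (Suc n)" and ?E2 = "flow d n b (Suc n + csize c)"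
  have c: "p = (a, s) \<or> fst p = n \<and> sem bs c s (snd p) \<or>
    Suc n \<le> fst p \<and> fst p < Suc n + csize c \<and> vis bs c s (snd p)"
    if "(fstep bs ?E1)\<^sup>*\<^sup>* (a, s) p" for p
    using Seq.IH(1)[OF that] Seq.prems by simp
  have d: "p = (n, r) \<or> fst p = b \<and> sem bs d r (snd p) \<or>
    Suc n + csize c \<le> fst p \<and> fst p < Suc n + csize c + csize d \<and> vis bs d r (snd p)"
    if "(fstep bs ?E2)\<^sup>*\<^sup>* (n, r) p" for p r
    using Seq.IH(2)[OF that] Seq.prems by simp
  \<comment> \<open>The two subgraphs share only the node \<open>n\<close>, which \<open>c\<close>
    never leaves and \<open>d\<close> never re-enters, so a path crosses it at most once.\<close>
  have "(fstep bs ?E1)\<^sup>*\<^sup>* (a, s) p \<or> (\<exists>r. sem bs c s r \<and> (fstep bs ?E2)\<^sup>*\<^sup>* (n, r) p)"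
    using Seq.prems(1)
  proof (induction rule: rtranclp_induct)
    case base
    then show ?case by auto
  next
    case (step y z)
    from step(2) consider "fstep bs ?E1 y z" | "fstep bs ?E2 y z"
      unfolding fstep_def by auto
    then show ?case
    proof cases
      case 1
      then have y: "fst y = a \<or> Suc n \<le> fst y \<and> fst y < Suc n + csize c"
        using flow_nodes by (fastforce simp: fstep_def)
      from step(3) show ?thesis
      proof
        assume "(fstep bs ?E1)\<^sup>*\<^sup>* (a, s) y"
        then show ?thesis using 1 by (blast intro: rtranclp.rtrancl_into_rtrancl)
      next
        assume "\<exists>r. sem bs c s r \<and> (fstep bs ?E2)\<^sup>*\<^sup>* (n, r) y"
        then obtain r where "(fstep bs ?E2)\<^sup>*\<^sup>* (n, r) y" by blast
        from d[OF this] y Seq.prems show ?thesis by auto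
      qed
    next
      case 2
      then have y: "fst y = n \<or> Suc n + csize c \<le> fst y"
        using flow_nodes by (fastforce simp: fstep_def)
      from step(3) show ?thesis
      proof
        assume "(fstep bs ?E1)\<^sup>*\<^sup>* (a, s) y"
        from c[OF this] y Seq.prems have "fst y = n" "sem bs c s (snd y)" by auto
        then show ?thesis using 2 by (metis prod.collapse r_into_rtranclp)
      next
        assume "\<exists>r. sem bs c s r \<and> (fstep bs ?E2)\<^sup>*\<^sup>* (n, r) y"
        then show ?thesis using 2 by (meson rtranclp.rtrancl_into_rtrancl)
      qed
    qed
  qed
  then show ?case
  proof
    assume "(fstep bs ?E1)\<^sup>*\<^sup>* (a, s) p"
    from c[OF this] show ?thesis by (auto intro: sem_imp_vis)
  next
    assume "\<exists>r. sem bs c s r \<and> (fstep bs ?E2)\<^sup>*\<^sup>* (n, r) p"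
    then obtain r where r: "sem bs c s r" "(fstep bs ?E2)\<^sup>*\<^sup>* (n, r) p" by blast
    from d[OF r(2)] r(1) show ?thesis by (auto intro: sem_imp_vis)
  qed
next
  case (Alt c d)
  let ?E1 = "flow c a b n" and ?E2 = "flow d a b (n + csize c)"
  have c: "p = (a, s) \<or> fst p = b \<and> sem bs c s (snd p) \<or>
    n \<le> fst p \<and> fst p < n + csize c \<and> vis bs c s (snd p)"
    if "(fstep bs ?E1)\<^sup>*\<^sup>* (a, s) p" for p
    using Alt.IH(1)[OF that] Alt.prems by simp
  have d: "p = (a, s) \<or> fst p = b \<and> sem bs d s (snd p) \<or>
    n + csize c \<le> fst p \<and> fst p < n + csize c + csize d \<and> vis bs d s (snd p)"
    if "(fstep bs ?E2)\<^sup>*\<^sup>* (a, s) p" for p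
    using Alt.IH(2)[OF that] Alt.prems by simp
  have "(fstep bs ?E1)\<^sup>*\<^sup>* (a, s) p \<or> (fstep bs ?E2)\<^sup>*\<^sup>* (a, s) p"
    using Alt.prems(1)
  proof (induction rule: rtranclp_induct)
    case base
    then show ?case by auto
  next
    case (step y z)
    from step(2) consider "fstep bs ?E1 y z" | "fstep bs ?E2 y z"
      unfolding fstep_def by auto
    then show ?case
    proof cases
      case 1
      then have y: "fst y = a \<or> n \<le> fst y \<and> fst y < n + csize c"
        using flow_nodes by (fastforce simp: fstep_def)
      from step(3) show ?thesis
      proof
        assume "(fstep bs ?E1)\<^sup>*\<^sup>* (a, s) y"
        then show ?thesis using 1 by (blast intro: rtranclp.rtrancl_into_rtrancl)
      next
        assume "(fstep bs ?E2)\<^sup>*\<^sup>* (a, s) y"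
        from d[OF this] y Alt.prems have "y = (a, s)" by auto
        then show ?thesis using 1 by blast
      qed
    next
      case 2
      then have y: "fst y = a \<or> n + csize c \<le> fst y"
        using flow_nodes by (fastforce simp: fstep_def)
      from step(3) show ?thesis
      proof
        assume "(fstep bs ?E2)\<^sup>*\<^sup>* (a, s) y"
        then show ?thesis using 2 by (blast intro: rtranclp.rtrancl_into_rtrancl)
      next
        assume "(fstep bs ?E1)\<^sup>*\<^sup>* (a, s) y"
        from c[OF this] y Alt.prems have "y = (a, s)" by auto
        then show ?thesis using 2 by blast
      qed
    qed
  qed
  then show ?case using c d by fastforce
next
  case (Star c)
  let ?E = "flow c n (Suc n) (Suc (Suc n))"
  have c: "p = (n, r) \<or> fst p = Suc n \<and> sem bs c r (snd p) \<or>
    Suc (Suc n) \<le> fst p \<and> fst p < Suc (Suc n) + csize c \<and> vis bs c r (snd p)"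
    if "(fstep bs ?E)\<^sup>*\<^sup>* (n, r) p" for p r
    using Star.IH[OF that] by simp
  \<comment> \<open>\<open>n\<close> is the hub of the loop. The body ends in the separate node
    \<open>Suc n\<close>, because the induction hypothesis requires distinct entry and exit, and a
    silent edge leads back to the hub.\<close>
  have "p = (a, s) \<or> (\<exists>r. (sem bs c)\<^sup>*\<^sup>* s r \<and> (p = (b, r) \<or> (fstep bs ?E)\<^sup>*\<^sup>* (n, r) p))"
    using Star.prems(1)
  proof (induction rule: rtranclp_induct)
    case base
    then show ?case by auto
  next
    case (step y z)
    let ?Q = "\<lambda>p. p = (a, s) \<or> (\<exists>r. (sem bs c)\<^sup>*\<^sup>* s r \<and> (p = (b, r) \<or> (fstep bs ?E)\<^sup>*\<^sup>* (n, r) p))"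
    have Q: "y = (a, s) \<or> (\<exists>r. (sem bs c)\<^sup>*\<^sup>* s r \<and> (y = (b, r) \<or> y = (n, r) \<or>
        (fstep bs ?E)\<^sup>*\<^sup>* (n, r) y \<and> (fst y = Suc n \<and> sem bs c r (snd y) \<or> Suc (Suc n) \<le> fst y)))"
      using step(3) c by blast
    from step(2) consider "fstep bs ?E y z" | "fst y = a" "fst z = n" "snd z = snd y"
      | "fst y = n" "fst z = b" "snd z = snd y" | "fst y = Suc n" "fst z = n" "snd z = snd y"
      unfolding fstep_def by auto
    then show ?case
    proof cases
      case 1
      then have y: "fst y = n \<or> Suc (Suc n) \<le> fst y"
        using flow_nodes by (fastforce simp: fstep_def)
      from Q y Star.prems obtain r where "(sem bs c)\<^sup>*\<^sup>* s r" "(fstep bs ?E)\<^sup>*\<^sup>* (n, r) y"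
        by fastforce
      then show ?thesis using 1 by (meson rtranclp.rtrancl_into_rtrancl)
    next
      case 2
      with Q Star.prems have "y = (a, s)" by fastforce
      with 2 have "z = (n, s)" by (simp add: prod_eq_iff)
      then show ?thesis by blast
    next
      case 3
      with Q Star.prems obtain r where "(sem bs c)\<^sup>*\<^sup>* s r" "y = (n, r)" by auto
      then have "(sem bs c)\<^sup>*\<^sup>* s (snd y)" by simp
      with 3 show ?thesis by (metis prod.collapse)
    next
      case 4
      with Q Star.prems obtain r where "(sem bs c)\<^sup>*\<^sup>* s r" "sem bs c r (snd y)"
        by fastforce
      then have "(sem bs c)\<^sup>*\<^sup>* s (snd y)" by simp
      moreover have "z = (n, snd y)" using 4 by (simp add: prod_eq_iff)
      ultimately show ?thesis by blast
    qed
  qed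
  then consider "p = (a, s)" | r where "(sem bs c)\<^sup>*\<^sup>* s r" "p = (b, r)"
    | r where "(sem bs c)\<^sup>*\<^sup>* s r" "(fstep bs ?E)\<^sup>*\<^sup>* (n, r) p" by blast
  then show ?case
  proof cases
    case 3
    from c[OF 3(2)] 3(1) show ?thesis by (auto intro: sem_imp_vis)
  qed auto
qed

lemma flow_exit_iff: "(fstep bs (flow c 0 1 2))\<^sup>*\<^sup>* (0, s) (1, s') \<longleftrightarrow> sem bs c s s'"
  using flow_sound[of bs c 0 1 2 s "(1, s')"] flow_complete[of bs c s s' 0 1 2] by auto

lemma flow_imp_vis: "(fstep bs (flow c 0 1 2))\<^sup>*\<^sup>* (0, s) p \<Longrightarrow> vis bs c s (snd p)"
  using flow_sound[of bs c 0 1 2 s p] by (auto intro: sem_imp_vis)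

section \<open>Programs on work tapes as Turing machines\<close>

datatype 'i instr = Read nat "nat set" | Write nat nat | Move nat move | IMove move | ICell "'i cell set"

fun isem :: "'i list \<Rightarrow> 'i instr \<Rightarrow> nat \<times> tape list \<Rightarrow> nat \<times> tape list \<Rightarrow> bool" where
  "isem w (Read r S) (h, ts) t \<longleftrightarrow> t = (h, ts) \<and> read_tape (ts ! r) \<in> S"
| "isem w (Write r s) (h, ts) t \<longleftrightarrow> t = (h, ts[r := act_tape (ts ! r) (s, Stay)])"
| "isem w (Move r d) (h, ts) t \<longleftrightarrow> t = (h, ts[r := move_tape d (ts ! r)])"
| "isem w (IMove d) (h, ts) t \<longleftrightarrow> t = (move_input w d h, ts)"
| "isem w (ICell S) (h, ts) t \<longleftrightarrow> t = (h, ts) \<and> input_cell w h \<in> S"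

fun enabled :: "'i instr option \<Rightarrow> 'i cell \<Rightarrow> nat list \<Rightarrow> bool" where
  "enabled (Some (Read r S)) i rs \<longleftrightarrow> rs ! r \<in> S"
| "enabled (Some (ICell S)) i rs \<longleftrightarrow> i \<in> S"
| "enabled _ i rs \<longleftrightarrow> True"

fun input_move :: "'i instr option \<Rightarrow> move" where
  "input_move (Some (IMove d)) = d"
| "input_move _ = Stay"

fun tape_acts :: "'i instr option \<Rightarrow> nat list \<Rightarrow> (nat \<times> move) list" where
  "tape_acts (Some (Write r s)) rs = (map (\<lambda>x. (x, Stay)) rs)[r := (s, Stay)]"
| "tape_acts (Some (Move r d)) rs = (map (\<lambda>x. (x, Stay)) rs)[r := (rs ! r, d)]"
| "tape_acts _ rs = map (\<lambda>x. (x, Stay)) rs"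

fun instr_ok :: "nat \<Rightarrow> 'i instr \<Rightarrow> bool" where
  "instr_ok k (Read r S) \<longleftrightarrow> r < k"
| "instr_ok k (Write r s) \<longleftrightarrow> r < k \<and> s \<le> 2"
| "instr_ok k (Move r d) \<longleftrightarrow> r < k"
| "instr_ok k _ \<longleftrightarrow> True"

definition cells :: "'i set \<Rightarrow> 'i cell set" where
  "cells A = {Left_End, Right_End} \<union> Symbol ` A"

text \<open>Tests may use infinite sets such as \<open>- {0}\<close>. Finiteness comes from listing
  only the three work symbols and the input cells over \<open>A\<close> as scanned symbols.\<close>

definition flow_transitions ::
  "'i set \<Rightarrow> nat \<Rightarrow> (nat \<times> 'i instr option \<times> nat) set \<Rightarrow> 'i ntm_transition set" where
  "flow_transitions A k E =
     {(l, i, rs, l', d, acts). \<exists>x. (l, x, l') \<in> E \<and> i \<in> cells A \<and>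
        length rs = k \<and> set rs \<subseteq> {0, 1, 2} \<and> enabled x i rs \<and>
        d = input_move x \<and> acts = tape_acts x rs}"

lemma finite_flow_transitions:
  assumes "finite A" "finite E"
  shows "finite (flow_transitions A k E)"
proof -
  let ?V = "{rs. set rs \<subseteq> {0, 1, 2 :: nat} \<and> length rs = k}"
  have "flow_transitions A k E \<subseteq>
     (\<lambda>((l, x, l'), i, rs). (l, i, rs, l', input_move x, tape_acts x rs)) ` (E \<times> cells A \<times> ?V)"
  proof
    fix y assume "y \<in> flow_transitions A k E"
    then obtain l x l' i rs where "y = (l, i, rs, l', input_move x, tape_acts x rs)"
      "(l, x, l') \<in> E" "i \<in> cells A" "rs \<in> ?V"
      by (auto simp: flow_transitions_def)
    then show "y \<in> (\<lambda>((l, x, l'), i, rs). (l, i, rs, l', input_move x, tape_acts x rs)) `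
        (E \<times> cells A \<times> ?V)"
      by (intro image_eqI[of _ _ "((l, x, l'), i, rs)"]) auto
  qed
  moreover have "finite ?V" by (rule finite_lists_length_eq) simp
  ultimately show ?thesis
    using assms by (auto simp: cells_def intro: finite_subset)
qed

lemma length_tape_acts [simp]: "length (tape_acts x rs) = length rs"
  by (induction x rs rule: tape_acts.induct) auto

definition valid_tapes :: "nat \<Rightarrow> tape list \<Rightarrow> bool" where
  "valid_tapes k ts \<longleftrightarrow> length ts = k \<and>
     (\<forall>r<k. snd (ts ! r) < length (fst (ts ! r)) \<and> set (fst (ts ! r)) \<subseteq> {0, 1, 2})"

lemma read_valid_tapes:
  assumes "valid_tapes k ts"
  shows "set (map read_tape ts) \<subseteq> {0, 1, 2}"
proof
  fix x assume "x \<in> set (map read_tape ts)"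
  then obtain r where r: "r < k" "x = read_tape (ts ! r)"
    using assms by (auto simp: in_set_conv_nth valid_tapes_def)
  obtain cs p where "ts ! r = (cs, p)" by fastforce
  moreover have "snd (ts ! r) < length (fst (ts ! r))" "set (fst (ts ! r)) \<subseteq> {0, 1, 2}"
    using assms r(1) unfolding valid_tapes_def by blast+
  ultimately have "x = cs ! p" "p < length cs" "set cs \<subseteq> {0, 1, 2}"
    using r(2) by simp_all
  then show "x \<in> {0, 1, 2}" by (meson nth_mem subsetD)
qed

lemma act_tape_read [simp]: "act_tape t (read_tape t, d) = move_tape d t"
  by (cases t) simp

lemma move_tape_Stay [simp]: "move_tape Stay t = t"
  by (cases t) simp

lemma map2_tape_acts:
  assumes "length ts = k" "case x of None \<Rightarrow> True | Some i \<Rightarrow> instr_ok k i"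
  shows "map2 act_tape ts (tape_acts x (map read_tape ts)) =
    (case x of Some (Write r s) \<Rightarrow> ts[r := act_tape (ts ! r) (s, Stay)]
     | Some (Move r d) \<Rightarrow> ts[r := move_tape d (ts ! r)] | _ \<Rightarrow> ts)"
  using assms
  by (auto split: option.splits instr.splits intro!: nth_equalityI simp: nth_list_update)

lemma valid_tapes_update:
  "valid_tapes k ts \<Longrightarrow> snd t < length (fst t) \<Longrightarrow> set (fst t) \<subseteq> {0, 1, 2} \<Longrightarrow>
     valid_tapes k (ts[r := t])"
  by (cases "r < k") (simp_all add: valid_tapes_def nth_list_update)

lemma valid_move_tape:
  assumes "snd t < length (fst t)" "set (fst t) \<subseteq> {0, 1, 2}"
  shows "snd (move_tape d t) < length (fst (move_tape d t)) \<and> set (fst (move_tape d t)) \<subseteq> {0, 1, 2}"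
  using assms by (cases t; cases d) auto

lemma valid_isem:
  assumes "isem w x (h, ts) (h', ts')" "valid_tapes k ts" "instr_ok k x"
  shows "valid_tapes k ts'"
proof (cases x)
  case (Write r s)
  obtain cs p where t: "ts ! r = (cs, p)" by fastforce
  have "r < k" "s \<in> {0, 1, 2}" using Write assms(3) by auto
  moreover from this assms(2)
  have "snd (ts ! r) < length (fst (ts ! r))" "set (fst (ts ! r)) \<subseteq> {0, 1, 2}"
    unfolding valid_tapes_def by blast+
  ultimately have cs: "p < length cs" "set cs \<subseteq> {0, 1, 2}" "s \<in> {0, 1, 2}"
    using t by simp_all
  have "set (cs[p := s]) \<subseteq> {0, 1, 2}"
    using set_update_subset_insert[of cs p s] cs by blast
  then show ?thesis
    using Write assms t cs by (auto intro!: valid_tapes_update)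
next
  case (Move r d)
  then have "snd (ts ! r) < length (fst (ts ! r))" "set (fst (ts ! r)) \<subseteq> {0, 1, 2}"
    using assms by (auto simp: valid_tapes_def)
  from valid_move_tape[OF this, of d] show ?thesis
    using Move assms by (auto intro!: valid_tapes_update)
qed (use assms in auto)

lemma input_cell_in_cells: "w \<in> lists A \<Longrightarrow> input_cell w h \<in> cells A"
  by (auto simp: cells_def)

definition ntm_of :: "'i set \<Rightarrow> nat \<Rightarrow> 'i instr com \<Rightarrow> 'i ntm" where
  "ntm_of A k c = \<lparr>work_tapes = k, start_state = 0, accept_state = 1,
     ntm_transitions = flow_transitions A k (flow c 0 1 2)\<rparr>"

lemma wf_ntm_of: "finite A \<Longrightarrow> wf_ntm (ntm_of A k c)"
  by (auto simp: wf_ntm_def ntm_of_def finite_flow_transitions finite_flow)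
    (auto simp: flow_transitions_def)

text \<open>With valid tapes and an input over \<open>A\<close>, every scanned symbol is among the
  finitely many for which transitions were generated, so the restriction loses no step.\<close>

lemma ntm_step_iff:
  assumes "valid_tapes k ts" "w \<in> lists A" "\<forall>x\<in>basics c. instr_ok k x"
  shows "ntm_step (ntm_of A k c) w (l, h, ts) (l', h', ts') \<longleftrightarrow>
    fstep (isem w) (flow c 0 1 2) (l, (h, ts)) (l', (h', ts'))"
proof -
  let ?E = "flow c 0 1 2"
  have ok: "case x of None \<Rightarrow> True | Some i \<Rightarrow> instr_ok k i" if "(l, x, l') \<in> ?E" for x
    using that assms(3) flow_labels by (fastforce split: option.splits)
  have len: "length ts = k" using assms(1) by (simp add: valid_tapes_def)
  have "ntm_step (ntm_of A k c) w (l, h, ts) (l', h', ts') \<longleftrightarrow>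
    (\<exists>x. (l, x, l') \<in> ?E \<and> enabled x (input_cell w h) (map read_tape ts) \<and>
       h' = move_input w (input_move x) h \<and>
       ts' = map2 act_tape ts (tape_acts x (map read_tape ts)))"
    using len read_valid_tapes[OF assms(1)] input_cell_in_cells[OF assms(2), of h]
    by (auto simp: ntm_step.simps ntm_of_def flow_transitions_def simp del: input_cell.simps)
  also have "\<dots> \<longleftrightarrow> (\<exists>x. (l, x, l') \<in> ?E \<and>
      (case x of None \<Rightarrow> (h', ts') = (h, ts) | Some i \<Rightarrow> isem w i (h, ts) (h', ts')))"
  proof (intro iff_exI conj_cong refl)
    fix x assume x: "(l, x, l') \<in> ?E"
    note m = map2_tape_acts[OF len ok[OF x]]
    show "(enabled x (input_cell w h) (map read_tape ts) \<and>
       h' = move_input w (input_move x) h \<and>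
       ts' = map2 act_tape ts (tape_acts x (map read_tape ts))) \<longleftrightarrow>
      (case x of None \<Rightarrow> (h', ts') = (h, ts) | Some i \<Rightarrow> isem w i (h, ts) (h', ts'))"
    proof (cases x)
      case (Some i)
      then show ?thesis
        using m ok[OF x] len by (cases i) (auto simp del: input_cell.simps)
    qed (use m in auto)
  qed
  also have "\<dots> \<longleftrightarrow> fstep (isem w) ?E (l, (h, ts)) (l', (h', ts'))"
    by (simp add: fstep_def cong: option.case_cong)
  finally show ?thesis .
qed

text \<open>Computations of the machine are paths in the flow graph from node 0. Validity of the
  tapes is carried along such a path, so that machine steps and edges can be exchanged
  throughout.\<close>

theorem ntm_of_correct:
  assumes "finite A" "w \<in> lists A" "\<forall>x\<in>basics c. instr_ok k x"
  defines "M \<equiv> ntm_of A k c" and "s0 \<equiv> (0, replicate k ([0], 0))"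
  shows "accepts M w \<longleftrightarrow> (\<exists>s. sem (isem w) c s0 s)"
    and "reachable_config M w (l, h, ts) \<Longrightarrow> vis (isem w) c s0 (h, ts)"
proof -
  let ?E = "flow c 0 1 2"
  have init: "initial_config M = (0, s0)"
    by (simp add: initial_config_def M_def ntm_of_def s0_def)
  have v0: "valid_tapes k (snd s0)"
    by (simp add: valid_tapes_def s0_def)
  have fw: "(fstep (isem w) ?E)\<^sup>*\<^sup>* (0, s0) x \<and> valid_tapes k (snd (snd x))"
    if "(ntm_step M w)\<^sup>*\<^sup>* (0, s0) x" for x
    using that
  proof induction
    case base
    then show ?case using v0 by simp
  next
    case (step y z)
    obtain l h ts l' h' ts' where yz: "y = (l, h, ts)" "z = (l', h', ts')" by (metis prod.collapse)
    with step ntm_step_iff[of k ts w A c] assms(2,3)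
    have 1: "fstep (isem w) ?E y z" by (auto simp: M_def)
    then obtain o' where o': "(l, o', l') \<in> ?E"
      "case o' of None \<Rightarrow> (h', ts') = (h, ts) | Some i \<Rightarrow> isem w i (h, ts) (h', ts')"
      by (auto simp: fstep_def yz cong: option.case_cong)
    have "valid_tapes k ts'"
    proof (cases o')
      case None
      then show ?thesis using o' step yz by simp
    next
      case (Some i)
      then have "instr_ok k i" using o' flow_labels assms(3) by metis
      then show ?thesis using Some o' step yz valid_isem[of w i h ts h' ts' k] by simp
    qed
    moreover have "(fstep (isem w) ?E)\<^sup>*\<^sup>* (0, s0) z"
      using 1 step(3) by (blast intro: rtranclp.rtrancl_into_rtrancl)
    ultimately show ?case using yz by simp
  qed
  have bw: "(ntm_step M w)\<^sup>*\<^sup>* (0, s0) x" if "(fstep (isem w) ?E)\<^sup>*\<^sup>* (0, s0) x" for x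
    using that
  proof induction
    case (step y z)
    obtain l h ts l' h' ts' where yz: "y = (l, h, ts)" "z = (l', h', ts')" by (metis prod.collapse)
    have "valid_tapes k ts" using fw[OF step(3)] yz by simp
    from ntm_step_iff[OF this assms(2,3)] step(2)
    have "ntm_step M w y z" by (simp add: yz M_def)
    with step(3) show ?case by (blast intro: rtranclp.rtrancl_into_rtrancl)
  qed simp
  have acc: "accept_state M = 1" by (simp add: M_def ntm_of_def)
  show "accepts M w \<longleftrightarrow> (\<exists>s. sem (isem w) c s0 s)"
    unfolding accepts_def reachable_config_def init acc
    using fw bw flow_exit_iff[of "isem w" c s0] by (metis surj_pair)
  show "vis (isem w) c s0 (h, ts)" if "reachable_config M w (l, h, ts)"
    using flow_imp_vis[of "isem w" c s0 "(l, h, ts)"] fw that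
    by (auto simp: reachable_config_def init)
qed

section \<open>Registers stored in bijective binary on tapes\<close>

text \<open>Registers hold natural numbers in bijective base 2, least significant digit first.\<close>

fun digs :: "nat \<Rightarrow> nat list" where
  "digs 0 = []"
| "digs (Suc m) = (if even m then 1 else 2) # digs (m div 2)"

primrec dval :: "nat list \<Rightarrow> nat" where
  "dval [] = 0"
| "dval (d # ds) = d + 2 * dval ds"

lemma dval_digs: "dval (digs n) = n"
  by (induction n rule: digs.induct) auto

lemma set_digs: "set (digs n) \<subseteq> {1, 2}"
  by (induction n rule: digs.induct) auto

lemma digs_dval: "set ds \<subseteq> {1, 2} \<Longrightarrow> digs (dval ds) = ds"
proof (induction ds)
  case (Cons d ds)
  have "digs (1 + 2 * v) = 1 # digs v" "digs (2 + 2 * v) = 2 # digs v" for v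
    by simp_all
  moreover have "d = 1 \<or> d = 2" "digs (dval ds) = ds" using Cons by auto
  ultimately show ?case by auto
qed simp

lemma digs_eqI: "set ds \<subseteq> {1, 2} \<Longrightarrow> dval ds = n \<Longrightarrow> digs n = ds"
  using digs_dval by blast

lemma dval_carry: "dval (replicate j 1 @ 2 # ds) = Suc (dval (replicate j 2 @ 1 # ds))"
  by (induction j) auto

lemma dval_carry_end: "dval (replicate j 1 @ [1]) = Suc (dval (replicate j 2))"
  by (induction j) auto

text \<open>Among the words of length \<open>l\<close> the one with all digits 1 has the least
  value, \<open>2 ^ l - 1\<close>.\<close>

lemma power_le_dval: "set ds \<subseteq> {1, 2} \<Longrightarrow> 2 ^ length ds \<le> Suc (dval ds)"
  by (induction ds) auto

lemma power_length_digs: "2 ^ length (digs n) \<le> Suc n"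
  using power_le_dval[OF set_digs, of n] by (simp add: dval_digs)

section \<open>Arithmetic on a single tape\<close>

datatype tinstr = TRead "nat set" | TWrite nat | TMove move

fun tsem :: "tinstr \<Rightarrow> tape \<Rightarrow> tape \<Rightarrow> bool" where
  "tsem (TRead S) t t' \<longleftrightarrow> t' = t \<and> read_tape t \<in> S"
| "tsem (TWrite s) t t' \<longleftrightarrow> t' = act_tape t (s, Stay)"
| "tsem (TMove d) t t' \<longleftrightarrow> t' = move_tape d t"

fun on_tape :: "nat \<Rightarrow> tinstr \<Rightarrow> 'i instr" where
  "on_tape r (TRead S) = Read r S"
| "on_tape r (TWrite s) = Write r s"
| "on_tape r (TMove d) = Move r d"

definition short :: "nat \<Rightarrow> tape \<Rightarrow> bool" where
  "short L t \<longleftrightarrow> length (fst t) \<le> L"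

text \<open>The relation fixes the input head and all tapes except tape \<open>r\<close>, so a
  one-tape program is transferred unchanged to a machine with many tapes.\<close>

lemma exec_on_tape:
  assumes "r < length ts"
  shows "refines tsem (isem w) (short L) (\<lambda>t s. s = (h, ts[r := t]))
     (\<lambda>s. \<exists>u. short L u \<and> s = (h, ts[r := u])) c (subst (\<lambda>b. Basic (on_tape r b)) c)"
proof (rule refines_subst)
  fix b
  show "refines tsem (isem w) (short L) (\<lambda>t s. s = (h, ts[r := t]))
     (\<lambda>s. \<exists>u. short L u \<and> s = (h, ts[r := u])) (Basic b) (Basic (on_tape r b))"
    using assms by (cases b) (auto simp: refines_def simp del: split_paired_All split_paired_Ex)
qed

text \<open>The head may be one cell beyond the visited part, which is then extended by a blank.\<close>

definition head_at :: "nat list \<Rightarrow> nat \<Rightarrow> tape" where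
  "head_at cs p = (if p < length cs then cs else cs @ [0::nat], p)"

definition carry :: "nat \<Rightarrow> nat \<Rightarrow> tinstr com" where
  "carry x y = while (TRead {x}) (TRead (- {x})) (Seq (Basic (TWrite y)) (Basic (TMove Move_Right)))"

text \<open>The head stops at the first symbol other than \<open>x\<close>. If the written part ends
  there, this is a cell not visited before, which accounts for the additional cell in the third
  premise.\<close>

lemma exec_carry:
  assumes "rest = [] \<or> hd rest \<noteq> x" "x \<noteq> 0" "Suc (length (pre @ replicate j x @ rest)) \<le> L \<or>
    rest \<noteq> [] \<and> length (pre @ replicate j x @ rest) \<le> L"
  shows "exec tsem (carry x y) (head_at (pre @ replicate j x @ rest) (length pre))
    (head_at (pre @ replicate j y @ rest) (length pre + j)) (short L)"
  using assms(3)
proof (induction j arbitrary: pre)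
  case 0
  then have "exec tsem (carry x y) (head_at (pre @ rest) (length pre))
      (head_at (pre @ rest) (length pre)) (short L)"
    unfolding carry_def using assms(1,2)
    by (intro exec_while_false) (auto simp: head_at_def short_def nth_append hd_conv_nth)
  then show ?case by simp
next
  case (Suc j)
  have "exec tsem (carry x y) (head_at ((pre @ [y]) @ replicate j x @ rest) (length (pre @ [y])))
    (head_at ((pre @ [y]) @ replicate j y @ rest) (length (pre @ [y]) + j)) (short L)"
    using Suc.prems by (intro Suc.IH) auto
  then have *: "exec tsem (carry x y) (head_at (pre @ y # replicate j x @ rest) (Suc (length pre)))
    (head_at (pre @ replicate (Suc j) y @ rest) (length pre + Suc j)) (short L)"
    by simp
  have 1: "exec tsem (Seq (Basic (TWrite y)) (Basic (TMove Move_Right)))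
     (head_at (pre @ replicate (Suc j) x @ rest) (length pre))
     (head_at (pre @ y # replicate j x @ rest) (Suc (length pre))) (short L)"
    using Suc.prems
    by (intro exec_Seq[OF exec_Basic exec_Basic, of _ _ _ "head_at (pre @ y # replicate j x @ rest) (length pre)"])
       (auto simp: head_at_def short_def)
  show ?case
    unfolding carry_def
    by (rule exec_while_true[OF _ _ 1 *[unfolded carry_def]]) (auto simp: head_at_def nth_append)
qed

text \<open>Intended for tapes whose cell 0 is blank while the digits are not: the nearest blank to
  the left is then the beginning of the tape.\<close>

definition rewind :: "tinstr com" where
  "rewind = while (TRead (- {0})) (TRead {0}) (Basic (TMove Move_Left))"

lemma exec_rewind:
  assumes "cs ! 0 = 0" "p < length cs" "\<forall>i. 0 < i \<longrightarrow> i \<le> p \<longrightarrow> cs ! i \<noteq> 0" "length cs \<le> L"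
  shows "exec tsem rewind (cs, p) (cs, 0) (short L)"
  using assms(2,3)
proof (induction p)
  case 0
  then show ?case
    unfolding rewind_def using assms by (intro exec_while_false) (auto simp: short_def)
next
  case (Suc p)
  then have *: "exec tsem rewind (cs, p) (cs, 0) (short L)" by auto
  show ?case
    unfolding rewind_def
    by (rule exec_while_true[OF _ _ exec_Basic *[unfolded rewind_def]])
       (use Suc.prems assms in \<open>auto simp: short_def\<close>)
qed

abbreviation right where "right \<equiv> Basic (TMove Move_Right)"
abbreviation left where "left \<equiv> Basic (TMove Move_Left)"

lemma exec_guard:
  "read_tape t \<in> S \<Longrightarrow> V t \<Longrightarrow> exec tsem c t t' V \<Longrightarrow> exec tsem (Seq (Basic (TRead S)) c) t t' V"
  by (rule exec_Seq[OF exec_Basic]) auto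

lemma dead_guard: "read_tape t \<notin> S \<Longrightarrow> V t \<Longrightarrow> dead tsem (Seq (Basic (TRead S)) c) t V"
  by (rule dead_Seq[OF dead_Basic]) auto

text \<open>In bijective base 2 the carry of the successor turns each leading 2 into 1. It is
  absorbed by a 1, which becomes 2, or else appends a new digit 1.\<close>

definition tinc :: "tinstr com" where
  "tinc = Seq right (Seq (carry 2 1)
     (Seq (Alt (Seq (Basic (TRead {1})) (Basic (TWrite 2))) (Seq (Basic (TRead {0})) (Basic (TWrite 1))))
        rewind))"

text \<open>The borrow turns each leading 1 into 2 and is absorbed by a 2, which becomes 1. If no
  such digit follows, the word is one digit too long and its last digit is erased; the second
  \<open>left\<close> steps off the erased cell, where \<open>rewind\<close> would stop at once. For
  the number 0 the erased cell is the blank cell 0, so 0 is left unchanged.\<close>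

definition tdec :: "tinstr com" where
  "tdec = Seq right (Seq (carry 1 2)
     (Seq (Alt (Seq (Basic (TRead {2})) (Basic (TWrite 1)))
         (Seq (Basic (TRead {0})) (Seq left (Seq (Basic (TWrite 0)) left))))
        rewind))"

definition tzero :: "tinstr com" where
  "tzero = Seq right (Seq (Basic (TRead {0})) left)"

definition tnonzero :: "tinstr com" where
  "tnonzero = Seq right (Seq (Basic (TRead (- {0}))) left)"

text \<open>Every word over \<open>{1, 2}\<close> is a numeral, so the blank is free to act as
  delimiter: cell 0 is a left marker, and the \<open>j\<close> trailing blanks are cells visited or
  emptied before, which a tape never gives back.\<close>

definition holds :: "nat \<Rightarrow> nat \<Rightarrow> tape \<Rightarrow> bool" where
  "holds L n t \<longleftrightarrow> (\<exists>j. t = (0 # digs n @ replicate j 0, 0)) \<and> length (fst t) \<le> L"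

text \<open>\<open>3 - x\<close> is the other digit. These are the two fates of a carry: absorbed
  inside the word or running off its end.\<close>

lemma leading:
  assumes "set ds \<subseteq> {1, 2}" "x \<in> {1, 2 :: nat}"
  obtains j ds' where "ds = replicate j x @ (3 - x) # ds'" | j where "ds = replicate j x"
proof -
  have "(\<exists>j ds'. ds = replicate j x @ (3 - x) # ds') \<or> (\<exists>j. ds = replicate j x)"
    using assms(1)
  proof (induction ds)
    case (Cons d ds)
    show ?case
    proof (cases "d = x")
      case True
      with Cons show ?thesis by (metis append_Cons insert_subset list.simps(15) replicate_Suc)
    next
      case False
      then have "d = 3 - x" using Cons.prems assms(2) by auto
      then show ?thesis by (metis append_Nil replicate_0)
    qed
  qed (metis replicate_0)
  then show ?thesis using that by blast
qed

lemma exec_right_0: 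
  "length cs \<le> L \<Longrightarrow> Suc (Suc 0) \<le> L \<Longrightarrow> cs \<noteq> [] \<Longrightarrow> exec tsem right (cs, 0) (head_at cs (Suc 0)) (short L)"
  by (intro exec_Basic) (auto simp: head_at_def short_def Suc_le_eq)

lemma holdsI: "digs n = ds \<Longrightarrow> Suc (length ds + j) \<le> L \<Longrightarrow> holds L n (0 # ds @ replicate j 0, 0)"
  by (auto simp: holds_def)

text \<open>The slack of 2 consists of the marker cell and one cell beyond the digits, into which
  the head and possibly a new digit move.\<close>

lemma exec_tinc:
  assumes "holds L n t" "length (digs n) + 2 \<le> L"
  shows "\<exists>t'. exec tsem tinc t t' (short L) \<and> holds L (Suc n) t'"
proof -
  from assms(1) obtain z where t: "t = (0 # digs n @ replicate z 0, 0)"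
    and L: "length (0 # digs n @ replicate z 0) \<le> L"
    by (auto simp: holds_def)
  show ?thesis
  proof (rule leading[OF set_digs[of n], of 2])
    fix j ds assume n: "digs n = replicate j 2 @ (3 - 2) # ds"
    let ?b = "replicate z 0"
    have n': "digs (Suc n) = replicate j 1 @ 2 # ds"
      using set_digs[of n] n dval_digs[of n] by (intro digs_eqI) (auto simp: dval_carry[simplified])
    let ?cs = "0 # replicate j 1 @ 2 # ds @ ?b"
    have "exec tsem tinc t (?cs, 0) (short L)"
      unfolding tinc_def
    proof (intro exec_Seq)
      show "exec tsem right t (head_at ([0::nat] @ replicate j 2 @ 1 # ds @ ?b) (length [0::nat])) (short L)"
        using exec_right_0[of "fst t" L] L assms(2) by (simp add: t n)
      show "exec tsem (carry 2 1) (head_at ([0::nat] @ replicate j 2 @ 1 # ds @ ?b) (length [0::nat]))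
         (head_at ([0::nat] @ replicate j 1 @ 1 # ds @ ?b) (length [0::nat] + j)) (short L)"
        using L by (intro exec_carry) (auto simp: n)
      show "exec tsem (Alt (Seq (Basic (TRead {1})) (Basic (TWrite 2)))
           (Seq (Basic (TRead {0})) (Basic (TWrite 1))))
        (head_at ([0::nat] @ replicate j 1 @ 1 # ds @ ?b) (length [0::nat] + j)) (?cs, Suc j) (short L)"
        by (rule exec_Alt1[OF exec_guard[OF _ _ exec_Basic] dead_guard])
          (use L in \<open>auto simp: head_at_def n short_def nth_append list_update_append\<close>)
      show "exec tsem rewind (?cs, Suc j) (?cs, 0) (short L)"
        using L by (intro exec_rewind) (auto simp: n nth_append nth_Cons split: nat.splits)
    qed
    then show ?thesis
      using L holdsI[OF n', of z L] by (intro exI[of _ "(?cs, 0)"]) (simp add: n)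
  next
    fix j assume n: "digs n = replicate j 2"
    \<comment> \<open>The new digit takes the place of a trailing blank if there is one. For
      \<open>z = 0\<close> the tape grows, and the truncated difference is 0 as required.\<close>
    let ?b = "replicate z 0" and ?b' = "replicate (z - 1) (0::nat)"
    have n': "digs (Suc n) = replicate j 1 @ [1]"
      using dval_digs[of n] dval_carry_end[of j] by (intro digs_eqI) (auto simp: n)
    let ?cs = "0 # replicate j 1 @ 1 # ?b'"
    have "exec tsem tinc t (?cs, 0) (short L)"
      unfolding tinc_def
    proof (intro exec_Seq)
      show "exec tsem right t (head_at ([0::nat] @ replicate j 2 @ ?b) (length [0::nat])) (short L)"
        using exec_right_0[of "fst t" L] L assms(2) by (simp add: t n)
      show "exec tsem (carry 2 1) (head_at ([0::nat] @ replicate j 2 @ ?b) (length [0::nat]))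
         (head_at ([0::nat] @ replicate j 1 @ ?b) (length [0::nat] + j)) (short L)"
        using L assms(2) by (intro exec_carry) (auto simp: n)
      show "exec tsem (Alt (Seq (Basic (TRead {1})) (Basic (TWrite 2)))
           (Seq (Basic (TRead {0})) (Basic (TWrite 1))))
        (head_at ([0::nat] @ replicate j 1 @ ?b) (length [0::nat] + j)) (?cs, Suc j) (short L)"
        by (rule exec_Alt2[OF dead_guard exec_guard[OF _ _ exec_Basic]])
          (use L assms(2) in \<open>cases z; auto simp: head_at_def n short_def nth_append list_update_append\<close>)+
      show "exec tsem rewind (?cs, Suc j) (?cs, 0) (short L)"
        using L assms(2) by (intro exec_rewind) (auto simp: n nth_append nth_Cons split: nat.splits)
    qed
    then show ?thesis
      using L assms(2) holdsI[OF n', of "z - 1" L] by (intro exI[of _ "(?cs, 0)"]) (auto simp: n)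
  qed simp
qed


lemma exec_tdec:
  assumes "holds L n t" "length (digs n) + 2 \<le> L"
  shows "\<exists>t'. exec tsem tdec t t' (short L) \<and> holds L (n - 1) t'"
proof -
  from assms(1) obtain z where t: "t = (0 # digs n @ replicate z 0, 0)"
    and L: "length (0 # digs n @ replicate z 0) \<le> L"
    by (auto simp: holds_def)
  let ?b = "replicate z 0"
  show ?thesis
  proof (rule leading[OF set_digs[of n], of 1])
    fix j ds assume n: "digs n = replicate j 1 @ (3 - 1) # ds"
    have n': "digs (n - 1) = replicate j 2 @ 1 # ds"
      using set_digs[of n] n dval_digs[of n] dval_carry[of j ds] by (intro digs_eqI) auto
    let ?cs = "0 # replicate j 2 @ 1 # ds @ ?b"
    have "exec tsem tdec t (?cs, 0) (short L)"
      unfolding tdec_def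
    proof (intro exec_Seq)
      show "exec tsem right t (head_at ([0::nat] @ replicate j 1 @ 2 # ds @ ?b) (length [0::nat])) (short L)"
        using exec_right_0[of "fst t" L] L assms(2) by (simp add: t n)
      show "exec tsem (carry 1 2) (head_at ([0::nat] @ replicate j 1 @ 2 # ds @ ?b) (length [0::nat]))
         (head_at ([0::nat] @ replicate j 2 @ 2 # ds @ ?b) (length [0::nat] + j)) (short L)"
        using L by (intro exec_carry) (auto simp: n)
      show "exec tsem (Alt (Seq (Basic (TRead {2})) (Basic (TWrite 1)))
           (Seq (Basic (TRead {0})) (Seq left (Seq (Basic (TWrite 0)) left))))
        (head_at ([0::nat] @ replicate j 2 @ 2 # ds @ ?b) (length [0::nat] + j)) (?cs, Suc j) (short L)"
        by (rule exec_Alt1[OF exec_guard[OF _ _ exec_Basic] dead_guard])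
          (use L in \<open>auto simp: head_at_def n short_def nth_append list_update_append\<close>)
      show "exec tsem rewind (?cs, Suc j) (?cs, 0) (short L)"
        using L by (intro exec_rewind) (auto simp: n nth_append nth_Cons split: nat.splits)
    qed
    then show ?thesis
      using L holdsI[OF n', of z L] by (intro exI[of _ "(?cs, 0)"]) (simp add: n)
  next
    fix j assume n: "digs n = replicate j 1"
    have n': "digs (n - 1) = replicate (j - 1) 2"
    proof (cases j)
      case 0
      then have "n = 0" using n dval_digs[of n] by simp
      then show ?thesis using 0 by simp
    next
      case (Suc i)
      then have "replicate j 1 = replicate i 1 @ [1]" by (simp add: replicate_append_same)
      then have "n = Suc (dval (replicate i 2))"
        by (metis dval_carry_end n dval_digs)
      then show ?thesis using Suc by (intro digs_eqI) auto
    qed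
    \<comment> \<open>Stepping past the last digit creates a blank cell when none was there.\<close>
    let ?z = "if z = 0 then 1 else z"
    let ?ds = "0 # replicate j 2 @ replicate ?z 0"
    let ?cs = "0 # replicate (j - 1) 2 @ replicate (if j = 0 then ?z else Suc ?z) 0"
    \<comment> \<open>For \<open>j = 0\<close> the number is 0 and the erased cell is the marker,
      which was already blank.\<close>
    have cs: "?ds[j := 0] = ?cs"
      by (cases j; cases z) (auto simp: list_update_append replicate_append_same[symmetric]
          simp del: replicate_append_same)
    have "exec tsem tdec t (?cs, 0) (short L)"
      unfolding tdec_def
    proof (intro exec_Seq)
      show "exec tsem right t (head_at ([0::nat] @ replicate j 1 @ ?b) (length [0::nat])) (short L)"
        using exec_right_0[of "fst t" L] L assms(2) by (simp add: t n)
      show "exec tsem (carry 1 2) (head_at ([0::nat] @ replicate j 1 @ ?b) (length [0::nat]))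
         (head_at ([0::nat] @ replicate j 2 @ ?b) (length [0::nat] + j)) (short L)"
        using L assms(2) by (intro exec_carry) (auto simp: n)
      have h: "head_at ([0::nat] @ replicate j 2 @ ?b) (length [0::nat] + j) = (?ds, Suc j)"
        by (auto simp: head_at_def)
      have l: "length ?ds \<le> L" using L assms(2) by (auto simp: n)
      show "exec tsem (Alt (Seq (Basic (TRead {2})) (Basic (TWrite 1)))
           (Seq (Basic (TRead {0})) (Seq left (Seq (Basic (TWrite 0)) left))))
        (head_at ([0::nat] @ replicate j 2 @ ?b) (length [0::nat] + j)) (?cs, j - 1) (short L)"
        unfolding h
      proof (rule exec_Alt2[OF dead_guard exec_guard])
        show "exec tsem (Seq left (Seq (Basic (TWrite 0)) left))
          (?ds, Suc j) (?cs, j - 1) (short L)"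
        proof (intro exec_Seq)
          show "exec tsem left (?ds, Suc j) (?ds, j) (short L)"
            using l by (intro exec_Basic) (auto simp: short_def)
          show "exec tsem (Basic (TWrite 0)) (?ds, j) (?ds[j := 0], j) (short L)"
            using l by (intro exec_Basic) (auto simp: short_def simp del: list_update.simps)
          show "exec tsem left (?ds[j := 0], j) (?cs, j - 1) (short L)"
            unfolding cs[symmetric] using l by (intro exec_Basic) (auto simp: short_def simp del: list_update.simps)
        qed
      qed (use l in \<open>auto simp: short_def nth_append\<close>)
      show "exec tsem rewind (?cs, j - 1) (?cs, 0) (short L)"
        using l by (intro exec_rewind) (auto simp: nth_append nth_Cons split: nat.splits)
    qed
    then show ?thesis
      using L assms(2) holdsI[OF n', of "if j = 0 then ?z else Suc ?z" L]
      by (intro exI[of _ "(?cs, 0)"]) (auto simp: n)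
  qed simp
qed

lemma digs_eq_Nil [simp]: "digs n = [] \<longleftrightarrow> n = 0"
  by (cases n) auto

text \<open>Cell 1 is blank exactly when the number is 0. The conditional translates a set of
  symbols into the set of register values that pass the test.\<close>

lemma exec_test_tape:
  assumes "holds L n t" "length (digs n) + 2 \<le> L"
  shows "n \<in> (if 0 \<in> S then {0} else {1..}) \<Longrightarrow> S = {0} \<or> S = - {0} \<Longrightarrow>
      \<exists>t'. exec tsem (Seq right (Seq (Basic (TRead S)) left)) t t' (short L) \<and> holds L n t'"
    and "n \<notin> (if 0 \<in> S then {0} else {1..}) \<Longrightarrow> S = {0} \<or> S = - {0} \<Longrightarrow>
      dead tsem (Seq right (Seq (Basic (TRead S)) left)) t (short L)"
proof -
  from assms(1) obtain z where t: "t = (0 # digs n @ replicate z 0, 0)"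
    and L: "length (0 # digs n @ replicate z 0) \<le> L"
    by (auto simp: holds_def)
  let ?z = "if n = 0 \<and> z = 0 then 1 else z"
  let ?cs = "0 # digs n @ replicate ?z 0"
  have l: "length ?cs \<le> L" using L assms(2) by auto
  have h: "exec tsem right t (?cs, 1) (short L)"
    using L l by (intro exec_Basic) (auto simp: t short_def)
  have cs1: "?cs ! 1 = 0 \<longleftrightarrow> n = 0"
    using set_digs[of n] by (cases "digs n") (auto simp: nth_append)
  have e: "exec tsem (Basic (TRead S)) (?cs, 1) (?cs, 1) (short L)" if "?cs ! 1 \<in> S"
    using l that by (intro exec_Basic) (simp_all add: short_def)
  have l': "exec tsem left (?cs, 1) (?cs, 0) (short L)"
    using l by (intro exec_Basic) (simp_all add: short_def)
  have d: "dead tsem (Basic (TRead S)) (?cs, 1) (short L)" if "?cs ! 1 \<notin> S"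
    using l that by (intro dead_Basic) (simp_all add: short_def)
  have "holds L n (?cs, 0)" using l by (auto simp: holds_def)
  then show "n \<in> (if 0 \<in> S then {0} else {1..}) \<Longrightarrow> S = {0} \<or> S = - {0} \<Longrightarrow>
      \<exists>t'. exec tsem (Seq right (Seq (Basic (TRead S)) left)) t t' (short L) \<and> holds L n t'"
    using exec_Seq[OF h exec_Seq[OF e l']] cs1 by (cases "n = 0") auto
  show "n \<notin> (if 0 \<in> S then {0} else {1..}) \<Longrightarrow> S = {0} \<or> S = - {0} \<Longrightarrow>
      dead tsem (Seq right (Seq (Basic (TRead S)) left)) t (short L)"
    using dead_Seq2[OF h dead_Seq[OF d]] cs1 by (cases "n = 0") auto
qed

section \<open>Counter programs with a two-way input head\<close>

datatype 'i rinstr = Inc nat | Dec nat | IsZero nat | NonZero nat | HMove move | HCell "'i cell set"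

type_synonym rstate = "nat \<times> (nat \<Rightarrow> nat)"

fun rsem :: "'i list \<Rightarrow> 'i rinstr \<Rightarrow> rstate \<Rightarrow> rstate \<Rightarrow> bool" where
  "rsem w (Inc r) (h, \<rho>) t \<longleftrightarrow> t = (h, \<rho>(r := Suc (\<rho> r)))"
| "rsem w (Dec r) (h, \<rho>) t \<longleftrightarrow> t = (h, \<rho>(r := \<rho> r - 1))"
| "rsem w (IsZero r) (h, \<rho>) t \<longleftrightarrow> t = (h, \<rho>) \<and> \<rho> r = 0"
| "rsem w (NonZero r) (h, \<rho>) t \<longleftrightarrow> t = (h, \<rho>) \<and> \<rho> r \<noteq> 0"
| "rsem w (HMove d) (h, \<rho>) t \<longleftrightarrow> t = (move_input w d h, \<rho>)"
| "rsem w (HCell S) (h, \<rho>) t \<longleftrightarrow> t = (h, \<rho>) \<and> input_cell w h \<in> S"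

fun rinstr_ok :: "nat \<Rightarrow> 'i rinstr \<Rightarrow> bool" where
  "rinstr_ok K (Inc r) \<longleftrightarrow> r < K"
| "rinstr_ok K (Dec r) \<longleftrightarrow> r < K"
| "rinstr_ok K (IsZero r) \<longleftrightarrow> r < K"
| "rinstr_ok K (NonZero r) \<longleftrightarrow> r < K"
| "rinstr_ok K _ \<longleftrightarrow> True"

abbreviation tape_com :: "nat \<Rightarrow> tinstr com \<Rightarrow> 'i instr com" where
  "tape_com r c \<equiv> subst (\<lambda>b. Basic (on_tape r b)) c"

fun rcode :: "'i rinstr \<Rightarrow> 'i instr com" where
  "rcode (Inc r) = tape_com r tinc"
| "rcode (Dec r) = tape_com r tdec"
| "rcode (IsZero r) = tape_com r tzero"
| "rcode (NonZero r) = tape_com r tnonzero"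
| "rcode (HMove d) = Basic (IMove d)"
| "rcode (HCell c) = Basic (ICell c)"

lemma instr_ok_rcode: "rinstr_ok K b \<Longrightarrow> x \<in> basics (rcode b) \<Longrightarrow> instr_ok K x"
  by (cases b) (auto simp: basics_subst tinc_def tdec_def tzero_def tnonzero_def carry_def
      rewind_def while_def)

lemma tape_com_exec:
  assumes "r < length ts" "exec tsem c (ts ! r) t' (short L)"
  shows "exec (isem w) (tape_com r c) (h, ts) (h, ts[r := t'])
     (\<lambda>s. \<exists>u. short L u \<and> s = (h, ts[r := u]))"
proof -
  have R: "(h, ts) = (h, ts[r := ts ! r])" by simp
  have G: "\<And>s'. vis tsem c (ts ! r) s' \<Longrightarrow> short L s'"
    and sem: "\<And>s'. sem tsem c (ts ! r) s' \<longleftrightarrow> s' = t'"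
    using assms(2) by (auto simp: exec_def)
  note 1 = exec_on_tape[OF assms(1), of w L h c, unfolded refines_def, rule_format, OF R G]
  show ?thesis unfolding exec_def using 1[unfolded sem] by metis
qed

lemma tape_com_dead:
  assumes "r < length ts" "dead tsem c (ts ! r) (short L)"
  shows "dead (isem w) (tape_com r c) (h, ts) (\<lambda>s. \<exists>u. short L u \<and> s = (h, ts[r := u]))"
proof -
  have R: "(h, ts) = (h, ts[r := ts ! r])" by simp
  have G: "\<And>s'. vis tsem c (ts ! r) s' \<Longrightarrow> short L s'"
    and sem: "\<And>s'. \<not> sem tsem c (ts ! r) s'"
    using assms(2) by (auto simp: dead_def)
  note 1 = exec_on_tape[OF assms(1), of w L h c, unfolded refines_def, rule_format, OF R G]
  show ?thesis unfolding dead_def using 1 sem by metis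
qed

definition tapes_hold :: "nat \<Rightarrow> nat \<Rightarrow> rstate \<Rightarrow> nat \<times> tape list \<Rightarrow> bool" where
  "tapes_hold K L s t \<longleftrightarrow> fst t = fst s \<and> length (snd t) = K \<and>
     (\<forall>r<K. holds L (snd s r) (snd t ! r))"

definition short_regs :: "nat \<Rightarrow> nat \<Rightarrow> rstate \<Rightarrow> bool" where
  "short_regs K L s \<longleftrightarrow> (\<forall>r<K. length (digs (snd s r)) + 2 \<le> L)"

definition short_tapes :: "nat \<Rightarrow> nat \<Rightarrow> nat \<times> tape list \<Rightarrow> bool" where
  "short_tapes K L t \<longleftrightarrow> length (snd t) = K \<and> (\<forall>r<K. short L (snd t ! r))"

lemma holds_imp_short: "holds L n t \<Longrightarrow> short L t"
  by (simp add: holds_def short_def)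

lemma short_tapes_update:
  assumes "tapes_hold K L (h, \<rho>) (h', ts)"
  shows "(\<exists>u. short L u \<and> s = (h, ts[r := u])) \<Longrightarrow> short_tapes K L s"
proof -
  assume s: "\<exists>u. short L u \<and> s = (h, ts[r := u])"
  have "length ts = K" "\<forall>i<K. short L (ts ! i)"
    using assms by (auto simp: tapes_hold_def dest!: holds_imp_short spec)
  with s show "short_tapes K L s"
    unfolding short_tapes_def by (metis length_list_update nth_list_update nth_list_update_neq snd_conv)
qed

lemma tapes_hold_update:
  assumes "tapes_hold K L (h, \<rho>) (h', ts)" "r < K" "holds L n t"
  shows "tapes_hold K L (h, \<rho>(r := n)) (h, ts[r := t])"
  using assms by (auto simp: tapes_hold_def nth_list_update)

lemma refines_rcode:
  assumes "rinstr_ok K b"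
  shows "refines (rsem w) (isem w) (short_regs K L) (tapes_hold K L) (short_tapes K L)
     (Basic b) (rcode b)"
  unfolding refines_def
proof (intro allI impI)
  fix s t assume R: "tapes_hold K L s t"
    and "\<forall>s'. vis (rsem w) (Basic b) s s' \<longrightarrow> short_regs K L s'"
  then have G: "short_regs K L s" by (metis vis_refl)
  obtain h \<rho> ts where s: "s = (h, \<rho>)" and t: "t = (h, ts)" and K: "length ts = K"
    using R by (cases s; cases t) (auto simp: tapes_hold_def)
  note R = R[unfolded s t]
  note sh = short_tapes_update[OF R]
  have r: "holds L (\<rho> r) (ts ! r)" "length (digs (\<rho> r)) + 2 \<le> L" if "r < K" for r
    using R G that by (auto simp: tapes_hold_def short_regs_def s)
  have short: "\<forall>r<K. short L (ts ! r)"
    using R by (auto simp: tapes_hold_def dest!: holds_imp_short spec)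
  let ?thes = "(\<forall>s'. sem (rsem w) (Basic b) s s' \<longrightarrow>
          (\<exists>t'. sem (isem w) (rcode b) t t' \<and> tapes_hold K L s' t')) \<and>
     (\<forall>t'. sem (isem w) (rcode b) t t' \<longrightarrow>
          (\<exists>s'. sem (rsem w) (Basic b) s s' \<and> tapes_hold K L s' t')) \<and>
     (\<forall>t'. vis (isem w) (rcode b) t t' \<longrightarrow> short_tapes K L t')"
  \<comment> \<open>All instructions on registers follow one of two patterns: a single outcome in
    which one register is overwritten, possibly by its old value, or a failed test.\<close>
  have ok: ?thes if e: "exec tsem c (ts ! r) t' (short L)" "holds L n t'"
      and c: "rcode b = tape_com r c" and b: "\<And>s'. rsem w b s s' \<longleftrightarrow> s' = (h, \<rho>(r := n))"
      and rK: "r < K" for c n t' r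
    using tape_com_exec[OF _ e(1), of w h] tapes_hold_update[OF R rK e(2)] sh[where r = r] rK
    unfolding c b exec_def t K by (simp add: b; blast)
  have nok: ?thes if d: "dead tsem c (ts ! r) (short L)"
      and c: "rcode b = tape_com r c" and b: "\<And>s'. \<not> rsem w b s s'"
      and rK: "r < K" for c r
    using tape_com_dead[OF _ d, of w h] sh[where r = r] rK
    unfolding c b dead_def t K by (simp add: b; blast)
  show ?thes
  proof (cases b)
    case (Inc i)
    then have i: "i < K" using assms by simp
    from exec_tinc[OF r[OF i]] obtain t' where
      "exec tsem tinc (ts ! i) t' (short L)" "holds L (Suc (\<rho> i)) t'" by blast
    then show ?thesis by (rule ok) (simp_all add: Inc i s)
  next
    case (Dec i)
    then have i: "i < K" using assms by simp
    from exec_tdec[OF r[OF i]] obtain t' where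
      "exec tsem tdec (ts ! i) t' (short L)" "holds L (\<rho> i - 1) t'" by blast
    then show ?thesis by (rule ok) (simp_all add: Dec i s)
  next
    case (IsZero i)
    then have i: "i < K" using assms by simp
    show ?thesis
    proof (cases "\<rho> i = 0")
      case True
      with exec_test_tape(1)[OF r[OF i], of "{0}"] obtain t' where
        "exec tsem tzero (ts ! i) t' (short L)" "holds L (\<rho> i) t'" by (auto simp: tzero_def)
      then show ?thesis by (rule ok) (simp_all add: IsZero i s True fun_upd_idem)
    next
      case False
      with exec_test_tape(2)[OF r[OF i], of "{0}"]
      have "dead tsem tzero (ts ! i) (short L)" by (auto simp: tzero_def)
      then show ?thesis by (rule nok) (simp_all add: IsZero i s False)
    qed
  next
    case (NonZero i)
    then have i: "i < K" using assms by simp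
    show ?thesis
    proof (cases "\<rho> i = 0")
      case False
      with exec_test_tape(1)[OF r[OF i], of "- {0}"] obtain t' where
        "exec tsem tnonzero (ts ! i) t' (short L)" "holds L (\<rho> i) t'" by (auto simp: tnonzero_def)
      then show ?thesis by (rule ok) (simp_all add: NonZero i s False)
    next
      case True
      with exec_test_tape(2)[OF r[OF i], of "- {0}"]
      have "dead tsem tnonzero (ts ! i) (short L)" by (auto simp: tnonzero_def)
      then show ?thesis by (rule nok) (simp_all add: NonZero i s True)
    qed
  next
    case (HMove d)
    then show ?thesis using R short
      by (auto simp: s t tapes_hold_def short_tapes_def)
  next
    case (HCell d)
    then show ?thesis using R short
      by (auto simp: s t tapes_hold_def short_tapes_def)
  qed
qed

lemma space_of_le:
  assumes "short_tapes K L (h, ts)"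
  shows "space_of (l, h, ts) \<le> K * L"
proof -
  have "\<forall>x\<in>set ts. length (fst x) \<le> L"
    using assms unfolding short_tapes_def short_def by (metis in_set_conv_nth snd_conv)
  then have "(\<Sum>(cs, _) \<leftarrow> ts. length cs) \<le> (\<Sum>_ \<leftarrow> ts. L)"
    by (intro sum_list_mono) auto
  also have "\<dots> = K * L"
    using assms by (simp add: short_tapes_def sum_list_triv)
  finally show ?thesis by simp
qed

text \<open>The machine is fixed before \<open>w\<close> and \<open>L\<close>, so one machine serves
  all inputs, each with its own bound. There are \<open>K\<close> tapes of at most \<open>L\<close>
  cells each.\<close>

theorem register_program_to_ntm:
  assumes "finite A" "\<forall>b\<in>basics c. rinstr_ok K b"
  obtains M :: "'i ntm" where "wf_ntm M"
    and "\<And>w L. w \<in> lists A \<Longrightarrow> L \<ge> 1 \<Longrightarrow>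
      (\<And>s. vis (rsem w) c (0, \<lambda>_. 0) s \<Longrightarrow> short_regs K L s) \<Longrightarrow>
      (accepts M w \<longleftrightarrow> (\<exists>s. sem (rsem w) c (0, \<lambda>_. 0) s)) \<and>
      (\<forall>x. reachable_config M w x \<longrightarrow> space_of x \<le> K * L)"
proof -
  let ?c = "subst rcode c"
  let ?M = "ntm_of A K ?c"
  have ok: "\<forall>x\<in>basics ?c. instr_ok K x"
    using assms(2) instr_ok_rcode by (auto simp: basics_subst)
  have main: "(accepts ?M w \<longleftrightarrow> (\<exists>s. sem (rsem w) c (0, \<lambda>_. 0) s)) \<and>
      (\<forall>x. reachable_config ?M w x \<longrightarrow> space_of x \<le> K * L)"
    if w: "w \<in> lists A" and L: "L \<ge> 1"
      and G: "\<And>s. vis (rsem w) c (0, \<lambda>_. 0) s \<Longrightarrow> short_regs K L s" for w L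
  proof -
    have R: "refines (rsem w) (isem w) (short_regs K L) (tapes_hold K L) (short_tapes K L) c ?c"
      by (rule refines_subst, rule refines_rcode) (use assms(2) in auto)
    have R0: "tapes_hold K L (0, \<lambda>_. 0) (0, replicate K ([0], 0))"
      using L by (auto simp: tapes_hold_def holds_def intro: exI[of _ 0])
    note R = R[unfolded refines_def, rule_format, OF R0 G]
    note M = ntm_of_correct[OF assms(1) w ok]
    have "accepts ?M w \<longleftrightarrow> (\<exists>s. sem (rsem w) c (0, \<lambda>_. 0) s)"
      unfolding M(1) using R by blast
    moreover have "space_of x \<le> K * L" if x: "reachable_config ?M w x" for x
    proof -
      obtain l h ts where x': "x = (l, h, ts)" by (metis prod.collapse)
      from M(2)[OF x[unfolded x']] R have "short_tapes K L (h, ts)" by blast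
      then show ?thesis unfolding x' by (rule space_of_le)
    qed
    ultimately show ?thesis by blast
  qed
  show ?thesis
    by (rule that[of ?M]) (use assms(1) main in \<open>auto intro: wf_ntm_of\<close>)
qed

section \<open>Functions computable with polynomially bounded registers\<close>

definition le_regs :: "nat \<Rightarrow> rstate \<Rightarrow> bool" where
  "le_regs B s \<longleftrightarrow> (\<forall>i. snd s i \<le> B)"

lemma le_regs_mono: "le_regs B s \<Longrightarrow> B \<le> B' \<Longrightarrow> le_regs B' s"
  unfolding le_regs_def using le_trans by blast

lemma le_regs_upd: "le_regs B (h, \<rho>) \<Longrightarrow> x \<le> B \<Longrightarrow> le_regs B (h', \<rho>(i := x))"
  by (auto simp: le_regs_def)

lemma le_regs_head: "le_regs B (h, \<rho>) \<longleftrightarrow> le_regs B (0, \<rho>)"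
  by (auto simp: le_regs_def)

section \<open>Elementary counter programs\<close>

definition skip :: "'i rinstr com" where
  "skip = Basic (HMove Stay)"

lemma exec_skip: "V s \<Longrightarrow> exec (rsem w) skip s s V"
  unfolding skip_def by (cases s) (auto intro!: exec_Basic)

lemma exec_Inc:
  "V (h, \<rho>) \<Longrightarrow> V (h, \<rho>(i := Suc (\<rho> i))) \<Longrightarrow>
     exec (rsem w) (Basic (Inc i)) (h, \<rho>) (h, \<rho>(i := Suc (\<rho> i))) V"
  by (rule exec_Basic) auto

lemma exec_Dec:
  "V (h, \<rho>) \<Longrightarrow> V (h, \<rho>(i := \<rho> i - 1)) \<Longrightarrow>
     exec (rsem w) (Basic (Dec i)) (h, \<rho>) (h, \<rho>(i := \<rho> i - 1)) V"
  by (rule exec_Basic) auto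

abbreviation while_pos :: "nat \<Rightarrow> 'i rinstr com \<Rightarrow> 'i rinstr com" where
  "while_pos i c \<equiv> while (NonZero i) (IsZero i) (Seq (Basic (Dec i)) c)"

lemma exec_while_pos_0:
  "\<rho> i = 0 \<Longrightarrow> V (h, \<rho>) \<Longrightarrow> exec (rsem w) (while_pos i c) (h, \<rho>) (h, \<rho>) V"
  by (rule exec_while_false) auto

lemma exec_while_pos_Suc:
  assumes "\<rho> i = Suc n" "V (h, \<rho>)"
    and c: "exec (rsem w) c (h, \<rho>(i := n)) s1 V" and w: "exec (rsem w) (while_pos i c) s1 s2 V"
  shows "exec (rsem w) (while_pos i c) (h, \<rho>) s2 V"
proof (rule exec_while_true[OF _ _ _ w])
  have "exec (rsem w) (Basic (Dec i)) (h, \<rho>) (h, \<rho>(i := n)) V"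
    using exec_Dec[of V h \<rho> i w] assms exec_start[OF c] by simp
  then show "exec (rsem w) (Seq (Basic (Dec i)) c) (h, \<rho>) s1 V"
    using c by (rule exec_Seq)
qed (use assms in auto)

definition move_reg :: "nat \<Rightarrow> nat \<Rightarrow> 'i rinstr com" where
  "move_reg i d = while_pos i (Basic (Inc d))"

lemma exec_move_reg:
  assumes "i \<noteq> d" "le_regs B (h, \<rho>)" "\<rho> d + \<rho> i \<le> B"
  shows "exec (rsem w) (move_reg i d) (h, \<rho>) (h, \<rho>(i := 0, d := \<rho> d + \<rho> i)) (le_regs B)"
  using assms(2,3)
proof (induction "\<rho> i" arbitrary: \<rho>)
  case 0
  then have "\<rho>(i := 0, d := \<rho> d + \<rho> i) = \<rho>" by auto
  then show ?case
    using exec_while_pos_0[of \<rho> i "le_regs B" h w "Basic (Inc d)"] 0 by (simp only: move_reg_def)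
next
  case (Suc n)
  let ?r = "\<rho>(i := n, d := Suc (\<rho> d))"
  have le: "le_regs B (h, \<rho>(i := n))" "le_regs B (h, ?r)"
    using Suc assms(1) by (auto simp: le_regs_def)
  have *: "?r(i := 0, d := ?r d + ?r i) = \<rho>(i := 0, d := \<rho> d + \<rho> i)"
    using Suc(2) assms(1) by auto
  have "exec (rsem w) (move_reg i d) (h, ?r) (h, ?r(i := 0, d := ?r d + ?r i)) (le_regs B)"
    by (rule Suc.hyps(1)) (use Suc.hyps(2) Suc.prems assms(1) le in auto)
  then show ?case
    unfolding * unfolding move_reg_def
    by (rule exec_while_pos_Suc[where V = "le_regs B", OF Suc.hyps(2)[symmetric] Suc.prems(1), rotated])
       (use exec_Inc[of "le_regs B" h "\<rho>(i := n)" d w] le assms(1) in auto)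
qed

text \<open>Reading a counter destroys it. Copying therefore moves the value to two places at once
  and afterwards moves one of them back.\<close>

definition move_reg2 :: "nat \<Rightarrow> nat \<Rightarrow> nat \<Rightarrow> 'i rinstr com" where
  "move_reg2 i d e = while_pos i (Seq (Basic (Inc d)) (Basic (Inc e)))"

lemma exec_move_reg2:
  assumes "i \<noteq> d" "i \<noteq> e" "d \<noteq> e" "le_regs B (h, \<rho>)" "\<rho> d + \<rho> i \<le> B" "\<rho> e + \<rho> i \<le> B"
  shows "exec (rsem w) (move_reg2 i d e) (h, \<rho>)
    (h, \<rho>(i := 0, d := \<rho> d + \<rho> i, e := \<rho> e + \<rho> i)) (le_regs B)"
  using assms(4-6)
proof (induction "\<rho> i" arbitrary: \<rho>)
  case 0
  then have "\<rho>(i := 0, d := \<rho> d + \<rho> i, e := \<rho> e + \<rho> i) = \<rho>" by auto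
  then show ?case
    using exec_while_pos_0[of \<rho> i "le_regs B" h w "Seq (Basic (Inc d)) (Basic (Inc e))"] 0
    by (simp only: move_reg2_def)
next
  case (Suc n)
  let ?r' = "\<rho>(i := n, d := Suc (\<rho> d))"
  let ?r = "?r'(e := Suc (\<rho> e))"
  have le: "le_regs B (h, \<rho>(i := n))" "le_regs B (h, ?r')" "le_regs B (h, ?r)"
    using Suc assms(1-3) by (auto simp: le_regs_def)
  have *: "?r(i := 0, d := ?r d + ?r i, e := ?r e + ?r i) =
      \<rho>(i := 0, d := \<rho> d + \<rho> i, e := \<rho> e + \<rho> i)"
    using Suc(2) assms(1-3) by auto
  have "exec (rsem w) (move_reg2 i d e) (h, ?r)
      (h, ?r(i := 0, d := ?r d + ?r i, e := ?r e + ?r i)) (le_regs B)"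
    by (rule Suc.hyps(1)) (use Suc.hyps(2) Suc.prems assms(1-3) le in auto)
  then show ?case
    unfolding * unfolding move_reg2_def
  proof (rule exec_while_pos_Suc[where V = "le_regs B", OF Suc.hyps(2)[symmetric] Suc.prems(1), rotated])
    show "exec (rsem w) (Seq (Basic (Inc d)) (Basic (Inc e))) (h, \<rho>(i := n)) (h, ?r) (le_regs B)"
      by (rule exec_Seq[of _ _ _ "(h, ?r')"])
         (use exec_Inc[of "le_regs B" h "\<rho>(i := n)" d w] exec_Inc[of "le_regs B" h ?r' e w] le assms(1-3)
          in auto)
  qed
qed

definition clear_reg :: "nat \<Rightarrow> 'i rinstr com" where
  "clear_reg i = while_pos i skip"

lemma exec_clear_reg:
  assumes "le_regs B (h, \<rho>)"
  shows "exec (rsem w) (clear_reg i) (h, \<rho>) (h, \<rho>(i := 0)) (le_regs B)"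
  using assms
proof (induction "\<rho> i" arbitrary: \<rho>)
  case 0
  then show ?case unfolding clear_reg_def
    by (metis exec_while_pos_0 fun_upd_triv)
next
  case (Suc n)
  have le: "le_regs B (h, \<rho>(i := n))"
    using Suc by (auto simp: le_regs_def) (metis Suc_leD)
  have "exec (rsem w) (clear_reg i) (h, \<rho>(i := n)) (h, (\<rho>(i := n))(i := 0)) (le_regs B)"
    by (rule Suc.hyps(1)) (use le in auto)
  then show ?case unfolding clear_reg_def
    by (intro exec_while_pos_Suc[where V = "le_regs B", OF Suc.hyps(2)[symmetric] Suc.prems exec_skip])
       (simp_all add: le)
qed

text \<open>\<open>X\<close> is the set of admissible inputs, each with a number that is polynomially related to
  every quantity the program may store; \<open>code\<close> numbers the input symbols.\<close>

type_synonym 'i env = "'i list \<times> (nat \<Rightarrow> nat)"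

definition input_code :: "('i \<Rightarrow> nat) \<Rightarrow> 'i list \<Rightarrow> nat \<Rightarrow> nat" where
  "input_code code w i = (if i < length w then code (w ! i) else 0)"

locale inputs =
  fixes A :: "'i set" and X :: "('i list \<times> nat) set" and code :: "'i \<Rightarrow> nat"
  assumes finite_A: "finite A" and X: "(w, b) \<in> X \<Longrightarrow> w \<in> lists A \<and> length w \<le> b"
begin

text \<open>The exponent is uniform in the input and in \<open>B\<close>. The base
  \<open>B + 2\<close> is at least 2, so that constants can be absorbed by raising the exponent.
  Head and scratch registers are restored to 0, which makes such programs composable.\<close>

definition computes :: "nat \<Rightarrow> 'i rinstr com \<Rightarrow> ('i env \<Rightarrow> nat) \<Rightarrow> nat \<Rightarrow> bool" where
  "computes d c f e \<longleftrightarrow> (\<forall>(w, b) \<in> X. \<forall>B\<ge>b. \<forall>\<rho>. (\<forall>i\<ge>d. \<rho> i = 0) \<longrightarrow> le_regs B (0, \<rho>) \<longrightarrow>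
     exec (rsem w) c (0, \<rho>) (0, \<rho>(d := f (w, \<rho>))) (le_regs ((B + 2) ^ e)))"

text \<open>\<open>tdef d f\<close>: \<open>f\<close> depends on the registers below \<open>d\<close> only and can be computed into any
  register from \<open>d\<close> on, using higher registers as scratch space, so that all intermediate values
  are polynomially bounded.\<close>

definition tdef :: "nat \<Rightarrow> ('i env \<Rightarrow> nat) \<Rightarrow> bool" where
  "tdef d f \<longleftrightarrow> (\<forall>w \<rho> \<rho>'. (\<forall>i<d. \<rho> i = \<rho>' i) \<longrightarrow> f (w, \<rho>) = f (w, \<rho>')) \<and>
     (\<forall>k\<ge>d. \<exists>c e. computes k c f e)"

definition polyb :: "nat \<Rightarrow> ('i env \<Rightarrow> nat) \<Rightarrow> bool" where
  "polyb d f \<longleftrightarrow> (\<exists>e. \<forall>(w, b) \<in> X. \<forall>B\<ge>b. \<forall>\<rho>. (\<forall>i<d. \<rho> i \<le> B) \<longrightarrow> f (w, \<rho>) \<le> (B + 2) ^ e)"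

lemma tdef_weaken: "tdef d f \<Longrightarrow> d \<le> k \<Longrightarrow> tdef k f"
  unfolding tdef_def by (meson le_trans less_le_trans)

lemma tdef_cong_regs: "tdef d f \<Longrightarrow> (\<And>i. i < d \<Longrightarrow> \<rho> i = \<rho>' i) \<Longrightarrow> f (w, \<rho>) = f (w, \<rho>')"
  unfolding tdef_def by blast

lemma computesD:
  assumes "computes d c f e" "(w, b) \<in> X" "b \<le> B" "\<And>i. i \<ge> d \<Longrightarrow> \<rho> i = 0" "le_regs B (0, \<rho>)"
  shows "exec (rsem w) c (0, \<rho>) (0, \<rho>(d := f (w, \<rho>))) (le_regs ((B + 2) ^ e))"
  using assms unfolding computes_def by blast

lemma computesI:
  assumes "\<And>w b B \<rho>. (w, b) \<in> X \<Longrightarrow> b \<le> B \<Longrightarrow> (\<And>i. i \<ge> d \<Longrightarrow> \<rho> i = 0) \<Longrightarrow> le_regs B (0, \<rho>) \<Longrightarrow>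
     exec (rsem w) c (0, \<rho>) (0, \<rho>(d := f (w, \<rho>))) (le_regs ((B + 2) ^ e))"
  shows "computes d c f e"
  unfolding computes_def using assms by blast

lemma power_le: "e \<le> e' \<Longrightarrow> (B + 2) ^ e \<le> (B + 2 :: nat) ^ e'"
  by (rule power_increasing) auto

lemma power_add2_le: "(B + 2) ^ e + 2 \<le> (B + 2 :: nat) ^ (e + 2)"
proof -
  have 1: "1 \<le> (B + 2) ^ e" by simp
  have "(B + 2) ^ e + 2 \<le> (B + 2) ^ e * 4" using 1 by linarith
  also have "\<dots> \<le> (B + 2) ^ e * (B + 2) ^ 2"
    by (intro mult_left_mono) (auto simp: power2_eq_square)
  finally show ?thesis by (simp only: power_add)
qed

text \<open>Polynomial bounds are closed under composition: running a program with
  \<open>(B + 2) ^ e\<close> in the role of \<open>B\<close> gives again a power of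
  \<open>B + 2\<close> with a fixed exponent.\<close>

lemma power_power_le: "((B + 2) ^ e + 2) ^ e' \<le> (B + 2 :: nat) ^ ((e + 2) * e')"
  unfolding power_mult by (rule power_mono[OF power_add2_le]) simp

lemma le_power: "B \<le> (B + 2 :: nat) ^ Suc e"
proof -
  have "B \<le> (B + 2) ^ 1" by simp
  also have "\<dots> \<le> (B + 2) ^ Suc e" by (rule power_le) simp
  finally show ?thesis .
qed

lemma exec_le_mono: "exec r c s s' (le_regs B) \<Longrightarrow> B \<le> B' \<Longrightarrow> exec r c s s' (le_regs B')"
  by (erule exec_mono) (rule le_regs_mono)

text \<open>The value ends up in a register and so obeys the register bound. For this the registers
  from \<open>d\<close> on are set to 0, which does not affect the value.\<close>

lemma tdef_polyb:
  assumes "tdef d f"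
  shows "polyb d f"
proof -
  obtain c e where c: "computes d c f e" using assms unfolding tdef_def by blast
  have "f (w, \<rho>) \<le> (B + 2) ^ e"
    if X: "(w, b) \<in> X" "b \<le> B" and \<rho>: "\<forall>i<d. \<rho> i \<le> B" for w b B \<rho>
  proof -
    let ?\<rho> = "\<lambda>i. if i < d then \<rho> i else 0"
    have "le_regs ((B + 2) ^ e) (0, ?\<rho>(d := f (w, ?\<rho>)))"
      by (rule exec_final[OF computesD[OF c X]]) (use \<rho> in \<open>auto simp: le_regs_def\<close>)
    then have "f (w, ?\<rho>) \<le> (B + 2) ^ e" by (auto simp: le_regs_def dest: spec[of _ d])
    then show ?thesis using tdef_cong_regs[OF assms, of \<rho> ?\<rho> w] by simp
  qed
  then show ?thesis unfolding polyb_def by blast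
qed

lemma polybE:
  assumes "polyb d f"
  obtains e where
    "\<And>w b B \<rho>. (w, b) \<in> X \<Longrightarrow> b \<le> B \<Longrightarrow> (\<forall>i<d. \<rho> i \<le> B) \<Longrightarrow> f (w, \<rho>) \<le> (B + 2) ^ e"
proof -
  from assms obtain e where e: "\<forall>(w, b) \<in> X. \<forall>B\<ge>b. \<forall>\<rho>. (\<forall>i<d. \<rho> i \<le> B) \<longrightarrow> f (w, \<rho>) \<le> (B + 2) ^ e"
    unfolding polyb_def ..
  show thesis by (rule that[of e]) (use bspec[OF e] in auto)
qed

lemma polybI:
  assumes "\<And>w b B \<rho>. (w, b) \<in> X \<Longrightarrow> b \<le> B \<Longrightarrow> (\<forall>i<d. \<rho> i \<le> B) \<Longrightarrow> f (w, \<rho>) \<le> (B + 2) ^ e"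
  shows "polyb d f"
  unfolding polyb_def by (rule exI[of _ e]) (use assms in auto)

lemma polyb_add:
  assumes "polyb d f" "polyb d g"
  shows "polyb d (\<lambda>s. f s + g s)"
proof -
  from assms(1) obtain e where e:
    "\<And>w b B \<rho>. (w, b) \<in> X \<Longrightarrow> b \<le> B \<Longrightarrow> (\<forall>i<d. \<rho> i \<le> B) \<Longrightarrow> f (w, \<rho>) \<le> (B + 2) ^ e"
    by (rule polybE) blast
  from assms(2) obtain e' where e':
    "\<And>w b B \<rho>. (w, b) \<in> X \<Longrightarrow> b \<le> B \<Longrightarrow> (\<forall>i<d. \<rho> i \<le> B) \<Longrightarrow> g (w, \<rho>) \<le> (B + 2) ^ e'"
    by (rule polybE) blast
  have "(B + 2) ^ e + (B + 2) ^ e' \<le> (B + 2 :: nat) ^ (e + e' + 1)" for B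
  proof -
    have "(B + 2) ^ e \<le> (B + 2 :: nat) ^ (e + e')" "(B + 2) ^ e' \<le> (B + 2 :: nat) ^ (e + e')"
      by (rule power_le; simp)+
    then have "(B + 2) ^ e + (B + 2) ^ e' \<le> 2 * (B + 2 :: nat) ^ (e + e')" by linarith
    also have "\<dots> \<le> (B + 2) * (B + 2 :: nat) ^ (e + e')" by (intro mult_right_mono) auto
    finally show ?thesis by simp
  qed
  then show ?thesis
    by (intro polybI[where e = "e + e' + 1"]) (blast intro: add_mono e e' le_trans)
qed

lemma polyb_mult:
  assumes "polyb d f" "polyb d g"
  shows "polyb d (\<lambda>s. f s * g s)"
proof -
  from assms(1) obtain e where e:
    "\<And>w b B \<rho>. (w, b) \<in> X \<Longrightarrow> b \<le> B \<Longrightarrow> (\<forall>i<d. \<rho> i \<le> B) \<Longrightarrow> f (w, \<rho>) \<le> (B + 2) ^ e"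
    by (rule polybE) blast
  from assms(2) obtain e' where e':
    "\<And>w b B \<rho>. (w, b) \<in> X \<Longrightarrow> b \<le> B \<Longrightarrow> (\<forall>i<d. \<rho> i \<le> B) \<Longrightarrow> g (w, \<rho>) \<le> (B + 2) ^ e'"
    by (rule polybE) blast
  show ?thesis
    by (rule polybI[where e = "e + e'"]) (simp only: power_add mult_le_mono e e')
qed

lemma polyb_input:
  assumes "\<And>w b. (w, b) \<in> X \<Longrightarrow> g w \<le> b"
  shows "polyb d (\<lambda>s. g (fst s))"
  unfolding polyb_def
  by (rule exI[of _ 1]) (auto dest!: assms)

section \<open>Basic functions and bounded recursion\<close>

lemma tdef_0: "tdef d (\<lambda>_. 0)"
proof -
  have "computes k skip (\<lambda>_. 0) 1" for k
  proof (rule computesI)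
    fix w b B and \<rho> :: "nat \<Rightarrow> nat"
    assume *: "\<And>i. i \<ge> k \<Longrightarrow> \<rho> i = 0" "le_regs B (0, \<rho>)"
    then have "\<rho>(k := 0) = \<rho>" by auto
    then show "exec (rsem w) skip (0, \<rho>) (0, \<rho>(k := 0)) (le_regs ((B + 2) ^ 1))"
      using * by (auto intro!: exec_skip elim: le_regs_mono)
  qed
  then show ?thesis unfolding tdef_def by blast
qed

lemma tdef_Suc:
  assumes "tdef d f"
  shows "tdef d (\<lambda>s. Suc (f s))"
proof -
  have "\<exists>c e. computes k c (\<lambda>s. Suc (f s)) e" if "k \<ge> d" for k
  proof -
    obtain c e where c: "computes k c f e" using assms \<open>k \<ge> d\<close> unfolding tdef_def by blast
    have "computes k (Seq c (Basic (Inc k))) (\<lambda>s. Suc (f s)) (e + 2)"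
    proof (rule computesI)
      fix w b B \<rho>
      assume *: "(w, b) \<in> X" "b \<le> B" "\<And>i. k \<le> i \<Longrightarrow> \<rho> i = 0" "le_regs B (0, \<rho>)"
      let ?B = "(B + 2) ^ e" and ?B' = "(B + 2) ^ (e + 2)"
      note 1 = computesD[OF c *]
      have le: "?B + 2 \<le> ?B'" by (rule power_add2_le)
      have 2: "le_regs ?B (0, \<rho>(k := f (w, \<rho>)))" by (rule exec_final[OF 1])
      then have f: "f (w, \<rho>) \<le> ?B" by (simp add: le_regs_def del: power_Suc) (metis fun_upd_same)
      have 3: "le_regs ?B' (0, \<rho>(k := f (w, \<rho>)))"
        by (rule le_regs_mono[OF 2]) (use le in linarith)
      have "Suc (f (w, \<rho>)) \<le> ?B'" using f le by linarith
      from le_regs_upd[OF 3 this, of 0 k] have "le_regs ?B' (0, \<rho>(k := Suc (f (w, \<rho>))))"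
        by simp
      with 3
show "exec (rsem w) (Seq c (Basic (Inc k))) (0, \<rho>) (0, \<rho>(k := Suc (f (w, \<rho>)))) (le_regs ?B')"
        using exec_Inc[of "le_regs ?B'" 0 "\<rho>(k := f (w, \<rho>))" k w] le
        by (intro exec_Seq[OF exec_le_mono[OF 1]]) auto
    qed
    then show ?thesis by blast
  qed
  then show ?thesis using assms unfolding tdef_def by metis
qed

lemma tdef_var:
  assumes "i < d"
  shows "tdef d (\<lambda>s. snd s i)"
proof -
  have "computes k (Seq (move_reg2 i k (Suc k)) (move_reg (Suc k) i)) (\<lambda>s. snd s i) 1"
    if "k \<ge> d" for k
  proof (rule computesI)
    fix w b B \<rho>
    assume *: "(w, b) \<in> X" "b \<le> B" "\<And>i. k \<le> i \<Longrightarrow> \<rho> i = 0" "le_regs B (0, \<rho>)"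
    let ?r = "\<rho>(i := 0, k := \<rho> k + \<rho> i, Suc k := \<rho> (Suc k) + \<rho> i)"
    let ?r' = "?r(Suc k := 0, i := ?r i + ?r (Suc k))"
    have 1: "exec (rsem w) (move_reg2 i k (Suc k)) (0, \<rho>) (0, ?r) (le_regs B)"
      by (rule exec_move_reg2) (use * that assms in \<open>auto simp: le_regs_def\<close>)
    have 2: "exec (rsem w) (move_reg (Suc k) i) (0, ?r) (0, ?r') (le_regs B)"
      by (rule exec_move_reg) (use * that assms exec_final[OF 1] in \<open>auto simp: le_regs_def\<close>)
    have "?r' = \<rho>(k := snd (w, \<rho>) i)"
      using * that assms by auto
    with exec_Seq[OF 1 2]
    show "exec (rsem w) (Seq (move_reg2 i k (Suc k)) (move_reg (Suc k) i)) (0, \<rho>)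
        (0, \<rho>(k := snd (w, \<rho>) i)) (le_regs ((B + 2) ^ 1))"
      by (auto elim: exec_le_mono)
  qed
  then show ?thesis using assms unfolding tdef_def by auto
qed

lemma tdef_const: "tdef d (\<lambda>_. n)"
  by (induction n) (auto intro: tdef_0 tdef_Suc)

text \<open>The bound \<open>h\<close> on all intermediate values is essential: without it the
  exponent could grow with every round. The premise on \<open>g\<close> speaks of arbitrary
  definable arguments in any larger register range, so that closure rules can be applied to the body
  of a recursion, where index and accumulator occupy additional registers.\<close>

lemma tdef_rec:
  assumes a: "tdef d a" and n: "tdef d n"
    and g: "\<And>k x y. d \<le> k \<Longrightarrow> tdef k x \<Longrightarrow> tdef k y \<Longrightarrow> tdef k (\<lambda>s. g s (x s) (y s))"
    and h: "polyb d h"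
      "\<And>w b \<rho> j. (w, b) \<in> X \<Longrightarrow> j \<le> n (w, \<rho>) \<Longrightarrow> rec_nat (a (w, \<rho>)) (g (w, \<rho>)) j \<le> h (w, \<rho>)"
  shows "tdef d (\<lambda>s. rec_nat (a s) (g s) (n s))"
proof -
  have g_cong: "g (w, \<rho>) = g (w, \<rho>')" if "\<forall>i<d. \<rho> i = \<rho>' i" for w \<rho> \<rho>'
  proof (intro ext)
    fix i v
    show "g (w, \<rho>) i v = g (w, \<rho>') i v"
      using tdef_cong_regs[OF g[OF order_refl tdef_const[of d i] tdef_const[of d v]], of \<rho> \<rho>' w] that
      by simp
  qed
  have "\<exists>c e. computes k c (\<lambda>s. rec_nat (a s) (g s) (n s)) e" if "k \<ge> d" for k
  proof -
    from n that obtain cn en where cn: "computes k cn n en" unfolding tdef_def by blast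
    have "k + 2 \<ge> d" using that by simp
    with a obtain ca ea where ca: "computes (k + 2) ca a ea" unfolding tdef_def by blast
    have "tdef (k + 3) (\<lambda>s. g s (snd s (k + 1)) (snd s (k + 2)))" (is "tdef _ ?G")
      by (rule g) (use that in \<open>auto intro: tdef_var\<close>)
    then obtain cg eg where cg: "computes (k + 3) cg ?G eg" unfolding tdef_def by blast
    from h(1) obtain eh where
      eh: "\<And>w b B \<rho>. (w, b) \<in> X \<Longrightarrow> b \<le> B \<Longrightarrow> (\<forall>i<d. \<rho> i \<le> B) \<Longrightarrow> h (w, \<rho>) \<le> (B + 2) ^ eh"
      by (rule polybE) blast
    \<comment> \<open>Register \<open>k\<close> counts the remaining rounds, \<open>k + 1\<close>
      holds the index, \<open>k + 2\<close> the accumulator, and \<open>k + 3\<close> receives the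
      new value.\<close>
    define body where "body = Seq cg (Seq (clear_reg (k + 2)) (Seq (move_reg (k + 3) (k + 2)) (Basic (Inc (k + 1)))))"
    define prog where "prog = Seq cn (Seq ca (Seq (while_pos k body) (Seq (clear_reg (k + 1)) (move_reg (k + 2) k))))"
    \<comment> \<open>\<open>(B + 2) ^ E\<close> bounds the registers between any two rounds.
      \<open>F\<close> adds the cost of one evaluation of \<open>a\<close> and \<open>g\<close> from
      such a state, so it does not depend on the number of rounds.\<close>
    define E where "E = en + eh + 1"
    define F where "F = (E + 2) * ea + (E + 2) * eg + E"
    have "computes k prog (\<lambda>s. rec_nat (a s) (g s) (n s)) F"
    proof (rule computesI)
      fix w b B \<rho>
      assume X: "(w, b) \<in> X" and B: "b \<le> B" and z: "\<And>i. k \<le> i \<Longrightarrow> \<rho> i = 0" and le: "le_regs B (0, \<rho>)"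
      define Bl where "Bl = (B + 2) ^ E"
      define BB where "BB = (B + 2) ^ F"
      define N where "N = n (w, \<rho>)"
      define r where "r j = rec_nat (a (w, \<rho>)) (g (w, \<rho>)) j" for j
      define \<sigma> where "\<sigma> j = \<rho>(k := N - j, k + 1 := j, k + 2 := r j)" for j
      have "(B + 2) ^ en \<le> Bl" "(B + 2) ^ eh \<le> Bl" "B \<le> Bl"
        unfolding Bl_def using le_power[of B "en + eh"] by (auto simp only: E_def intro!: power_le) simp_all
      note Bl = this
      have BB: "Bl \<le> BB" "(Bl + 2) ^ ea \<le> BB" "(Bl + 2) ^ eg \<le> BB"
        unfolding Bl_def BB_def
        by (rule power_le order_trans[OF power_power_le]; simp add: F_def)+
      have bBl: "b \<le> Bl" using B Bl by simp
      have 1: "exec (rsem w) cn (0, \<rho>) (0, \<rho>(k := N)) (le_regs ((B + 2) ^ en))"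
        unfolding N_def by (rule computesD[OF cn X B z le])
      from exec_final[OF 1] have leN: "le_regs Bl (0, \<rho>(k := N))" using le_regs_mono Bl by blast
      then have N: "N \<le> Bl" unfolding le_regs_def by (metis fun_upd_same snd_conv)
      have r: "r j \<le> Bl" if "j \<le> N" for j
      proof -
        have "r j \<le> h (w, \<rho>)" using h(2)[OF X] that unfolding r_def N_def by blast
        also have "\<dots> \<le> (B + 2) ^ eh" by (rule eh[OF X B]) (use le in \<open>auto simp: le_regs_def\<close>)
        finally show ?thesis using Bl by simp
      qed
      have leB: "le_regs Bl (0, \<rho>)" using le Bl le_regs_mono by blast
      have a': "a (w, \<rho>(k := N)) = a (w, \<rho>)"
        by (rule tdef_cong_regs[OF a]) (use that in auto)
      have "(\<rho>(k := N))(k + 2 := a (w, \<rho>(k := N))) = \<sigma> 0"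
        unfolding \<sigma>_def a' by (auto simp: r_def z)
      with computesD[OF ca X bBl _ leN] z
      have 2: "exec (rsem w) ca (0, \<rho>(k := N)) (0, \<sigma> 0) (le_regs ((Bl + 2) ^ ea))"
        by auto
      have le\<sigma>: "le_regs Bl (0, \<sigma> j)" if "j \<le> N" for j
        using that leB N r[OF that] unfolding \<sigma>_def by (intro le_regs_upd) auto
      have 3: "exec (rsem w) (while_pos k body) (0, \<sigma> j) (0, \<sigma> N) (le_regs BB)" if "j \<le> N" for j
        using that
      proof (induction rule: inc_induct)
        case base
        have "\<sigma> N k = 0" by (simp add: \<sigma>_def)
        then show ?case by (rule exec_while_pos_0) (rule le_regs_mono[OF le\<sigma> BB(1)], simp)
      next
        case (step j)
        define \<tau> where "\<tau> = (\<sigma> j)(k := N - Suc j)"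
        have j: "\<sigma> j k = Suc (N - Suc j)" using step by (simp add: \<sigma>_def)
        have le\<tau>: "le_regs Bl (0, \<tau>)"
          unfolding \<tau>_def by (rule le_regs_upd[OF le\<sigma>]) (use step N in auto)
        have "g (w, \<tau>) = g (w, \<rho>)"
          by (rule g_cong) (use that \<open>k \<ge> d\<close> in \<open>auto simp: \<tau>_def \<sigma>_def\<close>)
        then have G: "?G (w, \<tau>) = r (Suc j)"
          by (simp add: \<tau>_def \<sigma>_def r_def)
        have z\<tau>: "\<tau> i = 0" if "k + 3 \<le> i" for i
          using that z by (simp add: \<tau>_def \<sigma>_def)
        have b1: "exec (rsem w) cg (0, \<tau>) (0, \<tau>(k + 3 := r (Suc j))) (le_regs BB)"
          using computesD[OF cg X bBl z\<tau> le\<tau>] BB(3) unfolding G by (rule exec_le_mono)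
        have b2: "exec (rsem w) (clear_reg (k + 2)) (0, \<tau>(k + 3 := r (Suc j)))
           (0, \<tau>(k + 3 := r (Suc j), k + 2 := 0)) (le_regs BB)"
          by (rule exec_clear_reg[OF exec_final[OF b1]])
        let ?t = "\<tau>(k + 3 := r (Suc j), k + 2 := 0)"
        have b3: "exec (rsem w) (move_reg (k + 3) (k + 2)) (0, ?t)
           (0, ?t(k + 3 := 0, k + 2 := ?t (k + 2) + ?t (k + 3))) (le_regs BB)"
          by (rule exec_move_reg[OF _ exec_final[OF b2]])
             (use r[of "Suc j"] step BB in auto)
        let ?u = "?t(k + 3 := 0, k + 2 := ?t (k + 2) + ?t (k + 3))"
        have u: "?u(k + 1 := Suc (?u (k + 1))) = \<sigma> (Suc j)"
          using z\<tau>[of "k + 3"] by (auto simp: \<tau>_def \<sigma>_def z)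
        have b4: "exec (rsem w) (Basic (Inc (k + 1))) (0, ?u) (0, \<sigma> (Suc j)) (le_regs BB)"
          unfolding u[symmetric]
          by (rule exec_Inc[where V = "le_regs BB", OF exec_final[OF b3]])
             (unfold u, rule le_regs_mono[OF le\<sigma> BB(1)], use step in simp)
        have b: "exec (rsem w) body (0, \<tau>) (0, \<sigma> (Suc j)) (le_regs BB)"
          unfolding body_def by (rule exec_Seq[OF b1 exec_Seq[OF b2 exec_Seq[OF b3 b4]]])
        show ?case
          by (rule exec_while_pos_Suc[OF j _ b[unfolded \<tau>_def] step.IH])
             (rule le_regs_mono[OF le\<sigma> BB(1)], use step in simp)
      qed
      have 4: "exec (rsem w) (clear_reg (k + 1)) (0, \<sigma> N) (0, (\<sigma> N)(k + 1 := 0)) (le_regs BB)"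
        by (rule exec_clear_reg[OF exec_final[OF 3[of 0]]]) simp
      let ?t = "(\<sigma> N)(k + 1 := 0)"
      have 5: "exec (rsem w) (move_reg (k + 2) k) (0, ?t) (0, ?t(k + 2 := 0, k := ?t k + ?t (k + 2))) (le_regs BB)"
        by (rule exec_move_reg[OF _ exec_final[OF 4]]) (use r[of N] BB in \<open>auto simp: \<sigma>_def\<close>)
      have t: "?t(k + 2 := 0, k := ?t k + ?t (k + 2)) = \<rho>(k := r N)"
        by (auto simp: \<sigma>_def z)
      have BB': "(B + 2) ^ en \<le> BB" using Bl(1) BB(1) by simp
      show "exec (rsem w) prog (0, \<rho>) (0, \<rho>(k := rec_nat (a (w, \<rho>)) (g (w, \<rho>)) (n (w, \<rho>))))
          (le_regs ((B + 2) ^ F))"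
        using exec_Seq[OF exec_le_mono[OF 1 BB'] exec_Seq[OF exec_le_mono[OF 2 BB(2)]
              exec_Seq[OF 3[of 0] exec_Seq[OF 4 5]]]]
        unfolding t by (simp add: prog_def r_def N_def BB_def)
    qed
    then show ?thesis by blast
  qed
  moreover have "rec_nat (a (w, \<rho>)) (g (w, \<rho>)) (n (w, \<rho>)) = rec_nat (a (w, \<rho>')) (g (w, \<rho>')) (n (w, \<rho>'))"
    if "\<forall>i<d. \<rho> i = \<rho>' i" for w \<rho> \<rho>'
    using g_cong[OF that] tdef_cong_regs[OF a, of \<rho> \<rho>' w] tdef_cong_regs[OF n, of \<rho> \<rho>' w] that
    by simp
  ultimately show ?thesis unfolding tdef_def by blast
qed

end

section \<open>Access to the input word\<close>

lemma input_cell_eq_Left_End [simp]: "input_cell w h = Left_End \<longleftrightarrow> h = 0"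
  by simp

lemma input_cell_eq_Right_End [simp]: "input_cell w h = Right_End \<longleftrightarrow> length w < h"
  by auto

declare input_cell.simps [simp del]

definition to_start :: "'i rinstr com" where
  "to_start = while (HCell (- {Left_End})) (HCell {Left_End}) (Basic (HMove Move_Left))"

lemma exec_to_start:
  assumes "le_regs B (h, \<rho>)"
  shows "exec (rsem w) to_start (h, \<rho>) (0, \<rho>) (le_regs B)"
  using assms
proof (induction h)
  case 0
  then show ?case unfolding to_start_def by (intro exec_while_false) auto
next
  case (Suc h)
  then have "le_regs B (h, \<rho>)" by (simp add: le_regs_def)
  with Suc.IH have IH: "exec (rsem w) to_start (h, \<rho>) (0, \<rho>) (le_regs B)" .
  have 1: "exec (rsem w) (Basic (HMove Move_Left)) (Suc h, \<rho>) (h, \<rho>) (le_regs B)"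
    by (rule exec_Basic) (use Suc in \<open>auto simp: le_regs_def\<close>)
  show ?case unfolding to_start_def
    by (rule exec_while_true[OF _ _ 1 IH[unfolded to_start_def]]) auto
qed

definition move_head :: "nat \<Rightarrow> 'i rinstr com" where
  "move_head k = while_pos k (Basic (HMove Move_Right))"

lemma exec_move_head:
  assumes "le_regs B (h, \<rho>)" "h \<le> Suc (length w)"
  shows "exec (rsem w) (move_head k) (h, \<rho>) (min (h + \<rho> k) (Suc (length w)), \<rho>(k := 0)) (le_regs B)"
  using assms
proof (induction "\<rho> k" arbitrary: h \<rho>)
  case 0
  then have "\<rho>(k := 0) = \<rho>" "min (h + \<rho> k) (Suc (length w)) = h" by auto
  then show ?case unfolding move_head_def
    using exec_while_pos_0[of \<rho> k "le_regs B"] 0 by simp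
next
  case (Suc n)
  let ?r = "\<rho>(k := n)" and ?h = "min (h + 1) (Suc (length w))"
  have le: "le_regs B (h, ?r)" "le_regs B (?h, ?r)"
    using Suc by (auto simp: le_regs_def) (metis Suc_leD)+
  have 1: "exec (rsem w) (Basic (HMove Move_Right)) (h, ?r) (?h, ?r) (le_regs B)"
    by (rule exec_Basic) (use le in auto)
  have "exec (rsem w) (move_head k) (?h, ?r) (min (?h + ?r k) (Suc (length w)), ?r(k := 0)) (le_regs B)"
    by (rule Suc.hyps(1)) (use le in auto)
  moreover have "min (?h + ?r k) (Suc (length w)) = min (h + \<rho> k) (Suc (length w))"
    using Suc(2) by auto
  ultimately have "exec (rsem w) (move_head k) (?h, ?r) (min (h + \<rho> k) (Suc (length w)), \<rho>(k := 0)) (le_regs B)"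
    by simp
  then show ?case unfolding move_head_def
    by (rule exec_while_pos_Suc[where V = "le_regs B", OF Suc.hyps(2)[symmetric] Suc.prems(1) 1])
qed

primrec incs :: "nat \<Rightarrow> nat \<Rightarrow> 'i rinstr com" where
  "incs k 0 = skip"
| "incs k (Suc m) = Seq (Basic (Inc k)) (incs k m)"

lemma exec_incs:
  assumes "le_regs B (h, \<rho>)" "\<rho> k + m \<le> B"
  shows "exec (rsem w) (incs k m) (h, \<rho>) (h, \<rho>(k := \<rho> k + m)) (le_regs B)"
  using assms
proof (induction m arbitrary: \<rho>)
  case 0
  then show ?case by (simp add: exec_skip)
next
  case (Suc m)
  let ?r = "\<rho>(k := Suc (\<rho> k))"
  have le: "le_regs B (h, ?r)" by (rule le_regs_upd[OF Suc.prems(1)]) (use Suc.prems in simp)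
  have "exec (rsem w) (incs k m) (h, ?r) (h, ?r(k := ?r k + m)) (le_regs B)"
    by (rule Suc.IH[OF le]) (use Suc.prems in simp)
  then have "exec (rsem w) (incs k m) (h, ?r) (h, \<rho>(k := \<rho> k + Suc m)) (le_regs B)" by simp
  then show ?case
    unfolding incs.simps by (rule exec_Seq[OF exec_Inc[where V = "le_regs B", OF Suc.prems(1) le]])
qed

fun cell_code :: "('i \<Rightarrow> nat) \<Rightarrow> 'i cell \<Rightarrow> nat" where
  "cell_code code (Symbol a) = code a"
| "cell_code code _ = 0"

text \<open>Every code up to a constant gets its own branch, which tests the cell and then adds the
  constant; only the branch with the right code survives.\<close>

primrec read_cell :: "('i \<Rightarrow> nat) \<Rightarrow> nat \<Rightarrow> nat \<Rightarrow> 'i rinstr com" where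
  "read_cell code k 0 = Basic (HCell {c. cell_code code c = 0})"
| "read_cell code k (Suc m) = Alt (read_cell code k m)
     (Seq (Basic (HCell {c. cell_code code c = Suc m})) (incs k (Suc m)))"

lemma exec_read_cell:
  fixes w :: "'i list" and code :: "'i \<Rightarrow> nat"
  assumes "le_regs B (h, \<rho>)" "\<rho> k = 0"
  defines "c \<equiv> cell_code code (input_cell w h)"
  shows "c \<le> m \<Longrightarrow> c \<le> B \<Longrightarrow> exec (rsem w) (read_cell code k m) (h, \<rho>) (h, \<rho>(k := c)) (le_regs B)"
    and "m < c \<Longrightarrow> dead (rsem w) (read_cell code k m) (h, \<rho>) (le_regs B)"
proof (induction m)
  case 0
  {
    case 1
    then have "\<rho>(k := c) = \<rho>" using assms(2) by auto
    then show ?case using 1 assms(1) by (auto simp: c_def intro!: exec_Basic)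
  next
    case 2
    then show ?case using assms(1) by (auto simp: c_def intro!: dead_Basic)
  }
next
  case (Suc m)
  {
    case 1
    show ?case
    proof (cases "c = Suc m")
      case True
      have "exec (rsem w) (Basic (HCell {c. cell_code code c = Suc m})) (h, \<rho>) (h, \<rho>) (le_regs B)"
        using True assms(1) by (auto simp: c_def intro!: exec_Basic)
      moreover have "exec (rsem w) (incs k (Suc m)) (h, \<rho>) (h, \<rho>(k := \<rho> k + Suc m)) (le_regs B)"
        by (rule exec_incs) (use 1 True assms in auto)
      ultimately have "exec (rsem w) (Seq (Basic (HCell {c. cell_code code c = Suc m})) (incs k (Suc m)))
         (h, \<rho>) (h, \<rho>(k := c)) (le_regs B)"
        using True assms(2) by (auto intro: exec_Seq simp del: incs.simps)
      moreover have "dead (rsem w) (read_cell code k m) (h, \<rho>) (le_regs B)"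
        using Suc.IH(2) True by simp
      ultimately show ?thesis unfolding read_cell.simps by (intro exec_Alt2)
    next
      case False
      then have "dead (rsem w) (Seq (Basic (HCell {c. cell_code code c = Suc m})) (incs k (Suc m)))
         (h, \<rho>) (le_regs B)"
        using assms(1) by (auto simp: c_def intro!: dead_Seq dead_Basic)
      moreover have "exec (rsem w) (read_cell code k m) (h, \<rho>) (h, \<rho>(k := c)) (le_regs B)"
        using Suc.IH(1) False 1 by (simp del: fun_upd_apply)
      ultimately show ?thesis unfolding read_cell.simps by (intro exec_Alt1)
    qed
  next
    case 2
    then have "dead (rsem w) (Seq (Basic (HCell {c. cell_code code c = Suc m})) (incs k (Suc m)))
       (h, \<rho>) (le_regs B)"
      using assms(1) by (auto simp: c_def intro!: dead_Seq dead_Basic)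
    moreover have "dead (rsem w) (read_cell code k m) (h, \<rho>) (le_regs B)"
      using Suc.IH(2) 2 by simp
    ultimately show ?case unfolding read_cell.simps by (intro dead_Alt)
  }
qed

definition to_end :: "nat \<Rightarrow> 'i rinstr com" where
  "to_end k = while (HCell (- {Right_End})) (HCell {Right_End}) (Seq (Basic (HMove Move_Right)) (Basic (Inc k)))"

lemma exec_to_end:
  assumes "le_regs B (h, \<rho>)" "\<rho> k + (Suc (length w) - h) \<le> B" "h \<le> Suc (length w)"
  shows "exec (rsem w) (to_end k) (h, \<rho>) (Suc (length w), \<rho>(k := \<rho> k + (Suc (length w) - h))) (le_regs B)"
  using assms
proof (induction "Suc (length w) - h" arbitrary: h \<rho>)
  case 0
  then have "h = Suc (length w)" by simp
  then show ?case using 0 unfolding to_end_def by (auto intro!: exec_while_false)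
next
  case (Suc n)
  then have h: "h \<le> length w" by simp
  let ?r = "\<rho>(k := Suc (\<rho> k))"
  have le: "le_regs B (h, ?r)" using Suc.prems h by (intro le_regs_upd[of B h]) auto
  then have le': "le_regs B (Suc h, \<rho>)" "le_regs B (Suc h, ?r)"
    using Suc.prems(1) by (auto simp: le_regs_def)
  have 1: "exec (rsem w) (Basic (HMove Move_Right)) (h, \<rho>) (Suc h, \<rho>) (le_regs B)"
    by (rule exec_Basic) (use h Suc.prems le' in auto)
  note 2 = exec_Inc[of "le_regs B", OF le', of w]
  have "exec (rsem w) (to_end k) (Suc h, ?r) (Suc (length w), ?r(k := ?r k + (Suc (length w) - Suc h))) (le_regs B)"
    by (rule Suc.hyps(1)) (use Suc.hyps(2) Suc.prems h le' in auto)
  moreover have "?r(k := ?r k + (Suc (length w) - Suc h)) = \<rho>(k := \<rho> k + (Suc (length w) - h))"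
    using h by (intro ext) auto
  ultimately have IH: "exec (rsem w) (to_end k) (Suc h, ?r)
      (Suc (length w), \<rho>(k := \<rho> k + (Suc (length w) - h))) (le_regs B)" by simp
  show ?case unfolding to_end_def
    by (rule exec_while_true[OF _ _ exec_Seq[OF 1 2] IH[unfolded to_end_def]]) (use h in auto)
qed

context inputs
begin

text \<open>The right end marker sits at position \<open>length w + 1\<close>, hence the final
  decrement after counting the moves.\<close>

lemma tdef_length: "tdef d (\<lambda>s. length (fst s))"
proof -
  have "computes k (Seq (to_end k) (Seq (Basic (Dec k)) to_start)) (\<lambda>s. length (fst s)) 1" for k
  proof (rule computesI)
    fix w b B and \<rho> :: "nat \<Rightarrow> nat"
    assume *: "(w, b) \<in> X" "b \<le> B" "\<And>i. i \<ge> k \<Longrightarrow> \<rho> i = 0" "le_regs B (0, \<rho>)"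
    let ?n = "length w" and ?V = "le_regs (B + 2) :: rstate \<Rightarrow> bool"
    have B: "?n \<le> B" using X[OF *(1)] * by simp
    have V: "?V (0, \<rho>)" using * le_regs_mono by simp
    have 1: "exec (rsem w) (to_end k) (0, \<rho>) (Suc ?n, \<rho>(k := Suc ?n)) ?V"
      using exec_to_end[OF V, of k w] * B by simp
    have V': "?V (Suc ?n, \<rho>(k := ?n))"
      by (rule le_regs_upd[OF V]) (use B in simp)
    have 2: "exec (rsem w) (Basic (Dec k)) (Suc ?n, \<rho>(k := Suc ?n)) (Suc ?n, \<rho>(k := ?n)) ?V"
      using exec_Dec[of ?V "Suc ?n" "\<rho>(k := Suc ?n)" k w] exec_final[OF 1] V' by simp
    show "exec (rsem w) (Seq (to_end k) (Seq (Basic (Dec k)) to_start)) (0, \<rho>)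
        (0, \<rho>(k := length (fst (w, \<rho>)))) (le_regs ((B + 2) ^ 1))"
      using exec_Seq[OF 1 exec_Seq[OF 2 exec_to_start[OF V']]] by simp
  qed
  then show ?thesis unfolding tdef_def by auto
qed

lemma tdef_input:
  assumes "tdef d f"
  shows "tdef d (\<lambda>s. input_code code (fst s) (f s))"
proof -
  define C where "C = Max (insert 0 (code ` A))"
  have C: "code a \<le> C" if "a \<in> A" for a
    unfolding C_def using finite_A that by (intro Max_ge) auto
  have "\<exists>c e. computes k c (\<lambda>s. input_code code (fst s) (f s)) e" if "k \<ge> d" for k
  proof -
    obtain c e where c: "computes k c f e" using assms \<open>k \<ge> d\<close> unfolding tdef_def by blast
    let ?c = "Seq c (Seq (Basic (HMove Move_Right)) (Seq (move_head k) (Seq (read_cell code k C) to_start)))"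
    have "computes k ?c (\<lambda>s. input_code code (fst s) (f s)) (e + C)"
    proof (rule computesI)
      fix w b B \<rho>
      assume *: "(w, b) \<in> X" "b \<le> B" "\<And>i. k \<le> i \<Longrightarrow> \<rho> i = 0" "le_regs B (0, \<rho>)"
      let ?V = "le_regs ((B + 2) ^ (e + C)) :: rstate \<Rightarrow> bool"
      let ?x = "f (w, \<rho>)" and ?n = "length w"
      let ?h = "min (1 + ?x) (Suc ?n)"
      \<comment> \<open>The largest code of a symbol is a constant, and it is absorbed into the
        exponent.\<close>
      have CB: "C \<le> (B + 2) ^ (e + C)"
      proof -
        have "C \<le> 2 ^ C" by (rule less_imp_le) (rule less_exp)
        also have "\<dots> \<le> (B + 2) ^ C" by (rule power_mono) auto
        also have "\<dots> \<le> (B + 2) ^ (e + C)" by (rule power_le) simp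
        finally show ?thesis .
      qed
      have 1: "exec (rsem w) c (0, \<rho>) (0, \<rho>(k := ?x)) ?V"
        by (rule exec_le_mono[OF computesD[OF c *] power_le]) simp_all
      have V: "?V (h, \<rho>(k := ?x))" for h
        by (rule le_regs_head[THEN iffD2, OF exec_final[OF 1]])
      have 2: "exec (rsem w) (Basic (HMove Move_Right)) (0, \<rho>(k := ?x)) (1, \<rho>(k := ?x)) ?V"
        by (rule exec_Basic[where V = ?V, OF _ V V]) auto
      have 3: "exec (rsem w) (move_head k) (1, \<rho>(k := ?x)) (?h, \<rho>(k := 0)) ?V"
        using exec_move_head[OF V, of 1 w k] by simp
      let ?cc = "cell_code code (input_cell w ?h)"
      \<comment> \<open>Moves beyond the word stop at the end marker, whose code 0 agrees with the
        default of \<open>input_code\<close>.\<close>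
      have cc: "?cc = input_code code w ?x"
        by (auto simp: input_code_def input_cell.simps)
      have wA: "w \<in> lists A" using X * by blast
      have "?cc \<le> C"
        unfolding cc input_code_def using C wA by auto
      then have "exec (rsem w) (read_cell code k C) (?h, \<rho>(k := 0)) (?h, (\<rho>(k := 0))(k := ?cc)) ?V"
        using CB exec_final[OF 3] by (intro exec_read_cell) auto
      then have 4: "exec (rsem w) (read_cell code k C) (?h, \<rho>(k := 0)) (?h, \<rho>(k := ?cc)) ?V"
        by simp
      show "exec (rsem w) ?c (0, \<rho>) (0, \<rho>(k := input_code code (fst (w, \<rho>)) (f (w, \<rho>)))) ?V"
        using exec_Seq[OF 1 exec_Seq[OF 2 exec_Seq[OF 3 exec_Seq[OF 4
            exec_to_start[OF exec_final[OF 4]]]]]]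
        unfolding cc by simp
    qed
    then show ?thesis by blast
  qed
  moreover have "input_code code w (f (w, \<rho>)) = input_code code w (f (w, \<rho>'))"
    if "\<forall>i<d. \<rho> i = \<rho>' i" for w \<rho> \<rho>'
    using tdef_cong_regs[OF assms, of \<rho> \<rho>' w] that by simp
  ultimately show ?thesis unfolding tdef_def by simp
qed

end

section \<open>Arithmetic, bounded quantifiers and bounded search\<close>

definition digit :: "nat \<Rightarrow> nat \<Rightarrow> nat \<Rightarrow> nat" where
  "digit b x i = x div b ^ i mod b"

text \<open>Bounded search: the least \<open>v < n\<close> with \<open>P v\<close>, and \<open>n\<close> if there is none.\<close>

definition bmin :: "nat \<Rightarrow> (nat \<Rightarrow> bool) \<Rightarrow> nat" where
  "bmin n P = (\<Sum>v<n. of_bool (\<forall>j<Suc v. \<not> P j))"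

lemma bmin_None: "\<forall>v<n. \<not> P v \<Longrightarrow> bmin n P = n"
  unfolding bmin_def by (subst sum.cong[OF refl, of _ _ "\<lambda>_. 1"]) auto

lemma bmin_Some:
  assumes "v < n" "P v"
  shows "bmin n P < n \<and> P (bmin n P)"
proof -
  define m where "m = (LEAST v. P v)"
  have m: "P m" "m \<le> v" "\<And>j. j < m \<Longrightarrow> \<not> P j"
    using assms(2) unfolding m_def by (auto intro: LeastI Least_le dest: not_less_Least)
  have "(\<forall>j<Suc v. \<not> P j) \<longleftrightarrow> v < m" for v
    using m(1) m(3) by (meson le_less_trans less_Suc_eq_le not_le)
  then have "bmin n P = (\<Sum>v<n. of_bool (v < m))" by (simp add: bmin_def)
  also have "\<dots> = card ({..<n} \<inter> {v. v < m})" by simp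
  also have "{..<n} \<inter> {v. v < m} = {..<m}" using m assms(1) by auto
  finally show ?thesis using m assms by simp
qed

lemma rec_nat_add: "rec_nat a (\<lambda>_ v. Suc v) n = a + n"
  by (induction n) auto

lemma rec_nat_sum: "rec_nat 0 (\<lambda>i v. v + f i) n = (\<Sum>i<n. f i)"
  by (induction n) auto

lemma rec_nat_diff: "rec_nat a (\<lambda>_ v. v - 1) n = a - n"
  by (induction n) auto

lemma rec_nat_div_power: "rec_nat (x :: nat) (\<lambda>_ v. v div b) i = x div b ^ i"
proof (induction i)
  case (Suc i)
  then show ?case using div_mult2_eq[of x "b ^ i" b] by (simp add: mult.commute)
qed simp

text \<open>The quotient counts the positive multiples of \<open>y\<close> up to \<open>x\<close>.
  As a bounded sum it is within reach of bounded recursion; the case \<open>y = 0\<close> follows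
  the convention for division by 0.\<close>

lemma div_eq_sum: "(x::nat) div y = (if y = 0 then 0 else (\<Sum>v<x. of_bool (Suc v * y \<le> x)))"
proof (cases "y = 0")
  case False
  have "(\<Sum>v<x. of_bool (Suc v * y \<le> x)) = card ({..<x} \<inter> {v. Suc v * y \<le> x})"
    by simp
  also have "{..<x} \<inter> {v. Suc v * y \<le> x} = {..<x div y}"
  proof -
    have "Suc v * y \<le> x \<longleftrightarrow> v < x div y" for v
    proof -
      have "0 < y" using False by simp
      then have "Suc v \<le> x div y \<longleftrightarrow> Suc v * y \<le> x" by (rule less_eq_div_iff_mult_less_eq)
      then show ?thesis by (simp only: Suc_le_eq)
    qed
    then have "v \<in> {..<x} \<inter> {v. Suc v * y \<le> x} \<longleftrightarrow> v < x \<and> v < x div y" for v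
      by (simp only: Int_iff lessThan_iff mem_Collect_eq)
    then show ?thesis using div_le_dividend[of x y] by (intro set_eqI) (simp only: lessThan_iff, linarith)
  qed
  finally show ?thesis using False by simp
qed simp

context inputs
begin

abbreviation pdef :: "nat \<Rightarrow> ('i env \<Rightarrow> bool) \<Rightarrow> bool" where
  "pdef d P \<equiv> tdef d (\<lambda>s. of_bool (P s))"

lemma tdef_add:
  assumes "tdef d f" "tdef d g" shows "tdef d (\<lambda>s. f s + g s)"
proof -
  have "tdef d (\<lambda>s. rec_nat (f s) (\<lambda>_ v. Suc v) (g s))"
    by (rule tdef_rec[where h = "\<lambda>s. f s + g s"])
       (use assms in \<open>auto intro: tdef_Suc polyb_add tdef_polyb simp: rec_nat_add\<close>)
  then show ?thesis by (simp add: rec_nat_add)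
qed

lemma tdef_mult:
  assumes "tdef d f" "tdef d g" shows "tdef d (\<lambda>s. f s * g s)"
proof -
  have *: "rec_nat 0 (\<lambda>_ v. v + x) n = x * n" for x n :: nat by (induction n) auto
  have "tdef d (\<lambda>s. rec_nat 0 (\<lambda>_ v. v + f s) (g s))"
    by (rule tdef_rec[where h = "\<lambda>s. f s * g s"])
       (use assms in \<open>auto intro: tdef_0 tdef_add tdef_weaken polyb_mult tdef_polyb simp: *\<close>)
  then show ?thesis by (simp add: *)
qed

lemma tdef_pred:
  assumes "tdef d f" shows "tdef d (\<lambda>s. f s - 1)"
proof -
  have *: "rec_nat 0 (\<lambda>i _. i) n = n - 1" for n by (cases n) auto
  have "tdef d (\<lambda>s. rec_nat 0 (\<lambda>i _. i) (f s))"
    by (rule tdef_rec[where h = f]) (use assms in \<open>auto intro: tdef_0 tdef_polyb simp: *\<close>)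
  then show ?thesis by (simp add: *)
qed

lemma tdef_diff:
  assumes "tdef d f" "tdef d g" shows "tdef d (\<lambda>s. f s - g s)"
proof -
  have "tdef d (\<lambda>s. rec_nat (f s) (\<lambda>_ v. v - 1) (g s))"
    by (rule tdef_rec[where h = f])
       (use assms in \<open>auto intro: tdef_pred tdef_polyb simp: rec_nat_diff simp del: One_nat_def\<close>)
  then show ?thesis by (simp only: rec_nat_diff)
qed

lemma tdef_if0:
  assumes "tdef d f" "tdef d g" "tdef d h" shows "tdef d (\<lambda>s. if h s = 0 then f s else g s)"
proof -
  have *: "rec_nat a (\<lambda>_ _. b) n = (if n = 0 then a else b)" for a b :: nat and n by (cases n) auto
  have "tdef d (\<lambda>s. rec_nat (f s) (\<lambda>_ _. g s) (h s))"
    by (rule tdef_rec[where h = "\<lambda>s. f s + g s"])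
       (use assms in \<open>auto intro: tdef_weaken polyb_add tdef_polyb simp: *\<close>)
  then show ?thesis by (simp add: *)
qed

lemma tdef_if:
  assumes "pdef d P" "tdef d f" "tdef d g" shows "tdef d (\<lambda>s. if P s then f s else g s)"
proof -
  have "tdef d (\<lambda>s. if of_bool (P s) = (0::nat) then g s else f s)"
    by (rule tdef_if0) (use assms in auto)
  moreover have "(\<lambda>s. if of_bool (P s) = (0::nat) then g s else f s) = (\<lambda>s. if P s then f s else g s)"
    by (rule ext) simp
  ultimately show ?thesis by (simp only:)
qed

lemma pdef_le:
  assumes "tdef d f" "tdef d g" shows "pdef d (\<lambda>s. f s \<le> g s)"
proof -
  have "tdef d (\<lambda>s. 1 - (f s - g s))" using assms by (intro tdef_diff tdef_const)
  moreover have "1 - (x - y) = (of_bool (x \<le> y) :: nat)" for x y :: nat by auto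
  ultimately show ?thesis by (simp del: One_nat_def)
qed

lemma pdef_not:
  assumes "pdef d P" shows "pdef d (\<lambda>s. \<not> P s)"
proof -
  have "tdef d (\<lambda>s. 1 - of_bool (P s))" using assms by (intro tdef_diff tdef_const)
  moreover have "1 - of_bool x = (of_bool (\<not> x) :: nat)" for x by auto
  ultimately show ?thesis by (simp del: One_nat_def)
qed

lemma pdef_conj:
  assumes "pdef d P" "pdef d Q" shows "pdef d (\<lambda>s. P s \<and> Q s)"
  using tdef_mult[OF assms] by (simp add: of_bool_conj)

lemma pdef_disj:
  assumes "pdef d P" "pdef d Q" shows "pdef d (\<lambda>s. P s \<or> Q s)"
  using pdef_not[OF pdef_conj[OF pdef_not[OF assms(1)] pdef_not[OF assms(2)]]] by simp

lemma pdef_imp: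
  assumes "pdef d P" "pdef d Q" shows "pdef d (\<lambda>s. P s \<longrightarrow> Q s)"
  using pdef_disj[OF pdef_not[OF assms(1)] assms(2)] by (simp only: imp_conv_disj)

lemma pdef_less:
  assumes "tdef d f" "tdef d g" shows "pdef d (\<lambda>s. f s < g s)"
  using pdef_le[OF tdef_Suc[OF assms(1)] assms(2)] by (simp add: Suc_le_eq)

lemma pdef_eq:
  assumes "tdef d f" "tdef d g" shows "pdef d (\<lambda>s. f s = g s)"
  using pdef_conj[OF pdef_le[OF assms] pdef_le[OF assms(2,1)]] by (simp add: eq_iff)

lemma pdef_iff:
  assumes "pdef d P" "pdef d Q" shows "pdef d (\<lambda>s. P s \<longleftrightarrow> Q s)"
  using pdef_conj[OF pdef_imp[OF assms] pdef_imp[OF assms(2,1)]] by (simp add: iff_conv_conj_imp)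

text \<open>The index of a summand may exceed \<open>B\<close>, but it is below \<open>n\<close> and
  thus polynomially bounded. The bound for \<open>g\<close> is therefore applied with this larger
  value in place of \<open>B\<close>.\<close>

lemma polyb_sum:
  assumes n: "tdef d n" and g: "\<And>k x. d \<le> k \<Longrightarrow> tdef k x \<Longrightarrow> tdef k (\<lambda>s. g s (x s))"
  shows "polyb d (\<lambda>s. \<Sum>i<n s. g s i)"
proof -
  from tdef_polyb[OF n] obtain en where
    en: "\<And>w b B \<rho>. (w, b) \<in> X \<Longrightarrow> b \<le> B \<Longrightarrow> (\<forall>i<d. \<rho> i \<le> B) \<Longrightarrow> n (w, \<rho>) \<le> (B + 2) ^ en"
    by (rule polybE) blast
  have "tdef (Suc d) (\<lambda>s. g s (snd s d))" by (rule g) (auto intro: tdef_var)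
  from tdef_polyb[OF this] obtain eg where
    eg: "\<And>w b B \<rho>. (w, b) \<in> X \<Longrightarrow> b \<le> B \<Longrightarrow> (\<forall>i<Suc d. \<rho> i \<le> B) \<Longrightarrow>
      g (w, \<rho>) (\<rho> d) \<le> (B + 2) ^ eg"
    by (rule polybE) auto
  show ?thesis
  proof (rule polybI[where e = "en + (Suc en + 2) * eg"])
    fix w b B \<rho> assume X: "(w, b) \<in> X" and B: "b \<le> B" and \<rho>: "\<forall>i<d. \<rho> i \<le> B"
    let ?B = "(B + 2) ^ Suc en"
    have BB: "B \<le> ?B" by (rule le_power)
    have nB: "n (w, \<rho>) \<le> ?B" by (rule order_trans[OF en[OF X B \<rho>] power_le]) simp
    have "g (w, \<rho>) i \<le> (B + 2) ^ ((Suc en + 2) * eg)" if "i < n (w, \<rho>)" for i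
    proof -
      let ?r = "\<rho>(d := i)"
      have "g (w, \<rho>) i = g (w, ?r) i"
        using tdef_cong_regs[OF g[OF order_refl tdef_const[of d i]], of \<rho> ?r w] by simp
      also have "\<dots> = g (w, ?r) (?r d)" by simp
      also have "\<dots> \<le> (?B + 2) ^ eg"
      proof (rule eg[OF X])
        show "b \<le> ?B" using B BB by linarith
        show "\<forall>j<Suc d. ?r j \<le> ?B"
        proof (intro allI impI)
          fix j assume "j < Suc d"
          show "?r j \<le> ?B"
          proof (cases "j = d")
            case True
            then show ?thesis using that nB by simp
          next
            case False
            then have "\<rho> j \<le> B" using \<open>j < Suc d\<close> \<rho> by simp
            then show ?thesis using False BB by simp
          qed
        qed
      qed
      also have "\<dots> \<le> (B + 2) ^ ((Suc en + 2) * eg)" by (rule power_power_le)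
      finally show ?thesis .
    qed
    then have "(\<Sum>i<n (w, \<rho>). g (w, \<rho>) i) \<le> n (w, \<rho>) * (B + 2) ^ ((Suc en + 2) * eg)"
      using sum_bounded_above[of "{..<n (w, \<rho>)}" "g (w, \<rho>)"] by simp
    also have "\<dots> \<le> (B + 2) ^ en * (B + 2) ^ ((Suc en + 2) * eg)"
      by (rule mult_right_mono[OF en[OF X B \<rho>]]) simp
    finally show "(\<Sum>i<n (w, \<rho>). g (w, \<rho>) i) \<le> (B + 2) ^ (en + (Suc en + 2) * eg)"
      by (simp only: power_add)
  qed
qed

lemma tdef_sum:
  assumes n: "tdef d n" and g: "\<And>k x. d \<le> k \<Longrightarrow> tdef k x \<Longrightarrow> tdef k (\<lambda>s. g s (x s))"
  shows "tdef d (\<lambda>s. \<Sum>i<n s. g s i)"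
proof -
  have "tdef d (\<lambda>s. rec_nat 0 (\<lambda>i v. v + g s i) (n s))"
  proof (rule tdef_rec[where h = "\<lambda>s. \<Sum>i<n s. g s i"])
    show "polyb d (\<lambda>s. \<Sum>i<n s. g s i)" by (rule polyb_sum[OF n g])
    show "rec_nat 0 (\<lambda>i v. v + g (w, \<rho>) i) j \<le> (\<Sum>i<n (w, \<rho>). g (w, \<rho>) i)"
      if "j \<le> n (w, \<rho>)" for w \<rho> j
      unfolding rec_nat_sum using that by (intro sum_mono2) auto
  qed (use n g in \<open>auto intro: tdef_0 tdef_add\<close>)
  then show ?thesis by (simp add: rec_nat_sum)
qed

lemma pdef_ex:
  assumes n: "tdef d n" and P: "\<And>k x. d \<le> k \<Longrightarrow> tdef k x \<Longrightarrow> pdef k (\<lambda>s. P s (x s))"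
  shows "pdef d (\<lambda>s. \<exists>i<n s. P s i)"
proof -
  have "pdef d (\<lambda>s. 0 < (\<Sum>i<n s. of_bool (P s i) :: nat))"
    by (intro pdef_less tdef_const tdef_sum n) (rule P)
  moreover have "0 < (\<Sum>i<m. of_bool (Q i) :: nat) \<longleftrightarrow> (\<exists>i<m. Q i)" for m :: nat and Q
    by (simp add: card_gt_0_iff) blast
  ultimately show ?thesis by simp
qed

lemma pdef_all:
  assumes n: "tdef d n" and P: "\<And>k x. d \<le> k \<Longrightarrow> tdef k x \<Longrightarrow> pdef k (\<lambda>s. P s (x s))"
  shows "pdef d (\<lambda>s. \<forall>i<n s. P s i)"
proof -
  have "pdef d (\<lambda>s. \<not> (\<exists>i<n s. \<not> P s i))"
    by (intro pdef_not pdef_ex n) (rule P)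
  then show ?thesis by simp
qed

lemma tdef_bmin:
  assumes n: "tdef d n" and P: "\<And>k x. d \<le> k \<Longrightarrow> tdef k x \<Longrightarrow> pdef k (\<lambda>s. P s (x s))"
  shows "tdef d (\<lambda>s. bmin (n s) (P s))"
  unfolding bmin_def by (intro tdef_sum n pdef_all tdef_Suc pdef_not) (auto intro: P)

lemma tdef_div:
  assumes "tdef d f" "tdef d g" shows "tdef d (\<lambda>s. f s div g s)"
  unfolding div_eq_sum
  by (intro tdef_if pdef_eq tdef_sum tdef_const pdef_le tdef_mult tdef_Suc)
     (auto intro: assms tdef_weaken)

lemma tdef_mod:
  assumes "tdef d f" "tdef d g" shows "tdef d (\<lambda>s. f s mod g s)"
  using tdef_diff[OF assms(1) tdef_mult[OF tdef_div[OF assms] assms(2)]]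
  by (simp add: minus_div_mult_eq_mod)

text \<open>The power itself may be far beyond every polynomial bound. Repeated division avoids it,
  and all intermediate values are at most the dividend.\<close>

lemma tdef_div_power:
  assumes "tdef d f" "tdef d g" "tdef d h" shows "tdef d (\<lambda>s. f s div g s ^ h s)"
proof -
  have "tdef d (\<lambda>s. rec_nat (f s) (\<lambda>_ v. v div g s) (h s))"
    by (rule tdef_rec[where h = f])
       (use assms in \<open>auto intro: tdef_div tdef_weaken tdef_polyb simp: rec_nat_div_power\<close>)
  then show ?thesis by (simp add: rec_nat_div_power)
qed

lemma tdef_digit:
  assumes "tdef d f" "tdef d g" "tdef d h" shows "tdef d (\<lambda>s. digit (f s) (g s) (h s))"
  unfolding digit_def by (intro tdef_mod tdef_div_power assms)

lemmas tdef_intros = tdef_const tdef_Suc tdef_add tdef_mult tdef_diff tdef_if pdef_le pdef_less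
  pdef_eq pdef_not pdef_conj pdef_disj pdef_imp pdef_iff tdef_sum pdef_ex pdef_all tdef_bmin
  tdef_div tdef_mod tdef_div_power tdef_digit tdef_length tdef_input

end

section \<open>Programs with definable assignments, tests and bounded guesses\<close>

datatype 'i hinstr =
    Assign nat "'i env \<Rightarrow> nat"
  | Test "'i env \<Rightarrow> bool"
  | Guess nat "'i env \<Rightarrow> nat"

text \<open>A guess carries an explicit bound, because even the computations that guess in vain must
  respect the space bound.\<close>

fun hsem :: "'i list \<Rightarrow> 'i hinstr \<Rightarrow> (nat \<Rightarrow> nat) \<Rightarrow> (nat \<Rightarrow> nat) \<Rightarrow> bool" where
  "hsem w (Assign r f) \<rho> \<rho>' \<longleftrightarrow> \<rho>' = \<rho>(r := f (w, \<rho>))"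
| "hsem w (Test P) \<rho> \<rho>' \<longleftrightarrow> \<rho>' = \<rho> \<and> P (w, \<rho>)"
| "hsem w (Guess r f) \<rho> \<rho>' \<longleftrightarrow> (\<exists>v\<le>f (w, \<rho>). \<rho>' = \<rho>(r := v))"

lemma refines_mono:
  assumes "refines bs cs G R V c c'" "\<And>t. V t \<Longrightarrow> V' t"
  shows "refines bs cs G R V' c c'"
  using assms unfolding refines_def by blast

lemma rinstr_ok_mono: "rinstr_ok K b \<Longrightarrow> K \<le> K' \<Longrightarrow> rinstr_ok K' b"
  by (cases b) auto

lemma ex_rinstr_ok: "\<exists>K. \<forall>b\<in>basics c. rinstr_ok K b"
proof -
  have one: "\<exists>K. rinstr_ok K b" for b :: "'i rinstr"
    by (cases b) auto
  have "\<exists>K. \<forall>b\<in>S. rinstr_ok K b" if "finite S" for S :: "'i rinstr set"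
    using that
  proof induction
    case (insert x F)
    then obtain K K' where "\<forall>b\<in>F. rinstr_ok K b" "rinstr_ok K' x" using one by blast
    then show ?case by (intro exI[of _ "max K K'"]) (auto intro: rinstr_ok_mono)
  qed simp
  then show ?thesis using finite_basics by blast
qed

text \<open>Units are moved from \<open>m\<close> to \<open>r\<close> one by one; the choice
  consists in when to stop. What remains in \<open>m\<close> has to be cleared afterwards.\<close>

definition guess_loop :: "nat \<Rightarrow> nat \<Rightarrow> 'i rinstr com" where
  "guess_loop m r = Star (Seq (Basic (NonZero m)) (Seq (Basic (Dec m)) (Basic (Inc r))))"

lemma guess_loop:
  assumes "le_regs B (0, \<rho>)" "n \<le> B" "r \<noteq> m"
  defines "\<sigma> \<equiv> \<lambda>j. \<rho>(m := n - j, r := j)"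
  shows "sem (rsem w) (guess_loop m r) (0, \<sigma> 0) s \<longleftrightarrow> (\<exists>j\<le>n. s = (0, \<sigma> j))"
    and "vis (rsem w) (guess_loop m r) (0, \<sigma> 0) s \<Longrightarrow> le_regs B s"
proof -
  let ?body = "Seq (Basic (NonZero m)) (Seq (Basic (Dec m)) (Basic (Inc r)))"
  have le: "le_regs B (0, \<sigma> j)" if "j \<le> n" for j
    unfolding \<sigma>_def using assms that by (intro le_regs_upd) auto
  have step: "exec (rsem w) ?body (0, \<sigma> j) (0, \<sigma> (Suc j)) (le_regs B)" if "j < n" for j
  proof (rule exec_Seq[OF _ exec_Seq])
    let ?t = "(\<sigma> j)(m := n - Suc j)"
    have t: "le_regs B (0, ?t)" by (rule le_regs_upd[OF le]) (use that assms in auto)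
    show "exec (rsem w) (Basic (NonZero m)) (0, \<sigma> j) (0, \<sigma> j) (le_regs B)"
      using that assms(3) le[of j] by (intro exec_Basic) (auto simp: \<sigma>_def)
    show "exec (rsem w) (Basic (Dec m)) (0, \<sigma> j) (0, ?t) (le_regs B)"
      by (rule exec_Basic[where V = "le_regs B", OF _ le t]) (use that assms(3) in \<open>auto simp: \<sigma>_def\<close>)
    have "\<sigma> (Suc j) = ?t(r := Suc (?t r))" using assms(3) by (auto simp: \<sigma>_def)
    then show "exec (rsem w) (Basic (Inc r)) (0, ?t) (0, \<sigma> (Suc j)) (le_regs B)"
      using t le[of "Suc j"] that by (intro exec_Basic) auto
  qed
  have stop: "dead (rsem w) ?body (0, \<sigma> n) (le_regs B)"
    using assms(3) le[of n] by (intro dead_Seq dead_Basic) (auto simp: \<sigma>_def)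
  have star: "(sem (rsem w) ?body)\<^sup>*\<^sup>* (0, \<sigma> 0) s \<longleftrightarrow> (\<exists>j\<le>n. s = (0, \<sigma> j))" for s
  proof
    assume "(sem (rsem w) ?body)\<^sup>*\<^sup>* (0, \<sigma> 0) s"
    then show "\<exists>j\<le>n. s = (0, \<sigma> j)"
    proof induction
      case (step y z)
      then obtain j where j: "j \<le> n" "y = (0, \<sigma> j)" by blast
      show ?case
      proof (cases "j = n")
        case True
        then show ?thesis using stop step(2) j unfolding dead_def by blast
      next
        case False
        then have "j < n" using j by simp
        from \<open>\<And>j. j < n \<Longrightarrow> exec (rsem w) ?body (0, \<sigma> j) (0, \<sigma> (Suc j)) (le_regs B)\<close>[OF this]
        have "z = (0, \<sigma> (Suc j))" using step(2) j unfolding exec_def by blast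
        then show ?thesis using \<open>j < n\<close> by (intro exI[of _ "Suc j"]) simp
      qed
    qed blast
  next
    assume "\<exists>j\<le>n. s = (0, \<sigma> j)"
    then obtain j where "j \<le> n" "s = (0, \<sigma> j)" by blast
    then show "(sem (rsem w) ?body)\<^sup>*\<^sup>* (0, \<sigma> 0) s"
    proof (induction j arbitrary: s)
      case (Suc j)
      then have "(sem (rsem w) ?body)\<^sup>*\<^sup>* (0, \<sigma> 0) (0, \<sigma> j)" by simp
      moreover have "sem (rsem w) ?body (0, \<sigma> j) s"
        using step[of j] Suc.prems unfolding exec_def by simp
      ultimately show ?case by (rule rtranclp.rtrancl_into_rtrancl)
    qed simp
  qed
  then show "sem (rsem w) (guess_loop m r) (0, \<sigma> 0) s \<longleftrightarrow> (\<exists>j\<le>n. s = (0, \<sigma> j))"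
    by (simp only: guess_loop_def sem.simps)
  have V: "le_regs B t" if "vis (rsem w) ?body (0, \<sigma> j) t" "j \<le> n" for t j
    using that step[of j] stop unfolding exec_def dead_def
    by (cases "j = n") (blast, metis le_neq_implies_less)
  show "le_regs B s" if "vis (rsem w) (guess_loop m r) (0, \<sigma> 0) s"
  proof -
    from that obtain t where t: "(sem (rsem w) ?body)\<^sup>*\<^sup>* (0, \<sigma> 0) t" "s = t \<or> vis (rsem w) ?body t s"
      unfolding guess_loop_def vis.simps by blast
    then obtain j where "j \<le> n" "t = (0, \<sigma> j)" using star by blast
    then show ?thesis using t(2) V le by blast
  qed
qed

context inputs
begin

fun hinstr_ok :: "nat \<Rightarrow> 'i hinstr \<Rightarrow> bool" where
  "hinstr_ok m (Assign r f) \<longleftrightarrow> r < m \<and> tdef m f"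
| "hinstr_ok m (Test P) \<longleftrightarrow> pdef m P"
| "hinstr_ok m (Guess r f) \<longleftrightarrow> r < m \<and> tdef m f"

definition reg_state :: "nat \<Rightarrow> (nat \<Rightarrow> nat) \<Rightarrow> rstate \<Rightarrow> bool" where
  "reg_state m \<rho> s \<longleftrightarrow> s = (0, \<rho>) \<and> (\<forall>i\<ge>m. \<rho> i = 0)"

definition hrefines :: "nat \<Rightarrow> 'i hinstr com \<Rightarrow> 'i rinstr com \<Rightarrow> nat \<Rightarrow> bool" where
  "hrefines m c c' e \<longleftrightarrow> (\<forall>w b B. (w, b) \<in> X \<longrightarrow> b \<le> B \<longrightarrow>
     refines (hsem w) (rsem w) (\<lambda>\<rho>. \<forall>i. \<rho> i \<le> B) (reg_state m) (le_regs ((B + 2) ^ e)) c c')"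

lemma hrefines_mono: "hrefines m c c' e \<Longrightarrow> e \<le> e' \<Longrightarrow> hrefines m c c' e'"
  unfolding hrefines_def by (blast intro: refines_mono le_regs_mono power_le)

text \<open>Results are computed in the scratch register \<open>m\<close> before register
  \<open>r\<close> is overwritten, since \<open>f\<close> may depend on \<open>r\<close>.\<close>

lemma hrefines_instr:
  assumes "hinstr_ok m b"
  shows "\<exists>c e. hrefines m (Basic b) c e"
proof (cases b)
  case (Assign r f)
  then have r: "r < m" and "tdef m f" using assms by auto
  then obtain c e where c: "computes m c f e" unfolding tdef_def by blast
  have "hrefines m (Basic b) (Seq c (Seq (clear_reg r) (move_reg m r))) e"
    unfolding hrefines_def refines_def
  proof (intro allI impI)
    fix w b' B \<rho> t
    assume X: "(w, b') \<in> X" "b' \<le> B" and R: "reg_state m \<rho> t"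
      and G: "\<forall>s'. vis (hsem w) (Basic b) \<rho> s' \<longrightarrow> (\<forall>i. s' i \<le> B)"
    from R have t: "t = (0, \<rho>)" and z: "\<And>i. i \<ge> m \<Longrightarrow> \<rho> i = 0" by (auto simp: reg_state_def)
    have le: "le_regs B (0, \<rho>)" using G[rule_format, of \<rho>] by (simp add: le_regs_def)
    let ?v = "f (w, \<rho>)" and ?V = "le_regs ((B + 2) ^ e) :: rstate \<Rightarrow> bool"
    note 1 = computesD[OF c X z le]
    note 2 = exec_clear_reg[OF exec_final[OF 1], of w r]
    let ?t = "\<rho>(m := ?v, r := 0)"
    have v: "?v \<le> (B + 2) ^ e"
      using exec_final[OF 1] unfolding le_regs_def by (metis fun_upd_same snd_conv)
    have 3: "exec (rsem w) (move_reg m r) (0, ?t) (0, ?t(m := 0, r := ?t r + ?t m)) ?V"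
      by (rule exec_move_reg[OF _ exec_final[OF 2]]) (use v r in auto)
    have "?t(m := 0, r := ?t r + ?t m) = \<rho>(r := ?v)" using r z by auto
    with exec_Seq[OF 1 exec_Seq[OF 2 3]]
    have e: "exec (rsem w) (Seq c (Seq (clear_reg r) (move_reg m r))) t (0, \<rho>(r := ?v)) ?V"
      unfolding t by simp
    have "reg_state m (\<rho>(r := ?v)) (0, \<rho>(r := ?v))" using z r by (auto simp: reg_state_def)
    with e show "(\<forall>s'. sem (hsem w) (Basic b) \<rho> s' \<longrightarrow>
            (\<exists>t'. sem (rsem w) (Seq c (Seq (clear_reg r) (move_reg m r))) t t' \<and> reg_state m s' t')) \<and>
         (\<forall>t'. sem (rsem w) (Seq c (Seq (clear_reg r) (move_reg m r))) t t' \<longrightarrow>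
            (\<exists>s'. sem (hsem w) (Basic b) \<rho> s' \<and> reg_state m s' t')) \<and>
         (\<forall>t'. vis (rsem w) (Seq c (Seq (clear_reg r) (move_reg m r))) t t' \<longrightarrow> ?V t')"
      unfolding exec_def Assign sem.simps(1) hsem.simps by metis
  qed
  then show ?thesis by blast
next
  case (Test P)
  then have "pdef m P" using assms by auto
  then obtain c e where c: "computes m c (\<lambda>s. of_bool (P s)) e" unfolding tdef_def by blast
  let ?c = "Seq c (Seq (Basic (NonZero m)) (clear_reg m))"
  have "hrefines m (Basic b) ?c e"
    unfolding hrefines_def refines_def
  proof (intro allI impI)
    fix w b' B \<rho> t
    assume X: "(w, b') \<in> X" "b' \<le> B" and R: "reg_state m \<rho> t"
      and G: "\<forall>s'. vis (hsem w) (Basic b) \<rho> s' \<longrightarrow> (\<forall>i. s' i \<le> B)"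
    from R have t: "t = (0, \<rho>)" and z: "\<And>i. i \<ge> m \<Longrightarrow> \<rho> i = 0" by (auto simp: reg_state_def)
    have le: "le_regs B (0, \<rho>)" using G[rule_format, of \<rho>] by (simp add: le_regs_def)
    let ?V = "le_regs ((B + 2) ^ e) :: rstate \<Rightarrow> bool"
    note 1 = computesD[OF c X z le]
    have V: "?V (0, \<rho>(m := of_bool (P (w, \<rho>))))" by (rule exec_final[OF 1])
    show "(\<forall>s'. sem (hsem w) (Basic b) \<rho> s' \<longrightarrow> (\<exists>t'. sem (rsem w) ?c t t' \<and> reg_state m s' t')) \<and>
         (\<forall>t'. sem (rsem w) ?c t t' \<longrightarrow> (\<exists>s'. sem (hsem w) (Basic b) \<rho> s' \<and> reg_state m s' t')) \<and>
         (\<forall>t'. vis (rsem w) ?c t t' \<longrightarrow> ?V t')"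
    proof (cases "P (w, \<rho>)")
      case True
      have 2: "exec (rsem w) (Basic (NonZero m)) (0, \<rho>(m := of_bool (P (w, \<rho>))))
          (0, \<rho>(m := of_bool (P (w, \<rho>)))) ?V"
        by (rule exec_Basic[where V = ?V, OF _ V V]) (use True in auto)
      have "\<rho>(m := of_bool (P (w, \<rho>)), m := 0) = \<rho>" using z by auto
      with exec_Seq[OF 1 exec_Seq[OF 2 exec_clear_reg[OF V, of w m]]]
      have "exec (rsem w) ?c t t ?V" unfolding t by simp
      then show ?thesis using True R unfolding exec_def Test sem.simps(1) hsem.simps by metis
    next
      case False
      have "dead (rsem w) (Basic (NonZero m)) (0, \<rho>(m := of_bool (P (w, \<rho>)))) ?V"
        by (rule dead_Basic[where V = ?V, OF _ V]) (use False in auto)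
      then have "dead (rsem w) ?c t ?V" unfolding t by (intro dead_Seq2[OF 1] dead_Seq)
      then show ?thesis using False unfolding dead_def Test sem.simps(1) hsem.simps by metis
    qed
  qed
  then show ?thesis by blast
next
  case (Guess r f)
  then have r: "r < m" and "tdef m f" using assms by auto
  then obtain c e where c: "computes m c f e" unfolding tdef_def by blast
  let ?c = "Seq c (Seq (clear_reg r) (Seq (guess_loop m r) (clear_reg m)))"
  have "hrefines m (Basic b) ?c e"
    unfolding hrefines_def refines_def
  proof (intro allI impI)
    fix w b' B \<rho> t
    assume X: "(w, b') \<in> X" "b' \<le> B" and R: "reg_state m \<rho> t"
      and G: "\<forall>s'. vis (hsem w) (Basic b) \<rho> s' \<longrightarrow> (\<forall>i. s' i \<le> B)"
    from R have t: "t = (0, \<rho>)" and z: "\<And>i. i \<ge> m \<Longrightarrow> \<rho> i = 0" by (auto simp: reg_state_def)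
    have le: "le_regs B (0, \<rho>)" using G[rule_format, of \<rho>] by (simp add: le_regs_def)
    let ?v = "f (w, \<rho>)" and ?V = "le_regs ((B + 2) ^ e) :: rstate \<Rightarrow> bool"
    note 1 = computesD[OF c X z le]
    note 2 = exec_clear_reg[OF exec_final[OF 1], of w r]
    have v: "?v \<le> (B + 2) ^ e"
      using exec_final[OF 1] unfolding le_regs_def by (metis fun_upd_same snd_conv)
    define \<sigma> where "\<sigma> = (\<lambda>j. \<rho>(m := ?v - j, r := j))"
    have 12: "exec (rsem w) (Seq c (clear_reg r)) t (0, \<sigma> 0) ?V"
      using exec_Seq[OF 1 2] unfolding t \<sigma>_def by simp
    have rm: "r \<noteq> m" using r by simp
    have gl: "sem (rsem w) (guess_loop m r) (0, \<sigma> 0) s \<longleftrightarrow> (\<exists>j\<le>?v. s = (0, \<sigma> j))"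
      "vis (rsem w) (guess_loop m r) (0, \<sigma> 0) s \<Longrightarrow> ?V s" for s
      unfolding \<sigma>_def by (rule guess_loop[OF exec_start[OF 1] v rm], assumption?)+
    have cl: "exec (rsem w) (clear_reg m) (0, \<sigma> j) (0, \<rho>(r := j)) ?V" if "j \<le> ?v" for j
    proof -
      have "sem (rsem w) (guess_loop m r) (0, \<sigma> 0) (0, \<sigma> j)"
        by (rule gl(1)[THEN iffD2], rule exI[of _ j]) (simp add: that)
      then have "?V (0, \<sigma> j)" by (intro gl(2) sem_imp_vis)
      from exec_clear_reg[OF this, of w m] show ?thesis
        using z[of m] r by (simp add: \<sigma>_def fun_upd_twist[of m r] fun_upd_idem)
    qed
    have c_sem: "sem (rsem w) ?c t t' \<longleftrightarrow> (\<exists>s. sem (rsem w) (guess_loop m r) (0, \<sigma> 0) s \<and>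
        sem (rsem w) (clear_reg m) s t')" for t'
    proof -
      have "sem (rsem w) ?c t t' \<longleftrightarrow> (\<exists>u. sem (rsem w) (Seq c (clear_reg r)) t u \<and>
          (\<exists>s. sem (rsem w) (guess_loop m r) u s \<and> sem (rsem w) (clear_reg m) s t'))"
        unfolding sem.simps OO_def by blast
      also have "\<dots> \<longleftrightarrow> (\<exists>u. u = (0, \<sigma> 0) \<and>
          (\<exists>s. sem (rsem w) (guess_loop m r) u s \<and> sem (rsem w) (clear_reg m) s t'))"
        using 12 unfolding exec_def by (simp only:)
      finally show ?thesis by blast
    qed
    have sem: "sem (rsem w) ?c t t' \<longleftrightarrow> (\<exists>j\<le>?v. t' = (0, \<rho>(r := j)))" for t'
      unfolding c_sem gl(1) using cl unfolding exec_def by metis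
    have vis: "?V t'" if "vis (rsem w) ?c t t'" for t'
    proof -
      from that consider "vis (rsem w) (Seq c (clear_reg r)) t t'"
        | s where "sem (rsem w) (Seq c (clear_reg r)) t s"
            "vis (rsem w) (Seq (guess_loop m r) (clear_reg m)) s t'"
        unfolding vis.simps sem.simps OO_def by blast
      then show ?thesis
      proof cases
        case 1
        then show ?thesis using 12 unfolding exec_def by blast
      next
        case 2
        then have "s = (0, \<sigma> 0)" using 12 unfolding exec_def by blast
        with 2(2) consider "vis (rsem w) (guess_loop m r) (0, \<sigma> 0) t'"
          | s' where "sem (rsem w) (guess_loop m r) (0, \<sigma> 0) s'" "vis (rsem w) (clear_reg m) s' t'"
          by auto
        then show ?thesis
        proof cases
          case 1
          then show ?thesis by (rule gl(2))
        next
          case 2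
          then show ?thesis using gl(1) cl unfolding exec_def by metis
        qed
      qed
    qed
    have "reg_state m (\<rho>(r := j)) (0, \<rho>(r := j))" for j using z r by (auto simp: reg_state_def)
    then show "(\<forall>s'. sem (hsem w) (Basic b) \<rho> s' \<longrightarrow> (\<exists>t'. sem (rsem w) ?c t t' \<and> reg_state m s' t')) \<and>
         (\<forall>t'. sem (rsem w) ?c t t' \<longrightarrow> (\<exists>s'. sem (hsem w) (Basic b) \<rho> s' \<and> reg_state m s' t')) \<and>
         (\<forall>t'. vis (rsem w) ?c t t' \<longrightarrow> ?V t')"
      using vis unfolding sem Guess sem.simps(1) hsem.simps by metis
  qed
  then show ?thesis by blast
qed

lemma hrefines_com:
  assumes "\<forall>b\<in>basics c. hinstr_ok m b"
  shows "\<exists>c' e. hrefines m c c' e"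
proof -
  from assms hrefines_instr have "\<forall>b\<in>basics c. \<exists>p. hrefines m (Basic b) (fst p) (snd p)" by fastforce
  from bchoice[OF this] obtain p where
    p: "\<And>b. b \<in> basics c \<Longrightarrow> hrefines m (Basic b) (fst (p b)) (snd (p b))" by blast
  define e where "e = (\<Sum>b\<in>basics c. snd (p b))"
  have "hrefines m (Basic b) (fst (p b)) e" if "b \<in> basics c" for b
    using p[OF that] by (rule hrefines_mono) (auto simp: e_def intro: member_le_sum finite_basics that)
  then have "hrefines m c (subst (fst \<circ> p) c) e"
    unfolding hrefines_def by (intro allI impI refines_subst) auto
  then show ?thesis by blast
qed

text \<open>Registers bounded by a fixed power of \<open>B x + 2\<close> have numerals of length
  proportional to \<open>log 2 (B x + 2)\<close>. Exponent and number of registers depend on the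
  program only, so both disappear in \<open>C\<close>.\<close>

theorem program_to_ntm:
  assumes "\<forall>b\<in>basics c. hinstr_ok m b"
    and "\<And>x. x \<in> I \<Longrightarrow> (enc x, b x) \<in> X \<and> b x \<le> B x \<and>
      (\<forall>\<rho>. vis (hsem (enc x)) c (\<lambda>_. 0) \<rho> \<longrightarrow> (\<forall>i. \<rho> i \<le> B x)) \<and>
      (P x \<longleftrightarrow> (\<exists>\<rho>. sem (hsem (enc x)) c (\<lambda>_. 0) \<rho>))"
  shows "\<exists>(M :: 'i ntm) C. C \<ge> 0 \<and> decides_in_nspace M I enc P (\<lambda>x. C * log 2 (real (B x) + 2))"
proof -
  obtain c' e where c': "hrefines m c c' e" using hrefines_com[OF assms(1)] by blast
  obtain K where K: "\<forall>b\<in>basics c'. rinstr_ok K b" using ex_rinstr_ok by blast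
  obtain M :: "'i ntm" where wf: "wf_ntm M" and M: "\<And>w L. w \<in> lists A \<Longrightarrow> L \<ge> 1 \<Longrightarrow>
      (\<And>s. vis (rsem w) c' (0, \<lambda>_. 0) s \<Longrightarrow> short_regs K L s) \<Longrightarrow>
      (accepts M w \<longleftrightarrow> (\<exists>s. sem (rsem w) c' (0, \<lambda>_. 0) s)) \<and>
      (\<forall>x. reachable_config M w x \<longrightarrow> space_of x \<le> K * L)"
    using register_program_to_ntm[OF finite_A K] by blast
  let ?C = "real K * (real e + 3)"
  have "(accepts M (enc x) \<longleftrightarrow> P x) \<and>
      (\<forall>y. reachable_config M (enc x) y \<longrightarrow> real (space_of y) \<le> ?C * log 2 (real (B x) + 2))"
    if "x \<in> I" for x
  proof -
    let ?w = "enc x"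
    define l where "l = log 2 (real (B x) + 2)"
    have l1: "l \<ge> 1" unfolding l_def by (simp add: le_log_iff)
    \<comment> \<open>The product bounds the number of digits, one unit in \<open>e + 1\<close>
      coming from the estimate \<open>2 ^ l \<le> v + 1\<close> for a numeral of length
      \<open>l\<close> and value \<open>v\<close>; the summand 2 is the slack for marker and
      carry.\<close>
    define L where "L = nat \<lfloor>(real e + 1) * l\<rfloor> + 2"
    note x = assms(2)[OF that]
    have xX: "(?w, b x) \<in> X" and bB: "b x \<le> B x" using x by auto
    have w: "?w \<in> lists A" using X[OF xX] by simp
    have R0: "reg_state m (\<lambda>_. 0) (0, \<lambda>_. 0)" by (simp add: reg_state_def)
    have G: "\<forall>s'. vis (hsem ?w) c (\<lambda>_. 0) s' \<longrightarrow> (\<forall>i. s' i \<le> B x)" using x by blast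
    from c' xX bB have "refines (hsem ?w) (rsem ?w) (\<lambda>\<rho>. \<forall>i. \<rho> i \<le> B x) (reg_state m)
      (le_regs ((B x + 2) ^ e)) c c'" unfolding hrefines_def by blast
    from this[unfolded refines_def, THEN spec[of _ "\<lambda>_. 0"], THEN spec[of _ "(0, \<lambda>_. 0)"],
        THEN mp, OF R0, THEN mp, OF G]
    have sem: "(\<exists>\<rho>. sem (hsem ?w) c (\<lambda>_. 0) \<rho>) \<longleftrightarrow> (\<exists>s. sem (rsem ?w) c' (0, \<lambda>_. 0) s)"
      and vis: "\<And>s. vis (rsem ?w) c' (0, \<lambda>_. 0) s \<Longrightarrow> le_regs ((B x + 2) ^ e) s"
      by blast+
    have short: "short_regs K L s" if "vis (rsem ?w) c' (0, \<lambda>_. 0) s" for s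
      unfolding short_regs_def
    proof (intro allI impI)
      fix r assume "r < K"
      let ?n = "length (digs (snd s r))"
      have "2 ^ ?n \<le> Suc (snd s r)" by (rule power_length_digs)
      also have "\<dots> \<le> Suc ((B x + 2) ^ e)" using vis[OF that] by (simp add: le_regs_def)
      also have "\<dots> \<le> (B x + 2) ^ Suc e"
      proof -
        have "1 \<le> (B x + 2) ^ e" by simp
        moreover have "Suc y \<le> (B x + 2) * y" if "1 \<le> y" for y using that by (cases y) auto
        ultimately show ?thesis unfolding power_Suc by blast
      qed
      finally have "real (2 ^ ?n) \<le> real ((B x + 2) ^ Suc e)" by (simp only: of_nat_le_iff)
      then have "2 ^ ?n \<le> (real (B x) + 2) ^ Suc e" by (simp only: of_nat_power of_nat_add of_nat_numeral)
      then have "log 2 (2 ^ ?n) \<le> log 2 ((real (B x) + 2) ^ Suc e)"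
        by (subst log_le_cancel_iff) auto
      then have "real ?n \<le> (real e + 1) * l"
        by (simp add: log_nat_power l_def add.commute del: power_Suc)
      then have "?n \<le> nat \<lfloor>(real e + 1) * l\<rfloor>" by (simp add: le_nat_floor)
      then show "?n + 2 \<le> L" by (simp add: L_def)
    qed
    have "L \<ge> 1" by (simp add: L_def)
    note M = M[OF w this short]
    have L: "real L \<le> (real e + 3) * l"
    proof -
      have "real (nat \<lfloor>(real e + 1) * l\<rfloor>) \<le> (real e + 1) * l" using l1 by simp
      then have "real L \<le> (real e + 1) * l + 2" by (simp add: L_def)
      also have "\<dots> \<le> (real e + 1) * l + 2 * l" using l1 by simp
      finally show ?thesis by (simp add: algebra_simps)
    qed
    have "real (space_of y) \<le> ?C * l" if "reachable_config M ?w y" for y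
    proof -
      have "real (space_of y) \<le> real (K * L)" using M that by (simp only: of_nat_le_iff)
      also have "\<dots> \<le> real K * ((real e + 3) * l)" using L by (simp add: mult_left_mono)
      finally show ?thesis by (simp add: mult.assoc)
    qed
    then show ?thesis using M sem x unfolding l_def by blast
  qed
  then have "decides_in_nspace M I enc P (\<lambda>x. ?C * log 2 (real (B x) + 2))"
    using wf unfolding decides_in_nspace_def by blast
  then show ?thesis by (intro exI[of _ M] exI[of _ ?C]) simp
qed

end

section \<open>Orbits and trees of words\<close>

lemma run_length: "run T q u v p \<Longrightarrow> length v = length u"
  by (induction rule: run.induct) auto

lemma run_Nil_iff [simp]: "run T q [] v p \<longleftrightarrow> v = [] \<and> p = q"
  by (auto elim: run.cases intro: run_Nil)

lemma run_Cons_iff: "run T q (a # u) w p \<longleftrightarrow>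
    (\<exists>b r v. w = b # v \<and> (q, a, b, r) \<in> transitions T \<and> run T r u v p)"
  by (subst run.simps) auto

lemma run_append: "run T q (u @ u') w p \<longleftrightarrow>
    (\<exists>v r v'. w = v @ v' \<and> run T q u v r \<and> run T r u' v' p)"
proof (induction u arbitrary: q w)
  case (Cons a u)
  show ?case
    unfolding append_Cons run_Cons_iff Cons.IH by (metis append_Cons)
qed simp

lemma run_snoc: "run T q (u @ [a]) w p \<longleftrightarrow>
    (\<exists>v r b. w = v @ [b] \<and> run T q u v r \<and> (r, a, b, p) \<in> transitions T)"
  unfolding run_append run_Cons_iff by auto

lemma run_deterministic:
  assumes "s_automaton T"
  shows "run T q u v p \<Longrightarrow> run T q u v' p' \<Longrightarrow> v = v' \<and> p = p'"
proof (induction u arbitrary: q v v')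
  case (Cons a u)
  then show ?case
    using assms unfolding s_automaton_def run_Cons_iff by metis
qed simp

lemma act_eq_Some_iff:
  assumes "s_automaton T"
  shows "act T q u = Some v \<longleftrightarrow> (\<exists>p. run T q u v p)"
proof
  assume "act T q u = Some v"
  then obtain v' p where "run T q u v' p" "v = (THE v. \<exists>p. run T q u v p)"
    unfolding act_def by (auto split: if_splits)
  moreover from this have "(THE v. \<exists>p. run T q u v p) = v'"
    using run_deterministic[OF assms] by (intro the_equality) blast+
  ultimately show "\<exists>p. run T q u v p" by blast
next
  assume "\<exists>p. run T q u v p"
  moreover from this have "(THE v. \<exists>p. run T q u v p) = v"
    using run_deterministic[OF assms] by (intro the_equality) blast+
  ultimately show "act T q u = Some v" unfolding act_def by auto
qed

lemma run_alphabet: "s_automaton T \<Longrightarrow> run T q u v p \<Longrightarrow> v \<in> lists (alphabet T)"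
proof (induction u arbitrary: q v)
  case (Cons a u)
  from Cons.prems(2) obtain b r v' where
    v: "v = b # v'" "(q, a, b, r) \<in> transitions T" "run T r u v' p"
    unfolding run_Cons_iff by blast
  moreover have "b \<in> alphabet T" using v(2) Cons.prems(1) unfolding s_automaton_def by blast
  ultimately show ?case using Cons.IH[OF Cons.prems(1) v(3)] by simp
qed simp

lemma orbit_refl: "u \<in> orbit T u"
  unfolding orbit_def by (auto intro!: bexI[of _ "[]"])

lemma orbit_act: "v \<in> orbit T u \<Longrightarrow> q \<in> states T \<Longrightarrow> act T q v = Some v' \<Longrightarrow> v' \<in> orbit T u"
  unfolding orbit_def by (force intro!: bexI[of _ "q # qs" for qs])

lemma orbit_induct [consumes 1, case_names refl act]:
  assumes "v \<in> orbit T u" "P u"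
    and "\<And>v q v'. P v \<Longrightarrow> q \<in> states T \<Longrightarrow> act T q v = Some v' \<Longrightarrow> P v'"
  shows "P v"
proof -
  have "P v" if "act_word T qs u = Some v" "qs \<in> lists (states T)" for qs v
    using that
  proof (induction qs arbitrary: v)
    case Nil
    then show ?case using assms(2) by simp
  next
    case (Cons q qs)
    then obtain v0 where "act_word T qs u = Some v0" "act T q v0 = Some v"
      by (auto simp: Option.bind_eq_Some_conv)
    then show ?case using Cons assms(3) by auto
  qed
  then show ?thesis using assms(1) unfolding orbit_def by blast
qed

lemma orbit_subset:
  assumes "s_automaton T" "u \<in> lists (alphabet T)"
  shows "orbit T u \<subseteq> {v. set v \<subseteq> alphabet T \<and> length v = length u}"
proof
  fix v assume "v \<in> orbit T u"
  then show "v \<in> {v. set v \<subseteq> alphabet T \<and> length v = length u}"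
  proof (induction rule: orbit_induct)
    case refl
    then show ?case using assms(2) by auto
  next
    case (act v q v')
    from act(3) obtain p where "run T q v v' p" unfolding act_eq_Some_iff[OF assms(1)] ..
    from run_length[OF this] run_alphabet[OF assms(1) this] act(1) show ?case by auto
  qed
qed

lemma finite_orbit:
  assumes "s_automaton T" "u \<in> lists (alphabet T)"
  shows "finite (orbit T u)"
proof -
  have "finite (alphabet T)" using assms(1) by (simp add: s_automaton_def)
  then show ?thesis by (rule finite_subset[OF orbit_subset[OF assms] finite_lists_length_eq])
qed

lemma card_orbit_le:
  assumes "s_automaton T" "u \<in> lists (alphabet T)"
  shows "card (orbit T u) \<le> card (alphabet T) ^ length u"
proof -
  have "finite (alphabet T)" using assms(1) by (simp add: s_automaton_def)
  then show ?thesis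
    using card_mono[OF finite_lists_length_eq orbit_subset[OF assms]] card_lists_length_eq
    by metis
qed

lemma card_orbit_pos: "s_automaton T \<Longrightarrow> u \<in> lists (alphabet T) \<Longrightarrow> card (orbit T u) \<ge> 1"
  using finite_orbit[of T u] orbit_refl[of u T]
  by (metis One_nat_def Suc_leI card_gt_0_iff empty_iff)

section \<open>Trees witnessing lower bounds for orbits\<close>

definition is_tree :: "nat \<Rightarrow> (nat \<Rightarrow> nat) \<Rightarrow> bool" where
  "is_tree N P \<longleftrightarrow> (\<forall>i<N. 0 < i \<longrightarrow> P i < i)"

text \<open>A proper subset of the orbit that contains \<open>u\<close> is not closed under the states, so that a
  tree with fewer nodes than the orbit can be extended.\<close>

lemma card_orbit_ge_iff:
  assumes "s_automaton T" "u \<in> lists (alphabet T)"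
  shows "N \<le> card (orbit T u) \<longleftrightarrow> (\<exists>W P q. is_tree N P \<and> W 0 = u \<and>
     (\<forall>i<N. 0 < i \<longrightarrow> q i \<in> states T \<and> act T (q i) (W (P i)) = Some (W i)) \<and> inj_on W {..<N})"
proof
  assume "N \<le> card (orbit T u)"
  then show "\<exists>W P q. is_tree N P \<and> W 0 = u \<and>
     (\<forall>i<N. 0 < i \<longrightarrow> q i \<in> states T \<and> act T (q i) (W (P i)) = Some (W i)) \<and> inj_on W {..<N}"
  proof (induction N)
    case 0
    show ?case by (rule exI[of _ "\<lambda>_. u"]) (auto simp: is_tree_def)
  next
    case (Suc N)
    then obtain W P q where W: "is_tree N P" "W 0 = u" "inj_on W {..<N}"
      "\<And>i. i < N \<Longrightarrow> 0 < i \<Longrightarrow> q i \<in> states T \<and> act T (q i) (W (P i)) = Some (W i)"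
      by auto
    show ?case
    proof (cases "N = 0")
      case True
      then show ?thesis by (intro exI[of _ "\<lambda>_. u"]) (auto simp: is_tree_def lessThan_Suc)
    next
      case False
      have "\<exists>i<N. \<exists>p\<in>states T. \<exists>v. act T p (W i) = Some v \<and> v \<notin> W ` {..<N}"
      proof (rule ccontr)
        assume *: "\<not> ?thesis"
        have "v \<in> W ` {..<N}" if "v \<in> orbit T u" for v
          using that
        proof (induction rule: orbit_induct)
          case refl
          then show ?case using W(2) False by (metis image_eqI lessThan_iff neq0_conv)
        next
          case (act v q v')
          then show ?case using * by blast
        qed
        then have "card (orbit T u) \<le> card (W ` {..<N})" by (intro card_mono) auto
        also have "\<dots> \<le> N" using card_image_le[of "{..<N}" W] by simp
        finally show False using Suc.prems by simp
      qed
      then obtain i p v where i: "i < N" "p \<in> states T" "act T p (W i) = Some v" "v \<notin> W ` {..<N}"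
        by blast
      have P: "P j < N" if "j < N" "0 < j" for j
        using W(1) that unfolding is_tree_def by (meson less_trans)
      show ?thesis
      proof (intro exI conjI allI impI)
        show "is_tree (Suc N) (P(N := i))"
          using W(1) i(1) unfolding is_tree_def by (simp add: less_Suc_eq)
        show "(W(N := v)) 0 = u" using W(2) False by simp
        show "inj_on (W(N := v)) {..<Suc N}"
          using W(3) i(4) by (auto simp: lessThan_Suc inj_on_insert inj_on_fun_updI)
        fix j assume j: "j < Suc N" "0 < j"
        show "(q(N := p)) j \<in> states T" using j W(4) i(2) by (auto simp: less_Suc_eq)
        show "act T ((q(N := p)) j) ((W(N := v)) ((P(N := i)) j)) = Some ((W(N := v)) j)"
          using j W(4)[of j] i P[of j] by (auto simp: less_Suc_eq)
      qed
    qed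
  qed
next
  assume "\<exists>W P q. is_tree N P \<and> W 0 = u \<and>
     (\<forall>i<N. 0 < i \<longrightarrow> q i \<in> states T \<and> act T (q i) (W (P i)) = Some (W i)) \<and> inj_on W {..<N}"
  then obtain W P q where W: "is_tree N P" "W 0 = u" "inj_on W {..<N}"
    "\<And>i. i < N \<Longrightarrow> 0 < i \<Longrightarrow> q i \<in> states T \<and> act T (q i) (W (P i)) = Some (W i)"
    by blast
  have "W i \<in> orbit T u" if "i < N" for i
    using that
  proof (induction i rule: less_induct)
    case (less i)
    show ?case
    proof (cases "i = 0")
      case True
      then show ?thesis using W(2) orbit_refl by metis
    next
      case False
      then have "P i < i" using W(1) less.prems unfolding is_tree_def by simp
      then have "W (P i) \<in> orbit T u" using less.IH less.prems by simp
      moreover have "q i \<in> states T" "act T (q i) (W (P i)) = Some (W i)"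
        using W(4)[OF less.prems] False by simp_all
      ultimately show ?thesis by (rule orbit_act)
    qed
  qed
  then have "card (W ` {..<N}) \<le> card (orbit T u)"
    by (intro card_mono finite_orbit assms) auto
  then show "N \<le> card (orbit T u)" using card_image[OF W(3)] by simp
qed

text \<open>The state of the simulation after the word \<open>y\<close> has been read at the root: \<open>S i\<close> is the
  current state of the edge into node \<open>i\<close>, and \<open>D i j\<close> tells whether the words produced at the
  nodes \<open>i\<close> and \<open>j\<close> already differ. The words themselves are not stored.\<close>

definition tree_conf :: "('q, 'a) automaton \<Rightarrow> nat \<Rightarrow> (nat \<Rightarrow> nat) \<Rightarrow> (nat \<Rightarrow> 'q) \<Rightarrow> 'a list \<Rightarrow>
    (nat \<Rightarrow> 'q) \<Rightarrow> (nat \<Rightarrow> nat \<Rightarrow> bool) \<Rightarrow> bool" where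
  "tree_conf T N P q y S D \<longleftrightarrow> (\<exists>W. W 0 = y \<and>
     (\<forall>i<N. 0 < i \<longrightarrow> run T (q i) (W (P i)) (W i) (S i)) \<and>
     (\<forall>i<N. \<forall>j<N. D i j \<longleftrightarrow> W i \<noteq> W j))"

text \<open>\<open>A i\<close> is the letter appended to the word at node \<open>i\<close>: the root
  reads \<open>a\<close>, and each edge transforms the letter of the parent into that of the child.
  Whether two words differ afterwards depends only on the old bit and on the two new letters, which
  is why the words can be forgotten.\<close>

definition tree_step :: "('q, 'a) automaton \<Rightarrow> nat \<Rightarrow> (nat \<Rightarrow> nat) \<Rightarrow>
    (nat \<Rightarrow> 'q) \<Rightarrow> (nat \<Rightarrow> nat \<Rightarrow> bool) \<Rightarrow> 'a \<Rightarrow> (nat \<Rightarrow> 'q) \<Rightarrow> (nat \<Rightarrow> nat \<Rightarrow> bool) \<Rightarrow> bool" where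
  "tree_step T N P S D a S' D' \<longleftrightarrow> (\<exists>A. A 0 = a \<and>
     (\<forall>i<N. 0 < i \<longrightarrow> (S i, A (P i), A i, S' i) \<in> transitions T) \<and>
     (\<forall>i<N. \<forall>j<N. D' i j \<longleftrightarrow> D i j \<or> A i \<noteq> A j))"

lemma tree_confE:
  assumes "tree_conf T N P q y S D"
  obtains W where "W 0 = y" "\<And>i. i < N \<Longrightarrow> 0 < i \<Longrightarrow> run T (q i) (W (P i)) (W i) (S i)"
    "\<And>i j. i < N \<Longrightarrow> j < N \<Longrightarrow> D i j \<longleftrightarrow> W i \<noteq> W j"
  using assms unfolding tree_conf_def by (elim exE conjE) (rule that, assumption, blast+)

lemma tree_stepE:
  assumes "tree_step T N P S D a S' D'"
  obtains A where "A 0 = a" "\<And>i. i < N \<Longrightarrow> 0 < i \<Longrightarrow> (S i, A (P i), A i, S' i) \<in> transitions T"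
    "\<And>i j. i < N \<Longrightarrow> j < N \<Longrightarrow> D' i j \<longleftrightarrow> D i j \<or> A i \<noteq> A j"
  using assms unfolding tree_step_def by (elim exE conjE) (rule that, assumption, blast+)

text \<open>The root has no incoming edge, so \<open>S 0\<close> carries no information, just like
  all values at indices from \<open>N\<close> on.\<close>

definition conf_eq :: "nat \<Rightarrow> (nat \<Rightarrow> 'q) \<Rightarrow> (nat \<Rightarrow> nat \<Rightarrow> bool) \<Rightarrow> (nat \<Rightarrow> 'q) \<Rightarrow> (nat \<Rightarrow> nat \<Rightarrow> bool) \<Rightarrow> bool" where
  "conf_eq N S D S' D' \<longleftrightarrow> (\<forall>i<N. 0 < i \<longrightarrow> S i = S' i) \<and> (\<forall>i<N. \<forall>j<N. D i j = D' i j)"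

lemma tree_conf_cong: "conf_eq N S D S' D' \<Longrightarrow> tree_conf T N P q y S D \<Longrightarrow> tree_conf T N P q y S' D'"
  unfolding tree_conf_def conf_eq_def by auto

lemma tree_step_cong:
  "conf_eq N S D S0 D0 \<Longrightarrow> tree_step T N P S D a S' D' \<Longrightarrow> tree_step T N P S0 D0 a S' D'"
  unfolding tree_step_def conf_eq_def by auto

text \<open>Parents have smaller numbers than their children, so agreement spreads from the root by
  induction on the number of the node.\<close>

lemma tree_words_unique:
  assumes "is_tree N P" "W 0 = W' 0" "\<And>i. i < N \<Longrightarrow> 0 < i \<Longrightarrow> W (P i) = W' (P i) \<Longrightarrow> W i = W' i" "i < N"
  shows "W i = W' i"
  using assms(4)
proof (induction i rule: less_induct)
  case (less i)
  show ?case
  proof (cases "i = 0")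
    case False
    then have "P i < i" using assms(1) less.prems unfolding is_tree_def by simp
    then show ?thesis using less assms(3) False by auto
  qed (use assms(2) in simp)
qed

text \<open>By determinism of the automaton, tree, initial states and input fix all words. This
  makes the simulation deterministic: whichever successor a search finds first, no other one has to
  be tried later.\<close>

lemma tree_conf_unique:
  assumes T: "s_automaton T" and P: "is_tree N P"
    and "tree_conf T N P q y S D" "tree_conf T N P q y S' D'"
  shows "conf_eq N S D S' D'"
proof -
  from assms(3) obtain W where W: "W 0 = y" "\<And>i. i < N \<Longrightarrow> 0 < i \<Longrightarrow> run T (q i) (W (P i)) (W i) (S i)"
    "\<And>i j. i < N \<Longrightarrow> j < N \<Longrightarrow> D i j \<longleftrightarrow> W i \<noteq> W j" by (rule tree_confE) blast
  from assms(4) obtain W' where W': "W' 0 = y" "\<And>i. i < N \<Longrightarrow> 0 < i \<Longrightarrow> run T (q i) (W' (P i)) (W' i) (S' i)"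
    "\<And>i j. i < N \<Longrightarrow> j < N \<Longrightarrow> D' i j \<longleftrightarrow> W' i \<noteq> W' j" by (rule tree_confE) blast
  have eq: "W i = W' i" if "i < N" for i
    by (rule tree_words_unique[OF P _ _ that]) (use W W' run_deterministic[OF T] in metis)+
  have "S i = S' i" if "i < N" "0 < i" for i
  proof -
    have "P i < N" using P that unfolding is_tree_def by (meson less_trans)
    then show ?thesis using W(2)[OF that] W'(2)[OF that] eq that run_deterministic[OF T] by metis
  qed
  then show ?thesis using W(3) W'(3) eq unfolding conf_eq_def by auto
qed

lemma tree_conf_Nil:
  assumes "is_tree N P"
  shows "tree_conf T N P q [] q (\<lambda>_ _. False)"
  unfolding tree_conf_def by (rule exI[of _ "\<lambda>_. []"]) simp

text \<open>For the converse of composing a configuration with a step, the last letter is cut off at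
  every node. This is possible since automata preserve length, so that all words are nonempty
  together with the word at the root.\<close>

lemma tree_conf_snoc:
  assumes P: "is_tree N P"
  shows "tree_conf T N P q (y @ [a]) S' D' \<longleftrightarrow>
    (\<exists>S D. tree_conf T N P q y S D \<and> tree_step T N P S D a S' D')"
proof
  assume "\<exists>S D. tree_conf T N P q y S D \<and> tree_step T N P S D a S' D'"
  then obtain S D where "tree_conf T N P q y S D" "tree_step T N P S D a S' D'" by blast
  then obtain W A where W: "W 0 = y" "\<And>i. i < N \<Longrightarrow> 0 < i \<Longrightarrow> run T (q i) (W (P i)) (W i) (S i)"
    "\<And>i j. i < N \<Longrightarrow> j < N \<Longrightarrow> D i j \<longleftrightarrow> W i \<noteq> W j" and
    A: "A 0 = a" "\<And>i. i < N \<Longrightarrow> 0 < i \<Longrightarrow> (S i, A (P i), A i, S' i) \<in> transitions T"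
    "\<And>i j. i < N \<Longrightarrow> j < N \<Longrightarrow> D' i j \<longleftrightarrow> D i j \<or> A i \<noteq> A j"
    by (elim tree_confE tree_stepE) blast
  show "tree_conf T N P q (y @ [a]) S' D'"
    unfolding tree_conf_def
    by (rule exI[of _ "\<lambda>i. W i @ [A i]"]) (use W A in \<open>auto simp: run_snoc; blast\<close>)
next
  assume "tree_conf T N P q (y @ [a]) S' D'"
  then obtain W where W: "W 0 = y @ [a]"
    "\<And>i. i < N \<Longrightarrow> 0 < i \<Longrightarrow> run T (q i) (W (P i)) (W i) (S' i)"
    "\<And>i j. i < N \<Longrightarrow> j < N \<Longrightarrow> D' i j \<longleftrightarrow> W i \<noteq> W j" by (rule tree_confE) blast
  have ne: "W i \<noteq> []" if "i < N" for i
    using that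
  proof (induction i rule: less_induct)
    case (less i)
    show ?case
    proof (cases "i = 0")
      case False
      then have "P i < i" using P less.prems unfolding is_tree_def by simp
      then have "W (P i) \<noteq> []" using less by simp
      then show ?thesis using run_length[OF W(2)[OF less.prems]] False by fastforce
    qed (use W(1) in simp)
  qed
  have "\<exists>r. run T (q i) (butlast (W (P i))) (butlast (W i)) r \<and>
      (r, last (W (P i)), last (W i), S' i) \<in> transitions T" if "i < N" "0 < i" for i
  proof -
    have "P i < N" using P that unfolding is_tree_def by (meson less_trans)
    then have "W (P i) = butlast (W (P i)) @ [last (W (P i))]" using ne by simp
    with W(2)[OF that] have "run T (q i) (butlast (W (P i)) @ [last (W (P i))]) (W i) (S' i)" by simp
    then show ?thesis unfolding run_snoc by auto
  qed
  then obtain S where S: "\<And>i. i < N \<Longrightarrow> 0 < i \<Longrightarrow> run T (q i) (butlast (W (P i))) (butlast (W i)) (S i) \<and>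
      (S i, last (W (P i)), last (W i), S' i) \<in> transitions T"
    by metis
  have "tree_conf T N P q y S (\<lambda>i j. butlast (W i) \<noteq> butlast (W j))"
    unfolding tree_conf_def by (rule exI[of _ "\<lambda>i. butlast (W i)"]) (use W(1) S in auto)
  moreover have "tree_step T N P S (\<lambda>i j. butlast (W i) \<noteq> butlast (W j)) a S' D'"
    unfolding tree_step_def
  proof (rule exI[of _ "\<lambda>i. last (W i)"], intro conjI allI impI)
    fix i j assume "i < N" "j < N"
    then show "D' i j = (butlast (W i) \<noteq> butlast (W j) \<or> last (W i) \<noteq> last (W j))"
      using W(3) ne by (metis append_butlast_last_id)
  qed (use W(1) S in auto)
  ultimately show "\<exists>S D. tree_conf T N P q y S D \<and> tree_step T N P S D a S' D'" by blast
qed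

text \<open>This replaces words by storable data: injectivity of the words becomes the statement
  that all off-diagonal bits of the difference matrix are set.\<close>

lemma card_orbit_ge_iff_conf:
  assumes "s_automaton T" "y \<in> lists (alphabet T)"
  shows "N \<le> card (orbit T y) \<longleftrightarrow> (\<exists>P q S D. is_tree N P \<and> (\<forall>i<N. 0 < i \<longrightarrow> q i \<in> states T) \<and>
     tree_conf T N P q y S D \<and> (\<forall>i<N. \<forall>j<N. i \<noteq> j \<longrightarrow> D i j))"
    (is "_ \<longleftrightarrow> ?R")
  unfolding card_orbit_ge_iff[OF assms]
proof
  assume "\<exists>W P q. is_tree N P \<and> W 0 = y \<and>
     (\<forall>i<N. 0 < i \<longrightarrow> q i \<in> states T \<and> act T (q i) (W (P i)) = Some (W i)) \<and> inj_on W {..<N}"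
  then obtain W P q where W: "is_tree N P" "W 0 = y" "inj_on W {..<N}"
    "\<And>i. i < N \<Longrightarrow> 0 < i \<Longrightarrow> q i \<in> states T" "\<And>i. i < N \<Longrightarrow> 0 < i \<Longrightarrow> \<exists>p. run T (q i) (W (P i)) (W i) p"
    unfolding act_eq_Some_iff[OF assms(1)] by blast
  from W(5) obtain S where S: "\<And>i. i < N \<Longrightarrow> 0 < i \<Longrightarrow> run T (q i) (W (P i)) (W i) (S i)" by metis
  have "tree_conf T N P q y S (\<lambda>i j. W i \<noteq> W j)"
    unfolding tree_conf_def using W(2) S by blast
  moreover have "\<forall>i<N. \<forall>j<N. i \<noteq> j \<longrightarrow> W i \<noteq> W j" using W(3) by (auto simp: inj_on_def)
  ultimately show ?R using W(1,4) by blast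
next
  assume ?R
  then obtain P q S D where R: "is_tree N P" "\<forall>i<N. 0 < i \<longrightarrow> q i \<in> states T"
    "tree_conf T N P q y S D" "\<forall>i<N. \<forall>j<N. i \<noteq> j \<longrightarrow> D i j" by blast
  from R(3) obtain W where "W 0 = y"
    "\<And>i. i < N \<Longrightarrow> 0 < i \<Longrightarrow> run T (q i) (W (P i)) (W i) (S i)"
    "\<And>i j. i < N \<Longrightarrow> j < N \<Longrightarrow> D i j \<longleftrightarrow> W i \<noteq> W j" by (rule tree_confE) blast
  with R show "\<exists>W P q. is_tree N P \<and> W 0 = y \<and>
     (\<forall>i<N. 0 < i \<longrightarrow> q i \<in> states T \<and> act T (q i) (W (P i)) = Some (W i)) \<and> inj_on W {..<N}"
    unfolding act_eq_Some_iff[OF assms(1)]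
    by (intro exI[of _ W] exI[of _ P] exI[of _ q]) (auto simp: inj_on_def; blast)
qed

section \<open>Digit expansions and binary length\<close>

lemma ex_digits:
  assumes "\<And>i. i < n \<Longrightarrow> f i < b" "b > 0"
  shows "\<exists>x < b ^ n. \<forall>i<n. digit b x i = f i"
  using assms(1)
proof (induction n)
  case (Suc n)
  then obtain x where x: "x < b ^ n" "\<And>i. i < n \<Longrightarrow> digit b x i = f i" by auto
  let ?x = "x + f n * b ^ n"
  have "?x < b ^ Suc n"
  proof -
    have "?x < Suc (f n) * b ^ n" using x(1) by simp
    also have "\<dots> \<le> b * b ^ n" using Suc.prems[of n] by (intro mult_right_mono) auto
    finally show ?thesis by simp
  qed
  moreover have "digit b ?x i = f i" if "i < Suc n" for i
  proof (cases "i = n")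
    case True
    then show ?thesis using x(1) assms(2) Suc.prems[of n] by (simp add: digit_def)
  next
    case False
    then have "i < n" using that by simp
    then obtain m where m: "n = Suc m + i" by (metis add.commute less_iff_Suc_add add_Suc)
    then have "?x = x + (f n * b ^ m * b) * b ^ i" by (simp add: power_add)
    then have "?x div b ^ i = (x + (f n * b ^ m * b) * b ^ i) div b ^ i" by (simp only:)
    also have "\<dots> = x div b ^ i + f n * b ^ m * b" using assms(2) by simp
    finally have "?x div b ^ i = x div b ^ i + f n * b ^ m * b" .
    then show ?thesis using x(2)[OF \<open>i < n\<close>] by (simp add: digit_def)
  qed
  ultimately show ?case by blast
qed simp

text \<open>The number of binary digits, with value 0 at 0. The form of a bounded sum makes it
  definable by the closure rules.\<close>

definition bitlen :: "nat \<Rightarrow> nat" where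
  "bitlen n = (\<Sum>i<n. of_bool (0 < n div 2 ^ i))"

lemma bitlen:
  assumes "n > 0"
  shows "\<exists>m. bitlen n = Suc m \<and> 2 ^ m \<le> n \<and> n < 2 ^ Suc m"
proof -
  define m where "m = (LEAST m. n < 2 ^ Suc m)"
  have "n < 2 ^ Suc n" by (rule less_trans[OF less_exp]) simp
  then have m: "n < 2 ^ Suc m" unfolding m_def by (rule LeastI)
  have m': "2 ^ m \<le> n"
  proof (cases m)
    case 0
    then show ?thesis using assms by simp
  next
    case (Suc k)
    then have "\<not> n < 2 ^ Suc k" using not_less_Least[of k "\<lambda>m. n < 2 ^ Suc m"] by (simp add: m_def)
    then show ?thesis using Suc by simp
  qed
  have "m < n" using m' less_exp[of m] by linarith
  have "0 < n div 2 ^ i \<longleftrightarrow> i < Suc m" for i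
  proof -
    have "0 < n div 2 ^ i \<longleftrightarrow> 2 ^ i \<le> n" by (simp add: div_greater_zero_iff)
    also have "\<dots> \<longleftrightarrow> i < Suc m"
    proof
      assume "2 ^ i \<le> n"
      then have "(2::nat) ^ i < 2 ^ Suc m" using m by linarith
      then show "i < Suc m" by (metis one_less_numeral_iff power_less_imp_less_exp semiring_norm(76))
    next
      assume "i < Suc m"
      then have "(2::nat) ^ i \<le> 2 ^ m" by (intro power_increasing) auto
      then show "2 ^ i \<le> n" using m' by linarith
    qed
    finally show ?thesis .
  qed
  then have "bitlen n = card ({..<n} \<inter> {i. i < Suc m})" by (simp add: bitlen_def)
  also have "{..<n} \<inter> {i. i < Suc m} = {..<Suc m}" using \<open>m < n\<close> by auto
  finally show ?thesis using m m' by auto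
qed

lemma less_power_bitlen: "n < 2 ^ bitlen n"
  using bitlen[of n] by (cases "n = 0") auto

lemma bitlen_le: "real (bitlen n) \<le> 1 + log 2 (real n)"
proof (cases "n = 0")
  case True
  then show ?thesis by (simp add: bitlen_def log_def)
next
  case False
  then obtain m where m: "bitlen n = Suc m" "2 ^ m \<le> n" using bitlen by blast
  then have "2 powr (real m) \<le> real n" by (simp add: powr_realpow)
  then have "real m \<le> log 2 (real n)" using False by (simp add: le_log_iff)
  then show ?thesis using m by simp
qed

section \<open>Encoding of trees by numbers\<close>

text \<open>A configuration is a number \<open>C < L * L\<close>: the digits of \<open>C mod L\<close> are the states of the
  edges, those of \<open>C div L\<close> the \<open>N \<times> N\<close> matrix of differences. The value \<open>L * L\<close> marks a failed run.\<close>

definition code_state :: "nat \<Rightarrow> nat \<Rightarrow> nat \<Rightarrow> nat \<Rightarrow> nat" where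
  "code_state Q L C i = digit (Suc Q) (C mod L) i"

definition code_differ :: "nat \<Rightarrow> nat \<Rightarrow> nat \<Rightarrow> nat \<Rightarrow> nat \<Rightarrow> bool" where
  "code_differ N L C i j \<longleftrightarrow> digit 2 (C div L) (i * N + j) = 1"

text \<open>The letters at the nodes form one more number \<open>A\<close>, which is searched for
  among all numbers below \<open>L\<close>. The condition on \<open>C\<close> makes the failure
  value \<open>L * L\<close> absorbing: it has no successor.\<close>

definition code_step :: "nat \<Rightarrow> nat \<Rightarrow> (nat \<Rightarrow> nat \<Rightarrow> nat \<Rightarrow> nat \<Rightarrow> bool) \<Rightarrow> nat \<Rightarrow> nat \<Rightarrow> nat \<Rightarrow>
    nat \<Rightarrow> nat \<Rightarrow> nat \<Rightarrow> bool" where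
  "code_step Q S dl N L p C a C' \<longleftrightarrow> C < L * L \<and> C' < L * L \<and> (\<exists>A<L. digit (Suc S) A 0 = a \<and>
     (\<forall>i<N. 0 < i \<longrightarrow> dl (code_state Q L C i) (digit (Suc S) A (digit (Suc N) p i))
        (digit (Suc S) A i) (code_state Q L C' i)) \<and>
     (\<forall>i<N. \<forall>j<N. code_differ N L C' i j \<longleftrightarrow>
        code_differ N L C i j \<or> \<not> digit (Suc S) A i = digit (Suc S) A j))"

text \<open>A configuration can have several codes, differing in digits without meaning; the least
  successor is as good as any. If there is none, \<open>bmin\<close> returns
  \<open>L * L\<close>.\<close>

definition code_run :: "nat \<Rightarrow> nat \<Rightarrow> (nat \<Rightarrow> nat \<Rightarrow> nat \<Rightarrow> nat \<Rightarrow> bool) \<Rightarrow> nat \<Rightarrow> nat \<Rightarrow> nat \<Rightarrow>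
    (nat \<Rightarrow> nat) \<Rightarrow> nat \<Rightarrow> nat \<Rightarrow> nat" where
  "code_run Q S dl N L p ls c m =
     rec_nat c (\<lambda>t C. bmin (L * L) (\<lambda>C'. code_step Q S dl N L p C (ls t) C')) m"

definition code_valid :: "nat \<Rightarrow> nat \<Rightarrow> nat \<Rightarrow> nat \<Rightarrow> bool" where
  "code_valid Q N p c \<longleftrightarrow> (\<forall>i<N. 0 < i \<longrightarrow> digit (Suc N) p i < i \<and> digit (Suc Q) c i < Q)"

definition code_distinct :: "nat \<Rightarrow> nat \<Rightarrow> nat \<Rightarrow> bool" where
  "code_distinct N L C \<longleftrightarrow> (\<forall>i<N. \<forall>j<N. \<not> i = j \<longrightarrow> code_differ N L C i j)"

definition code_big :: "nat \<Rightarrow> nat \<Rightarrow> (nat \<Rightarrow> nat \<Rightarrow> nat \<Rightarrow> nat \<Rightarrow> bool) \<Rightarrow> (nat \<Rightarrow> nat) \<Rightarrow> nat \<Rightarrow>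
    nat \<Rightarrow> nat \<Rightarrow> bool" where
  "code_big Q S dl ls m N L \<longleftrightarrow> (\<exists>p<L. \<exists>c<L. code_valid Q N p c \<and>
     code_run Q S dl N L p ls c m < L * L \<and> code_distinct N L (code_run Q S dl N L p ls c m))"

lemma tree_conf_cong_tree:
  assumes "\<And>i. i < N \<Longrightarrow> 0 < i \<Longrightarrow> P i = P' i \<and> q i = q' i"
  shows "tree_conf T N P q y S D \<longleftrightarrow> tree_conf T N P' q' y S D"
  using assms unfolding tree_conf_def by auto

text \<open>The four inequalities make room for the numbers that code states, letters, parents and
  the difference matrix. The first three bases are successors, hence positive even for an automaton
  without states.\<close>

locale coding =
  fixes T :: "(nat, nat) automaton" and Q Sg N L :: nat and dl
  assumes T: "s_automaton T" "states T = {..<Q}" "alphabet T = {..<Sg}"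
    and N: "0 < N"
    and L: "Suc Q ^ N \<le> L" "Suc Sg ^ N \<le> L" "Suc N ^ N \<le> L" "2 ^ (N * N) \<le> L"
    and dl: "\<And>q a b p. dl q a b p \<longleftrightarrow> (q, a, b, p) \<in> transitions T"
begin

abbreviation "cS \<equiv> code_state Q L"
abbreviation "cD \<equiv> code_differ N L"
abbreviation "par p \<equiv> digit (Suc N) p"
abbreviation "cstep \<equiv> code_step Q Sg dl N L"
abbreviation "crun \<equiv> code_run Q Sg dl N L"

lemma transition_bounds:
  "(q, a, b, p) \<in> transitions T \<Longrightarrow> q < Q \<and> a < Sg \<and> b < Sg \<and> p < Q"
  using T unfolding s_automaton_def by blast

lemma L_pos: "0 < L"
  using L(1) by (metis gr0I le_zero_eq nat.distinct(1) power_eq_0_iff)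

lemma cstep_sound:
  assumes "cstep p C a C'"
  shows "tree_step T N (par p) (cS C) (cD C) a (cS C') (cD C')"
proof -
  from assms obtain A where "digit (Suc Sg) A 0 = a"
    "\<forall>i<N. 0 < i \<longrightarrow> dl (cS C i) (digit (Suc Sg) A (par p i)) (digit (Suc Sg) A i) (cS C' i)"
    "\<forall>i<N. \<forall>j<N. cD C' i j \<longleftrightarrow> cD C i j \<or> \<not> digit (Suc Sg) A i = digit (Suc Sg) A j"
    unfolding code_step_def by blast
  then show ?thesis unfolding tree_step_def dl by blast
qed

lemma ex_code:
  assumes "\<And>i. i < N \<Longrightarrow> 0 < i \<Longrightarrow> S i < Q"
  shows "\<exists>C<L * L. conf_eq N S D (cS C) (cD C)"
proof -
  have "\<exists>x<Suc Q ^ N. \<forall>i<N. digit (Suc Q) x i = (if i = 0 then 0 else S i)"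
    by (rule ex_digits) (use assms in \<open>auto simp: less_Suc_eq\<close>)
  then obtain x where x: "x < L" "\<And>i. i < N \<Longrightarrow> 0 < i \<Longrightarrow> digit (Suc Q) x i = S i"
    using L(1) by (metis less_le_trans less_numeral_extra(3))
  have "\<exists>y<2 ^ (N * N). \<forall>m<N * N. digit 2 y m = of_bool (D (m div N) (m mod N))"
    by (rule ex_digits) auto
  then obtain y where y: "y < L" "\<And>m. m < N * N \<Longrightarrow> digit 2 y m = of_bool (D (m div N) (m mod N))"
    using L(4) by (metis less_le_trans)
  let ?C = "x + L * y"
  have C: "?C mod L = x" "?C div L = y" using x L_pos by auto
  have "?C < L * L"
  proof -
    have "?C < L * Suc y" using x(1) by simp
    also have "\<dots> \<le> L * L" using y(1) by (intro mult_left_mono) auto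
    finally show ?thesis .
  qed
  moreover have "cD ?C i j \<longleftrightarrow> D i j" if "i < N" "j < N" for i j
  proof -
    have "i * N + j < Suc i * N" using that by simp
    also have "\<dots> \<le> N * N" using that by (intro mult_right_mono) auto
    finally have "digit 2 y (i * N + j) = of_bool (D i j)" using y(2) that by simp
    then show ?thesis unfolding code_differ_def C by simp
  qed
  then have "conf_eq N S D (cS ?C) (cD ?C)"
    using x(2) unfolding conf_eq_def code_state_def C by auto
  ultimately show ?thesis by blast
qed

lemma cstep_complete:
  assumes C: "C < L * L" and P: "is_tree N (par p)" and a: "a < Sg"
    and step: "tree_step T N (par p) (cS C) (cD C) a S' D'"
  shows "\<exists>C'. cstep p C a C' \<and> conf_eq N S' D' (cS C') (cD C')"
proof -
  from step obtain A where A: "A 0 = a"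
    "\<And>i. i < N \<Longrightarrow> 0 < i \<Longrightarrow> (cS C i, A (par p i), A i, S' i) \<in> transitions T"
    "\<And>i j. i < N \<Longrightarrow> j < N \<Longrightarrow> D' i j \<longleftrightarrow> cD C i j \<or> A i \<noteq> A j"
    by (rule tree_stepE) blast
  have AS: "A i < Suc Sg" if "i < N" for i
    using A(1) a A(2)[OF that] transition_bounds by (cases "i = 0") (auto simp: less_Suc_eq)
  have "\<exists>x<Suc Sg ^ N. \<forall>i<N. digit (Suc Sg) x i = A i"
    by (rule ex_digits) (use AS in auto)
  then obtain x where x: "x < L" "\<And>i. i < N \<Longrightarrow> digit (Suc Sg) x i = A i"
    using L(2) by (metis less_le_trans)
  obtain C' where C': "C' < L * L" "conf_eq N S' D' (cS C') (cD C')"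
    using ex_code[of S' D'] A(2) transition_bounds by blast
  have "par p i < N" if "i < N" "0 < i" for i
    using P that unfolding is_tree_def by (meson less_trans)
  then have "cstep p C a C'"
    unfolding code_step_def using C C' x A N
    by (intro conjI exI[of _ x]) (auto simp: dl conf_eq_def)
  then show ?thesis using C'(2) by blast
qed

definition confs :: "nat \<Rightarrow> nat \<Rightarrow> nat list \<Rightarrow> nat \<Rightarrow> bool" where
  "confs p c y C \<longleftrightarrow> C < L * L \<and> tree_conf T N (par p) (digit (Suc Q) c) y (cS C) (cD C)"

text \<open>By uniqueness of configurations, every step from the current configuration can be taken
  from the code at hand, whichever of its codes it is.\<close>

lemma confs_step_iff:
  assumes P: "is_tree N (par p)" and C: "confs p c y C" and a: "a < Sg"
  shows "tree_conf T N (par p) (digit (Suc Q) c) (y @ [a]) S' D' \<longleftrightarrow>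
    (\<exists>C'. cstep p C a C' \<and> conf_eq N S' D' (cS C') (cD C'))"
proof
  assume "tree_conf T N (par p) (digit (Suc Q) c) (y @ [a]) S' D'"
  then obtain S D where SD: "tree_conf T N (par p) (digit (Suc Q) c) y S D"
    "tree_step T N (par p) S D a S' D'" unfolding tree_conf_snoc[OF P] by blast
  have "conf_eq N S D (cS C) (cD C)"
    using tree_conf_unique[OF T(1) P SD(1)] C unfolding confs_def by blast
  from tree_step_cong[OF this SD(2)] cstep_complete[OF _ P a] C
  show "\<exists>C'. cstep p C a C' \<and> conf_eq N S' D' (cS C') (cD C')"
    unfolding confs_def by blast
next
  assume "\<exists>C'. cstep p C a C' \<and> conf_eq N S' D' (cS C') (cD C')"
  then obtain C' where C': "cstep p C a C'" "conf_eq N S' D' (cS C') (cD C')" by blast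
  have "tree_conf T N (par p) (digit (Suc Q) c) (y @ [a]) (cS C') (cD C')"
    unfolding tree_conf_snoc[OF P] using C cstep_sound[OF C'(1)] unfolding confs_def by blast
  moreover have "conf_eq N (cS C') (cD C') S' D'" using C'(2) unfolding conf_eq_def by auto
  ultimately show "tree_conf T N (par p) (digit (Suc Q) c) (y @ [a]) S' D'"
    using tree_conf_cong by blast
qed

lemma confs_step:
  assumes "is_tree N (par p)" "confs p c y C" "a < Sg" "cstep p C a C'"
  shows "confs p c (y @ [a]) C'"
proof -
  have "C' < L * L" using assms(4) unfolding code_step_def by blast
  moreover have "tree_conf T N (par p) (digit (Suc Q) c) (y @ [a]) (cS C') (cD C')"
    unfolding confs_step_iff[OF assms(1-3)] using assms(4) by (auto simp: conf_eq_def)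
  ultimately show ?thesis unfolding confs_def by blast
qed

text \<open>The run never commits to a wrong successor, because all successors code the same
  configuration. Hence failure is conclusive, and with it the negative answers of the search are
  correct.\<close>

lemma crun:
  assumes P: "is_tree N (par p)" and c: "c < L" and ls: "\<And>i. i < t \<Longrightarrow> ls i < Sg"
  shows "confs p c (map ls [0..<t]) (crun p ls c t) \<or>
    crun p ls c t = L * L \<and> (\<nexists>S D. tree_conf T N (par p) (digit (Suc Q) c) (map ls [0..<t]) S D)"
  using ls
proof (induction t)
  case 0
  \<comment> \<open>The number of the initial states serves as the initial configuration: as it is
    below \<open>L\<close>, the part for the differences is 0, which is right for empty
    words.\<close>
  have C: "c mod L = c" "c div L = 0" using c by auto
  have "tree_conf T N (par p) (digit (Suc Q) c) [] (cS c) (cD c)"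
    by (rule tree_conf_cong[OF _ tree_conf_Nil[OF P]])
       (auto simp: conf_eq_def code_state_def code_differ_def digit_def C)
  moreover have "c < L * L" using c L_pos by (metis less_le_trans mult.right_neutral mult_le_mono2 Suc_leI One_nat_def)
  ultimately show ?case by (simp add: confs_def code_run_def)
next
  case (Suc t)
  define C where "C = crun p ls c t"
  have run: "crun p ls c (Suc t) = bmin (L * L) (\<lambda>C'. cstep p C (ls t) C')"
    by (simp add: code_run_def C_def)
  have y: "map ls [0..<Suc t] = map ls [0..<t] @ [ls t]" by simp
  have a: "ls t < Sg" using Suc.prems by simp
  from Suc have "confs p c (map ls [0..<t]) C \<or>
    C = L * L \<and> (\<nexists>S D. tree_conf T N (par p) (digit (Suc Q) c) (map ls [0..<t]) S D)"
    unfolding C_def by simp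
  then show ?case
  proof
    assume C: "confs p c (map ls [0..<t]) C"
    show ?thesis
    proof (cases "\<exists>C'. cstep p C (ls t) C'")
      case True
      then obtain C' where "cstep p C (ls t) C'" "C' < L * L" unfolding code_step_def by blast
      from bmin_Some[OF this(2), of "\<lambda>C'. cstep p C (ls t) C'", OF this(1)]
      have "cstep p C (ls t) (crun p ls c (Suc t))" unfolding run by blast
      then show ?thesis using confs_step[OF P C a] unfolding y by blast
    next
      case False
      then have "crun p ls c (Suc t) = L * L" unfolding run by (intro bmin_None) blast
      moreover have "\<nexists>S D. tree_conf T N (par p) (digit (Suc Q) c) (map ls [0..<Suc t]) S D"
        unfolding y confs_step_iff[OF P C a] using False by blast
      ultimately show ?thesis by blast
    qed
  next
    assume C: "C = L * L \<and> (\<nexists>S D. tree_conf T N (par p) (digit (Suc Q) c) (map ls [0..<t]) S D)"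
    then have "\<not> cstep p C (ls t) C'" for C' unfolding code_step_def by auto
    then have "crun p ls c (Suc t) = L * L" unfolding run by (intro bmin_None) blast
    moreover have "\<nexists>S D. tree_conf T N (par p) (digit (Suc Q) c) (map ls [0..<Suc t]) S D"
      unfolding y tree_conf_snoc[OF P] using C by blast
    ultimately show ?thesis by blast
  qed
qed

lemma crun_confs:
  assumes "is_tree N (par p)" "c < L" "\<And>i. i < t \<Longrightarrow> ls i < Sg" "crun p ls c t < L * L"
  shows "confs p c (map ls [0..<t]) (crun p ls c t)"
  using crun[of p c t ls, OF assms(1,2)] assms(3,4) by auto

lemma crun_exists:
  assumes "is_tree N (par p)" "c < L" "\<And>i. i < t \<Longrightarrow> ls i < Sg"
    "tree_conf T N (par p) (digit (Suc Q) c) (map ls [0..<t]) S D"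
  shows "confs p c (map ls [0..<t]) (crun p ls c t)"
  using crun[of p c t ls, OF assms(1,2)] assms(3,4) by blast

lemma code_valid_iff: "code_valid Q N p c \<longleftrightarrow>
    is_tree N (par p) \<and> (\<forall>i<N. 0 < i \<longrightarrow> digit (Suc Q) c i \<in> states T)"
  unfolding code_valid_def is_tree_def T by auto

lemma orbit_ge_imp_code:
  assumes "y \<in> lists (alphabet T)" "N \<le> card (orbit T y)"
  obtains p c S D where "p < L" "c < L" "code_valid Q N p c"
    "tree_conf T N (par p) (digit (Suc Q) c) y S D" "\<forall>i<N. \<forall>j<N. i \<noteq> j \<longrightarrow> D i j"
proof -
  from assms obtain P q S D where PqSD: "is_tree N P" "\<forall>i<N. 0 < i \<longrightarrow> q i \<in> states T"
    "tree_conf T N P q y S D" "\<forall>i<N. \<forall>j<N. i \<noteq> j \<longrightarrow> D i j"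
    unfolding card_orbit_ge_iff_conf[OF T(1) assms(1)] by blast
  have "\<exists>x<Suc N ^ N. \<forall>i<N. par x i = (if i = 0 then 0 else P i)"
    by (rule ex_digits) (use PqSD(1) in \<open>auto simp: is_tree_def dest: less_trans\<close>)
  then obtain p where p: "p < L" "\<And>i. i < N \<Longrightarrow> 0 < i \<Longrightarrow> par p i = P i"
    using L(3) by (metis less_le_trans less_numeral_extra(3))
  have "\<exists>x<Suc Q ^ N. \<forall>i<N. digit (Suc Q) x i = (if i = 0 then 0 else q i)"
    by (rule ex_digits) (use PqSD(2) T(2) in \<open>auto simp: less_Suc_eq\<close>)
  then obtain c where c: "c < L" "\<And>i. i < N \<Longrightarrow> 0 < i \<Longrightarrow> digit (Suc Q) c i = q i"
    using L(1) by (metis less_le_trans less_numeral_extra(3))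
  have "tree_conf T N (par p) (digit (Suc Q) c) y S D"
    using PqSD(3) tree_conf_cong_tree[of N "par p" P "digit (Suc Q) c" q] p(2) c(2) by blast
  moreover have "code_valid Q N p c"
    using PqSD(1,2) p(2) c(2) unfolding code_valid_iff is_tree_def by auto
  ultimately show thesis using that p(1) c(1) PqSD(4) by blast
qed

lemma confs_imp_orbit_ge:
  assumes "y \<in> lists (alphabet T)" "code_valid Q N p c" "confs p c y C" "code_distinct N L C"
  shows "N \<le> card (orbit T y)"
  unfolding card_orbit_ge_iff_conf[OF T(1) assms(1)]
  using assms(2-4) unfolding code_valid_iff confs_def code_distinct_def by blast

lemma code_distinct_cong:
  "conf_eq N S D (cS C) (cD C) \<Longrightarrow> \<forall>i<N. \<forall>j<N. i \<noteq> j \<longrightarrow> D i j \<Longrightarrow> code_distinct N L C"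
  unfolding conf_eq_def code_distinct_def by auto

text \<open>A large orbit provides some final configuration with distinct words. By uniqueness the
  computed run ends in a code of the same configuration, so distinctness can be read off that
  code.\<close>

lemma code_big_iff:
  assumes ls: "\<And>i. i < m \<Longrightarrow> ls i < Sg"
  shows "code_big Q Sg dl ls m N L \<longleftrightarrow> N \<le> card (orbit T (map ls [0..<m]))"
proof -
  let ?y = "map ls [0..<m]"
  have y: "?y \<in> lists (alphabet T)" using ls T(3) by auto
  show ?thesis
  proof
    assume "code_big Q Sg dl ls m N L"
    then obtain p c where "p < L" "c < L" "code_valid Q N p c" "crun p ls c m < L * L"
      "code_distinct N L (crun p ls c m)" unfolding code_big_def by blast
    then show "N \<le> card (orbit T ?y)"
      using confs_imp_orbit_ge[OF y] crun_confs[of p c m ls] ls code_valid_iff by blast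
  next
    assume "N \<le> card (orbit T ?y)"
    then obtain p c S D where pc: "p < L" "c < L" "code_valid Q N p c"
      "tree_conf T N (par p) (digit (Suc Q) c) ?y S D" "\<forall>i<N. \<forall>j<N. i \<noteq> j \<longrightarrow> D i j"
      by (rule orbit_ge_imp_code[OF y])
    then have P: "is_tree N (par p)" unfolding code_valid_iff by blast
    have C: "confs p c ?y (crun p ls c m)" by (rule crun_exists[OF P pc(2) ls pc(4)])
    then have "conf_eq N S D (cS (crun p ls c m)) (cD (crun p ls c m))"
      using tree_conf_unique[OF T(1) P pc(4)] unfolding confs_def by blast
    then have "code_distinct N L (crun p ls c m)" using pc(5) code_distinct_cong by blast
    then show "code_big Q Sg dl ls m N L"
      unfolding code_big_def using pc C unfolding confs_def by blast
  qed
qed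

definition reach :: "nat \<Rightarrow> nat \<Rightarrow> nat \<Rightarrow> bool" where
  "reach p C C' \<longleftrightarrow> (\<exists>a<Sg. cstep p C a C')"

lemma reach_sound:
  assumes "is_tree N (par p)" "confs p c y C" "(reach p)\<^sup>*\<^sup>* C C'"
  shows "\<exists>x\<in>lists (alphabet T). confs p c (y @ x) C'"
  using assms(3)
proof induction
  case base
  then show ?case using assms(2) by (intro bexI[of _ "[]"]) auto
next
  case (step C1 C2)
  then obtain x a where "x \<in> lists (alphabet T)" "confs p c (y @ x) C1" "a < Sg" "cstep p C1 a C2"
    unfolding reach_def by blast
  moreover from this have "confs p c (y @ x @ [a]) C2"
    using confs_step[OF assms(1), of c "y @ x" C1 a C2] by simp
  ultimately show ?case using T(3) by (intro bexI[of _ "x @ [a]"]) auto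
qed

text \<open>The extension \<open>x\<close> has no length bound and is never stored; only the current
  configuration is kept while its letters are guessed one at a time.\<close>

lemma reach_complete:
  assumes P: "is_tree N (par p)" and C: "confs p c y C"
  shows "x \<in> lists (alphabet T) \<Longrightarrow> tree_conf T N (par p) (digit (Suc Q) c) (y @ x) S D \<Longrightarrow>
    \<exists>C'. (reach p)\<^sup>*\<^sup>* C C' \<and> confs p c (y @ x) C' \<and> conf_eq N S D (cS C') (cD C')"
proof (induction x arbitrary: S D rule: rev_induct)
  case Nil
  then have "conf_eq N S D (cS C) (cD C)"
    using tree_conf_unique[OF T(1) P, of "digit (Suc Q) c" y S D] C unfolding confs_def by simp
  then show ?case using C by (intro exI[of _ C]) simp
next
  case (snoc a x)
  then have a: "a < Sg" and x: "x \<in> lists (alphabet T)" using T(3) by auto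
  have *: "tree_conf T N (par p) (digit (Suc Q) c) ((y @ x) @ [a]) S D" using snoc.prems(2) by simp
  then obtain S0 D0 where "tree_conf T N (par p) (digit (Suc Q) c) (y @ x) S0 D0"
    unfolding tree_conf_snoc[OF P] by blast
  from snoc.IH[OF x this] obtain C1 where C1: "(reach p)\<^sup>*\<^sup>* C C1" "confs p c (y @ x) C1" by blast
  from * obtain C2 where C2: "cstep p C1 a C2" "conf_eq N S D (cS C2) (cD C2)"
    unfolding confs_step_iff[OF P C1(2) a] by blast
  have "confs p c (y @ x @ [a]) C2" using confs_step[OF P C1(2) a C2(1)] by simp
  moreover have "reach p C1 C2" using C2(1) a unfolding reach_def by blast
  with C1(1) have "(reach p)\<^sup>*\<^sup>* C C2" by (rule rtranclp.rtrancl_into_rtrancl)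
  ultimately show ?case using C2(2) by blast
qed

end

section \<open>The algorithm\<close>

text \<open>Partial correctness together with a bound on all visited states. This yields soundness
  and the space bound; existence of accepting computations is proved separately.\<close>

definition hoare :: "('b \<Rightarrow> 's \<Rightarrow> 's \<Rightarrow> bool) \<Rightarrow> ('s \<Rightarrow> bool) \<Rightarrow> ('s \<Rightarrow> bool) \<Rightarrow> 'b com \<Rightarrow> ('s \<Rightarrow> bool) \<Rightarrow> bool" where
  "hoare bs V pre c post \<longleftrightarrow> (\<forall>s. pre s \<longrightarrow> (\<forall>t. vis bs c s t \<longrightarrow> V t) \<and> (\<forall>t. sem bs c s t \<longrightarrow> post t))"

lemma hoare_Basic:
  "(\<And>s. pre s \<Longrightarrow> V s) \<Longrightarrow> (\<And>s t. pre s \<Longrightarrow> bs b s t \<Longrightarrow> V t \<and> post t) \<Longrightarrow> hoare bs V pre (Basic b) post"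
  unfolding hoare_def by auto

lemma hoare_Seq: "hoare bs V pre c mid \<Longrightarrow> hoare bs V mid d post \<Longrightarrow> hoare bs V pre (Seq c d) post"
  unfolding hoare_def vis.simps sem.simps OO_def by blast

lemma hoare_Alt: "hoare bs V pre c post \<Longrightarrow> hoare bs V pre d post \<Longrightarrow> hoare bs V pre (Alt c d) post"
  unfolding hoare_def by auto

lemma hoare_Star:
  assumes "hoare bs V I c I" "\<And>s. I s \<Longrightarrow> V s"
  shows "hoare bs V I (Star c) I"
proof -
  have I: "I t" if "(sem bs c)\<^sup>*\<^sup>* s t" "I s" for s t
    using that by induction (use assms(1) in \<open>auto simp: hoare_def\<close>)
  show ?thesis
    unfolding hoare_def vis.simps sem.simps using I assms unfolding hoare_def by blast
qed

lemma bmin_le: "bmin n P \<le> n"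
  using bmin_None[of n P] bmin_Some[of _ n P] by (metis less_imp_le order_refl)

lemma code_run_le: "code_run Q S dl N L p ls c m \<le> max c (L * L)"
  unfolding code_run_def by (cases m) (auto intro: bmin_le max.coboundedI2)

text \<open>Register 0 holds the number of nodes, 1 a power of two that bounds all codes, 2 the parents,
  3 the configuration, and 4 a guessed successor configuration.\<close>

definition st :: "nat \<Rightarrow> nat \<Rightarrow> nat \<Rightarrow> nat \<Rightarrow> nat \<Rightarrow> nat \<Rightarrow> nat" where
  "st N L p c d = (\<lambda>_. 0)(0 := N, 1 := L, 2 := p, 3 := c, 4 := d)"

lemma st_get [simp]:
  "st N L p c d 0 = N" "st N L p c d (Suc 0) = L" "st N L p c d 2 = p" "st N L p c d 3 = c"
  "st N L p c d 4 = d"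
  by (simp_all add: st_def)

lemma st_upd [simp]:
  "(st N L p c d)(0 := x) = st x L p c d" "(st N L p c d)(Suc 0 := x) = st N x p c d"
  "(st N L p c d)(2 := x) = st N L x c d" "(st N L p c d)(3 := x) = st N L p x d"
  "(st N L p c d)(4 := x) = st N L p c x"
  by (auto simp: st_def)

lemma st_0: "(\<lambda>_. 0) = st 0 0 0 0 0"
  by (auto simp: st_def)

text \<open>An exponent that suffices for all four requirements on \<open>L\<close>. The summand
  \<open>S\<close> is a generous bound for the bits of a letter; the factor for the size of the
  alphabet in the space bound leaves room for it.\<close>

definition expo :: "nat \<Rightarrow> nat \<Rightarrow> nat \<Rightarrow> nat" where
  "expo Q S N = N * (N + S + bitlen Q)"

lemma expo_mono: "N \<le> N' \<Longrightarrow> expo Q S N \<le> expo Q S N'"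
  unfolding expo_def by (intro mult_le_mono) auto

lemma power_div_power_eq_0: "(2::nat) ^ j div 2 ^ e = 0 \<longleftrightarrow> j < e"
  by (simp add: div_eq_0_iff)

lemma coding_expo:
  assumes "s_automaton T" "states T = {..<Q}" "alphabet T = {..<S}" "0 < N"
    "\<And>q a b p. dl q a b p \<longleftrightarrow> (q, a, b, p) \<in> transitions T"
  shows "coding T Q S N (2 ^ expo Q S N) dl"
proof
  have *: "b ^ N \<le> 2 ^ expo Q S N" if "b \<le> 2 ^ e" "e \<le> N + S + bitlen Q" for b e :: nat
  proof -
    have "b ^ N \<le> (2 ^ e) ^ N" using that(1) by (rule power_mono) simp
    also have "\<dots> = 2 ^ (N * e)" by (simp add: power_mult[symmetric] mult.commute)
    also have "\<dots> \<le> 2 ^ expo Q S N"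
      unfolding expo_def using that(2) by (intro power_increasing mult_left_mono) auto
    finally show ?thesis .
  qed
  show "Suc Q ^ N \<le> 2 ^ expo Q S N" by (rule *[of _ "bitlen Q"]) (auto simp: Suc_le_eq less_power_bitlen)
  show "Suc S ^ N \<le> 2 ^ expo Q S N" by (rule *[of _ S]) (auto simp: Suc_le_eq less_exp)
  show "Suc N ^ N \<le> 2 ^ expo Q S N" by (rule *[of _ N]) (auto simp: Suc_le_eq less_exp)
  show "2 ^ (N * N) \<le> (2::nat) ^ expo Q S N"
    unfolding expo_def by (intro power_increasing) auto
qed (use assms in auto)

text \<open>The interface to the input format: all data of the instance are definable functions of
  the input word. Automata that are part of the input and fixed automata are two instances.\<close>

locale algorithm = inputs A X code
  for A :: "'i set" and X :: "('i list \<times> nat) set" and code :: "'i \<Rightarrow> nat" +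
  fixes nQ nS kk ul :: "'i list \<Rightarrow> nat" and letter :: "'i list \<Rightarrow> nat \<Rightarrow> nat"
    and del :: "'i list \<Rightarrow> nat \<Rightarrow> nat \<Rightarrow> nat \<Rightarrow> nat \<Rightarrow> bool"
    and aut :: "'i list \<Rightarrow> (nat, nat) automaton"
  assumes tdef_nQ: "tdef d (\<lambda>s. nQ (fst s))" and tdef_nS: "tdef d (\<lambda>s. nS (fst s))"
    and tdef_kk: "tdef d (\<lambda>s. kk (fst s))" and tdef_ul: "tdef d (\<lambda>s. ul (fst s))"
    and tdef_letter: "tdef d f \<Longrightarrow> tdef d (\<lambda>s. letter (fst s) (f s))"
    and pdef_del: "tdef d f1 \<Longrightarrow> tdef d f2 \<Longrightarrow> tdef d f3 \<Longrightarrow> tdef d f4 \<Longrightarrow>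
      pdef d (\<lambda>s. del (fst s) (f1 s) (f2 s) (f3 s) (f4 s))"
    and input: "(w, b) \<in> X \<Longrightarrow> s_automaton (aut w) \<and> states (aut w) = {..<nQ w} \<and>
      alphabet (aut w) = {..<nS w} \<and>
      (\<forall>q a b p. del w q a b p \<longleftrightarrow> (q, a, b, p) \<in> transitions (aut w)) \<and>
      (\<forall>t<ul w. letter w t < nS w) \<and> 1 \<le> kk w"
begin

text \<open>For a power of two \<open>L\<close> this says \<open>L < 2 ^ expo\<close>. Division is
  used because the power itself could exceed the register bound and is never formed.\<close>

definition grow :: "'i list \<Rightarrow> nat \<Rightarrow> nat \<Rightarrow> bool" where
  "grow w N L \<longleftrightarrow> L div 2 ^ expo (nQ w) (nS w) N = 0"

definition big :: "'i list \<Rightarrow> nat \<Rightarrow> nat \<Rightarrow> bool" where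
  "big w N L \<longleftrightarrow> code_big (nQ w) (nS w) (del w) (letter w) (ul w) N L"

definition run_u :: "'i list \<Rightarrow> nat \<Rightarrow> nat \<Rightarrow> nat \<Rightarrow> nat \<Rightarrow> nat" where
  "run_u w N L p c = code_run (nQ w) (nS w) (del w) N L p (letter w) c (ul w)"

definition reach_step :: "'i list \<Rightarrow> nat \<Rightarrow> nat \<Rightarrow> nat \<Rightarrow> nat \<Rightarrow> nat \<Rightarrow> bool" where
  "reach_step w N L p C C' \<longleftrightarrow> (\<exists>a<nS w. code_step (nQ w) (nS w) (del w) N L p C a C')"

text \<open>Register 0 starts at 0 and is only raised after the next larger number of nodes has been
  verified. For given register contents exactly one of the two branches and the exit test succeeds,
  so the phase is deterministic and ends at the exact orbit size.\<close>

definition phase1 :: "'i hinstr com" where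
  "phase1 = Seq (Star (Alt
      (Seq (Basic (Test (\<lambda>s. grow (fst s) (Suc (snd s 0)) (snd s 1))))
           (Basic (Assign 1 (\<lambda>s. 2 * snd s 1))))
      (Seq (Basic (Test (\<lambda>s. \<not> grow (fst s) (Suc (snd s 0)) (snd s 1) \<and> big (fst s) (Suc (snd s 0)) (snd s 1))))
           (Basic (Assign 0 (\<lambda>s. Suc (snd s 0)))))))
    (Basic (Test (\<lambda>s. \<not> grow (fst s) (Suc (snd s 0)) (snd s 1) \<and> \<not> big (fst s) (Suc (snd s 0)) (snd s 1))))"

definition phase2 :: "'i hinstr com" where
  "phase2 = Seq (Star
      (Seq (Basic (Test (\<lambda>s. grow (fst s) (snd s 0) (snd s 1)))) (Basic (Assign 1 (\<lambda>s. 2 * snd s 1)))))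
    (Basic (Test (\<lambda>s. \<not> grow (fst s) (snd s 0) (snd s 1))))"

text \<open>The last test asks only that the run on \<open>u\<close> be defined. Words that still
  coincide after \<open>u\<close> may be separated by the extension.\<close>

definition phase3 :: "'i hinstr com" where
  "phase3 = Seq (Basic (Guess 2 (\<lambda>s. snd s 1))) (Seq (Basic (Guess 3 (\<lambda>s. snd s 1)))
     (Seq (Basic (Test (\<lambda>s. snd s 3 < snd s 1 \<and> code_valid (nQ (fst s)) (snd s 0) (snd s 2) (snd s 3))))
     (Seq (Basic (Assign 3 (\<lambda>s. run_u (fst s) (snd s 0) (snd s 1) (snd s 2) (snd s 3))))
       (Basic (Test (\<lambda>s. snd s 3 < snd s 1 * snd s 1))))))"

definition phase4 :: "'i hinstr com" where
  "phase4 = Seq (Star (Seq (Basic (Guess 4 (\<lambda>s. snd s 1 * snd s 1)))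
      (Seq (Basic (Test (\<lambda>s. reach_step (fst s) (snd s 0) (snd s 1) (snd s 2) (snd s 3) (snd s 4))))
        (Basic (Assign 3 (\<lambda>s. snd s 4))))))
    (Basic (Test (\<lambda>s. code_distinct (snd s 0) (snd s 1) (snd s 3))))"

definition prog :: "'i hinstr com" where
  "prog = Seq (Basic (Assign 1 (\<lambda>_. 1))) (Seq phase1 (Seq (Basic (Assign 0 (\<lambda>s. snd s 0 + kk (fst s))))
     (Seq phase2 (Seq phase3 phase4))))"

section \<open>Definability of the tests and assignments\<close>

lemma tdef_bitlen: "tdef d f \<Longrightarrow> tdef d (\<lambda>s. bitlen (f s))"
  unfolding bitlen_def by (intro tdef_sum pdef_less tdef_const tdef_div_power) (auto intro: tdef_weaken)

lemma tdef_expo: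
  "tdef d f1 \<Longrightarrow> tdef d f2 \<Longrightarrow> tdef d f3 \<Longrightarrow> tdef d (\<lambda>s. expo (f1 s) (f2 s) (f3 s))"
  unfolding expo_def by (intro tdef_mult tdef_add tdef_bitlen)

lemma pdef_grow: "tdef d f1 \<Longrightarrow> tdef d f2 \<Longrightarrow> pdef d (\<lambda>s. grow (fst s) (f1 s) (f2 s))"
  unfolding grow_def by (intro pdef_eq tdef_const tdef_div_power tdef_expo tdef_nQ tdef_nS)

lemma tdef_code_state: "tdef d f1 \<Longrightarrow> tdef d f2 \<Longrightarrow> tdef d f3 \<Longrightarrow> tdef d f4 \<Longrightarrow>
    tdef d (\<lambda>s. code_state (f1 s) (f2 s) (f3 s) (f4 s))"
  unfolding code_state_def by (intro tdef_digit tdef_Suc tdef_mod)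

lemma pdef_code_differ: "tdef d f1 \<Longrightarrow> tdef d f2 \<Longrightarrow> tdef d f3 \<Longrightarrow> tdef d f4 \<Longrightarrow> tdef d f5 \<Longrightarrow>
    pdef d (\<lambda>s. code_differ (f1 s) (f2 s) (f3 s) (f4 s) (f5 s))"
  unfolding code_differ_def by (intro pdef_eq tdef_const tdef_digit tdef_add tdef_mult tdef_div)

lemmas tdef_intros' = tdef_intros tdef_nQ tdef_nS tdef_kk tdef_ul tdef_letter pdef_del tdef_code_state
  pdef_code_differ pdef_grow

lemma pdef_code_step:
  assumes "tdef d N" "tdef d L" "tdef d p" "tdef d C" "tdef d a" "tdef d C'"
  shows "pdef d (\<lambda>s. code_step (nQ (fst s)) (nS (fst s)) (del (fst s)) (N s) (L s) (p s) (C s) (a s) (C' s))"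
  unfolding code_step_def
  by (rule tdef_intros' assms | assumption | (rule tdef_weaken, assumption, linarith)
      | (rule tdef_weaken, rule assms, linarith))+

text \<open>Bounded recursion applies since each iterate is a result of \<open>bmin\<close> and so
  at most \<open>L * L\<close>; the summand for \<open>c\<close> covers the case of no step.\<close>

lemma tdef_code_run:
  assumes "tdef d N" "tdef d L" "tdef d p" "tdef d c"
  shows "tdef d (\<lambda>s. run_u (fst s) (N s) (L s) (p s) (c s))"
  unfolding run_u_def code_run_def
proof (rule tdef_rec[where h = "\<lambda>s. c s + L s * L s"])
  show "polyb d (\<lambda>s. c s + L s * L s)"
    by (intro polyb_add polyb_mult tdef_polyb assms)
  show "rec_nat (c (w, \<rho>)) (\<lambda>t C. bmin (L (w, \<rho>) * L (w, \<rho>)) (\<lambda>C'. code_step (nQ (fst (w, \<rho>)))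
      (nS (fst (w, \<rho>))) (del (fst (w, \<rho>))) (N (w, \<rho>)) (L (w, \<rho>)) (p (w, \<rho>)) C
      (letter (fst (w, \<rho>)) t) C')) j \<le> c (w, \<rho>) + L (w, \<rho>) * L (w, \<rho>)" for w \<rho> j
    by (cases j) (auto intro: trans_le_add2 bmin_le)
qed (rule tdef_intros' pdef_code_step assms | assumption | (rule tdef_weaken, assumption, linarith)
      | (rule tdef_weaken, rule assms, linarith))+

lemma pdef_code_valid:
  assumes "tdef d f1" "tdef d f2" "tdef d f3" "tdef d f4"
  shows "pdef d (\<lambda>s. code_valid (f1 s) (f2 s) (f3 s) (f4 s))"
  unfolding code_valid_def
  by (rule tdef_intros' assms | assumption | (rule tdef_weaken, rule assms, linarith))+

lemma pdef_code_distinct: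
  assumes "tdef d f1" "tdef d f2" "tdef d f3"
  shows "pdef d (\<lambda>s. code_distinct (f1 s) (f2 s) (f3 s))"
  unfolding code_distinct_def
  by (rule tdef_intros' assms | assumption | (rule tdef_weaken, assumption, linarith)
      | (rule tdef_weaken, rule assms, linarith))+

lemma pdef_reach_step:
  assumes "tdef d N" "tdef d L" "tdef d p" "tdef d C" "tdef d C'"
  shows "pdef d (\<lambda>s. reach_step (fst s) (N s) (L s) (p s) (C s) (C' s))"
  unfolding reach_step_def
  by (rule tdef_intros' pdef_code_step assms | assumption | (rule tdef_weaken, assumption, linarith)
      | (rule tdef_weaken, rule assms, linarith))+

lemma pdef_big:
  assumes "tdef d N" "tdef d L"
  shows "pdef d (\<lambda>s. big (fst s) (N s) (L s))"
  unfolding big_def code_big_def run_u_def[symmetric]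
  by (rule tdef_intros' pdef_code_valid pdef_code_distinct tdef_code_run assms | assumption
      | (rule tdef_weaken, assumption, linarith) | (rule tdef_weaken, rule assms, linarith))+

lemma prog_ok: "b \<in> basics prog \<Longrightarrow> hinstr_ok 5 b"
  unfolding prog_def phase1_def phase2_def phase3_def phase4_def
  by (auto intro!: tdef_intros' pdef_big tdef_code_run pdef_code_valid pdef_code_distinct
      pdef_reach_step tdef_var)

end

lemma st_eq_iff [simp]: "st N L p c d = st N' L' p' c' d' \<longleftrightarrow>
    N = N' \<and> L = L' \<and> p = p' \<and> c = c' \<and> d = d'"
proof
  assume "st N L p c d = st N' L' p' c' d'"
  then have "st N L p c d i = st N' L' p' c' d' i" for i by simp
  from this[of 0] this[of 1] this[of 2] this[of 3] this[of 4]
  show "N = N' \<and> L = L' \<and> p = p' \<and> c = c' \<and> d = d'" by simp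
qed simp

lemma sem_Seq: "sem bs c s t \<Longrightarrow> sem bs d t t' \<Longrightarrow> sem bs (Seq c d) s t'"
  unfolding sem.simps by (rule relcomppI)

lemma sem_Star_Basic:
  "(sem bs c)\<^sup>*\<^sup>* s t \<Longrightarrow> bs b t t' \<Longrightarrow> sem bs (Seq (Star c) (Basic b)) s t'"
  unfolding sem.simps by (rule relcomppI)

section \<open>Soundness and space: invariants of the four phases\<close>

context algorithm
begin

context
  fixes w b assumes wX: "(w, b) \<in> X"
begin

abbreviation "word \<equiv> map (letter w) [0..<ul w]"
abbreviation "n0 \<equiv> card (orbit (aut w) word)"
abbreviation "M0 \<equiv> n0 + kk w"
abbreviation "ex \<equiv> expo (nQ w) (nS w)"

lemmas inp = input[OF wX]

lemma word_lists: "word \<in> lists (alphabet (aut w))"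
  using inp by auto

lemma n0_pos: "1 \<le> n0"
  using inp word_lists by (intro card_orbit_pos) auto

lemma coding: "0 < N \<Longrightarrow> coding (aut w) (nQ w) (nS w) N (2 ^ ex N) (del w)"
  using inp by (intro coding_expo) auto

lemma grow_iff: "grow w N (2 ^ j) \<longleftrightarrow> j < ex N"
  unfolding grow_def by (rule power_div_power_eq_0)

lemma big_iff: "big w (Suc N) (2 ^ ex (Suc N)) \<longleftrightarrow> Suc N \<le> n0"
  unfolding big_def using inp by (intro coding.code_big_iff[OF coding]) auto

text \<open>The largest stored values are configurations, their guessed successors and the failure
  value \<open>L * L\<close>, where \<open>L\<close> is at most \<open>2 ^ ex M0\<close>; the square
  of this is the bound.\<close>

definition good :: "(nat \<Rightarrow> nat) \<Rightarrow> bool" where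
  "good \<rho> \<longleftrightarrow> (\<forall>i. \<rho> i \<le> 4 ^ ex M0)"

lemma M0_le: "M0 \<le> 2 ^ ex M0"
proof -
  have "M0 \<le> M0 * (M0 + nS w + bitlen (nQ w))" using n0_pos by simp
  then have "M0 \<le> ex M0" by (simp add: expo_def)
  also have "\<dots> \<le> 2 ^ ex M0" by (rule less_imp_le) (rule less_exp)
  finally show ?thesis .
qed

lemma four_power: "(4::nat) ^ e = 2 ^ e * 2 ^ e"
  by (simp add: power_mult_distrib[symmetric])

lemma two_le_four: "(2::nat) ^ e \<le> 4 ^ e"
  by (rule power_mono) auto

lemma good_st:
  assumes "N \<le> M0" "L \<le> 2 ^ ex M0" "p \<le> 2 ^ ex M0" "c \<le> 4 ^ ex M0" "d \<le> 4 ^ ex M0"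
  shows "good (st N L p c d)"
  using assms M0_le two_le_four[of "ex M0"] unfolding good_def st_def by auto

lemma power_le_ex: "j \<le> ex N \<Longrightarrow> N \<le> M0 \<Longrightarrow> (2::nat) ^ j \<le> 2 ^ ex M0"
  by (rule power_increasing) (auto dest: expo_mono[of _ _ "nQ w" "nS w"])

definition inv1 :: "(nat \<Rightarrow> nat) \<Rightarrow> bool" where
  "inv1 \<rho> \<longleftrightarrow> (\<exists>N j. \<rho> = st N (2 ^ j) 0 0 0 \<and> N \<le> n0 \<and> j \<le> ex (Suc N))"

text \<open>Here \<open>k \<ge> 1\<close> enters: the first phase looks at up to
  \<open>n0 + 1\<close> nodes, which must not exceed \<open>n0 + k\<close>.\<close>

lemma inv1_good: "inv1 \<rho> \<Longrightarrow> good \<rho>"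
  unfolding inv1_def using inp by (auto intro!: good_st power_le_ex)

lemma hoare_phase1:
  "hoare (hsem w) good inv1 phase1 (\<lambda>\<rho>. \<rho> = st n0 (2 ^ ex (Suc n0)) 0 0 0)"
  unfolding phase1_def
proof (intro hoare_Seq[OF hoare_Star] hoare_Alt)
  show "hoare (hsem w) good inv1 (Seq
      (Basic (Test (\<lambda>s. grow (fst s) (Suc (snd s 0)) (snd s 1)))) (Basic (Assign 1 (\<lambda>s. 2 * snd s 1)))) inv1"
  proof (rule hoare_Seq[OF hoare_Basic hoare_Basic])
    fix \<rho> \<rho>' assume "inv1 \<rho> \<and> grow w (Suc (\<rho> 0)) (\<rho> 1)" "hsem w (Assign 1 (\<lambda>s. 2 * snd s 1)) \<rho> \<rho>'"
    then obtain N j where "\<rho>' = st N (2 ^ Suc j) 0 0 0" "N \<le> n0" "j < ex (Suc N)"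
      unfolding inv1_def by (auto simp: grow_iff)
    then have "inv1 \<rho>'" unfolding inv1_def by (metis Suc_leI)
    then show "good \<rho>' \<and> inv1 \<rho>'" using inv1_good by blast
  qed (auto intro: inv1_good)
  show "hoare (hsem w) good inv1 (Seq
      (Basic (Test (\<lambda>s. \<not> grow (fst s) (Suc (snd s 0)) (snd s 1) \<and> big (fst s) (Suc (snd s 0)) (snd s 1))))
      (Basic (Assign 0 (\<lambda>s. Suc (snd s 0))))) inv1"
  proof (rule hoare_Seq[OF hoare_Basic hoare_Basic])
    fix \<rho> \<rho>' assume *: "inv1 \<rho> \<and> \<not> grow w (Suc (\<rho> 0)) (\<rho> 1) \<and> big w (Suc (\<rho> 0)) (\<rho> 1)"
      and \<rho>': "hsem w (Assign 0 (\<lambda>s. Suc (snd s 0))) \<rho> \<rho>'"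
    from * obtain N j where \<rho>: "\<rho> = st N (2 ^ j) 0 0 0" "N \<le> n0" "j \<le> ex (Suc N)"
      unfolding inv1_def by blast
    \<comment> \<open>The register has stopped growing at exactly the value of \<open>L\<close> for
      which \<open>big\<close> is known to compare \<open>Suc N\<close> with the orbit size.\<close>
    with * have "j = ex (Suc N)" by (simp add: grow_iff)
    with * \<rho> have "Suc N \<le> n0" by (simp add: big_iff)
    moreover have "j \<le> ex (Suc (Suc N))" using \<rho>(3) expo_mono[of "Suc N" "Suc (Suc N)" "nQ w" "nS w"] by simp
    ultimately have "inv1 \<rho>'" unfolding inv1_def using \<rho> \<rho>' by auto
    then show "good \<rho>' \<and> inv1 \<rho>'" using inv1_good by blast
  qed (auto intro: inv1_good)
  show "hoare (hsem w) good inv1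
      (Basic (Test (\<lambda>s. \<not> grow (fst s) (Suc (snd s 0)) (snd s 1) \<and> \<not> big (fst s) (Suc (snd s 0)) (snd s 1))))
      (\<lambda>\<rho>. \<rho> = st n0 (2 ^ ex (Suc n0)) 0 0 0)"
  proof (rule hoare_Basic)
    fix \<rho> \<rho>' assume "inv1 \<rho>" and t: "hsem w (Test (\<lambda>s. \<not> grow (fst s) (Suc (snd s 0)) (snd s 1) \<and>
        \<not> big (fst s) (Suc (snd s 0)) (snd s 1))) \<rho> \<rho>'"
    then obtain N j where \<rho>: "\<rho> = st N (2 ^ j) 0 0 0" "N \<le> n0" "j \<le> ex (Suc N)"
      unfolding inv1_def by blast
    with t have "j = ex (Suc N)" by (simp add: grow_iff)
    moreover from this t \<rho> have "N = n0" by (simp add: big_iff)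
    ultimately show "good \<rho>' \<and> \<rho>' = st n0 (2 ^ ex (Suc n0)) 0 0 0"
      using t \<rho> \<open>inv1 \<rho>\<close> inv1_good by auto
  qed (rule inv1_good)
qed (rule inv1_good)

definition inv2 :: "(nat \<Rightarrow> nat) \<Rightarrow> bool" where
  "inv2 \<rho> \<longleftrightarrow> (\<exists>j\<le>ex M0. \<rho> = st M0 (2 ^ j) 0 0 0)"

lemma inv2_good: "inv2 \<rho> \<Longrightarrow> good \<rho>"
  unfolding inv2_def by (auto intro!: good_st power_le_ex)

lemma hoare_phase2:
  "hoare (hsem w) good inv2 phase2 (\<lambda>\<rho>. \<rho> = st M0 (2 ^ ex M0) 0 0 0)"
  unfolding phase2_def
proof (intro hoare_Seq[OF hoare_Star])
  show "hoare (hsem w) good inv2 (Seq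
      (Basic (Test (\<lambda>s. grow (fst s) (snd s 0) (snd s 1)))) (Basic (Assign 1 (\<lambda>s. 2 * snd s 1)))) inv2"
  proof (rule hoare_Seq[OF hoare_Basic hoare_Basic])
    fix \<rho> \<rho>' assume "inv2 \<rho> \<and> grow w (\<rho> 0) (\<rho> 1)" "hsem w (Assign 1 (\<lambda>s. 2 * snd s 1)) \<rho> \<rho>'"
    then obtain j where "\<rho>' = st M0 (2 ^ Suc j) 0 0 0" "j < ex M0"
      unfolding inv2_def by (auto simp: grow_iff)
    then have "inv2 \<rho>'" unfolding inv2_def by (metis Suc_leI)
    then show "good \<rho>' \<and> inv2 \<rho>'" using inv2_good by blast
  qed (auto intro: inv2_good)
  show "hoare (hsem w) good inv2 (Basic (Test (\<lambda>s. \<not> grow (fst s) (snd s 0) (snd s 1))))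
      (\<lambda>\<rho>. \<rho> = st M0 (2 ^ ex M0) 0 0 0)"
    by (rule hoare_Basic) (auto simp: inv2_def grow_iff intro: inv2_good[unfolded inv2_def])
qed (rule inv2_good)

abbreviation "L0 \<equiv> 2 ^ ex M0 :: nat"

interpretation C: coding "aut w" "nQ w" "nS w" M0 L0 "del w"
  by (rule coding) (use n0_pos in simp)

lemma reach_step_eq: "reach_step w M0 L0 p = C.reach p"
  by (intro ext) (simp add: reach_step_def C.reach_def)

text \<open>The initial states \<open>c\<close> and the letters \<open>x\<close> guessed so far
  exist only in the proof; the registers keep the tree and the current configuration.\<close>

definition inv4 :: "(nat \<Rightarrow> nat) \<Rightarrow> bool" where
  "inv4 \<rho> \<longleftrightarrow> (\<exists>p c C d. \<rho> = st M0 L0 p C d \<and> p \<le> L0 \<and> d \<le> L0 * L0 \<and> code_valid (nQ w) M0 p c \<and>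
     (\<exists>x\<in>lists (alphabet (aut w)). C.confs p c (word @ x) C))"

lemma inv4_good: "inv4 \<rho> \<Longrightarrow> good \<rho>"
  unfolding inv4_def C.confs_def by (auto intro!: good_st simp: four_power)

lemma good_st': "p \<le> L0 \<Longrightarrow> c \<le> L0 * L0 \<Longrightarrow> d \<le> L0 * L0 \<Longrightarrow> good (st M0 L0 p c d)"
  by (rule good_st) (simp_all add: four_power)

lemma le_L0_sq: "c \<le> L0 \<Longrightarrow> c \<le> L0 * L0"
  by (erule order_trans) simp

lemma hoare_phase3: "hoare (hsem w) good (\<lambda>\<rho>. \<rho> = st M0 L0 0 0 0) phase3 inv4"
  unfolding phase3_def
proof (intro hoare_Seq)
  show "hoare (hsem w) good (\<lambda>\<rho>. \<rho> = st M0 L0 0 0 0) (Basic (Guess 2 (\<lambda>s. snd s 1)))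
     (\<lambda>\<rho>. \<exists>p\<le>L0. \<rho> = st M0 L0 p 0 0)"
    by (rule hoare_Basic) (auto intro!: good_st')
  show "hoare (hsem w) good (\<lambda>\<rho>. \<exists>p\<le>L0. \<rho> = st M0 L0 p 0 0) (Basic (Guess 3 (\<lambda>s. snd s 1)))
     (\<lambda>\<rho>. \<exists>p\<le>L0. \<exists>c\<le>L0. \<rho> = st M0 L0 p c 0)"
    by (rule hoare_Basic) (auto intro!: good_st' le_L0_sq)
  show "hoare (hsem w) good (\<lambda>\<rho>. \<exists>p\<le>L0. \<exists>c\<le>L0. \<rho> = st M0 L0 p c 0)
     (Basic (Test (\<lambda>s. snd s 3 < snd s 1 \<and> code_valid (nQ (fst s)) (snd s 0) (snd s 2) (snd s 3))))
     (\<lambda>\<rho>. \<exists>p\<le>L0. \<exists>c<L0. \<rho> = st M0 L0 p c 0 \<and> code_valid (nQ w) M0 p c)"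
    by (rule hoare_Basic) (auto intro!: good_st' le_L0_sq)
  show "hoare (hsem w) good (\<lambda>\<rho>. \<exists>p\<le>L0. \<exists>c<L0. \<rho> = st M0 L0 p c 0 \<and> code_valid (nQ w) M0 p c)
     (Basic (Assign 3 (\<lambda>s. run_u (fst s) (snd s 0) (snd s 1) (snd s 2) (snd s 3))))
     (\<lambda>\<rho>. \<exists>p\<le>L0. \<exists>c<L0. \<exists>C\<le>L0 * L0. \<rho> = st M0 L0 p C 0 \<and> C = run_u w M0 L0 p c \<and> code_valid (nQ w) M0 p c)"
  proof (rule hoare_Basic)
    fix \<rho> \<rho>' assume "\<exists>p\<le>L0. \<exists>c<L0. \<rho> = st M0 L0 p c 0 \<and> code_valid (nQ w) M0 p c"
      and \<rho>': "hsem w (Assign 3 (\<lambda>s. run_u (fst s) (snd s 0) (snd s 1) (snd s 2) (snd s 3))) \<rho> \<rho>'"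
    then obtain p c where pc: "p \<le> L0" "c < L0" "\<rho> = st M0 L0 p c 0" "code_valid (nQ w) M0 p c" by blast
    have r: "run_u w M0 L0 p c \<le> L0 * L0"
      unfolding run_u_def
      by (rule order_trans[OF code_run_le]) (use le_L0_sq[of c] pc(2) in simp)
    with \<rho>' pc show "good \<rho>' \<and> (\<exists>p\<le>L0. \<exists>c<L0. \<exists>C\<le>L0 * L0. \<rho>' = st M0 L0 p C 0 \<and>
        C = run_u w M0 L0 p c \<and> code_valid (nQ w) M0 p c)"
      by (auto intro!: good_st')
  qed (auto intro!: good_st' le_L0_sq)
  show "hoare (hsem w) good (\<lambda>\<rho>. \<exists>p\<le>L0. \<exists>c<L0. \<exists>C\<le>L0 * L0. \<rho> = st M0 L0 p C 0 \<and>
        C = run_u w M0 L0 p c \<and> code_valid (nQ w) M0 p c)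
     (Basic (Test (\<lambda>s. snd s 3 < snd s 1 * snd s 1))) inv4"
  proof (rule hoare_Basic)
    fix \<rho> \<rho>' assume "\<exists>p\<le>L0. \<exists>c<L0. \<exists>C\<le>L0 * L0. \<rho> = st M0 L0 p C 0 \<and>
        C = run_u w M0 L0 p c \<and> code_valid (nQ w) M0 p c"
      and t: "hsem w (Test (\<lambda>s. snd s 3 < snd s 1 * snd s 1)) \<rho> \<rho>'"
    then obtain p c where pc: "p \<le> L0" "c < L0" "\<rho> = st M0 L0 p (run_u w M0 L0 p c) 0"
      "code_valid (nQ w) M0 p c" by blast
    with t have "run_u w M0 L0 p c < L0 * L0" by simp
    then have "C.confs p c word (run_u w M0 L0 p c)"
      unfolding run_u_def using pc inp C.code_valid_iff by (intro C.crun_confs) auto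
    then have "\<exists>x\<in>lists (alphabet (aut w)). C.confs p c (word @ x) (run_u w M0 L0 p c)"
      by (intro bexI[of _ "[]"]) simp_all
    moreover have "\<rho>' = st M0 L0 p (run_u w M0 L0 p c) 0" using t pc(3) by simp
    ultimately have "inv4 \<rho>'" unfolding inv4_def using pc(1,4) by blast
    then show "good \<rho>' \<and> inv4 \<rho>'" using inv4_good by blast
  qed (auto intro!: good_st')
qed

lemma hoare_phase4: "hoare (hsem w) good inv4 phase4
   (\<lambda>_. \<exists>x\<in>lists (alphabet (aut w)). M0 \<le> card (orbit (aut w) (word @ x)))"
  unfolding phase4_def
proof (rule hoare_Seq[OF hoare_Star])
  show "hoare (hsem w) good inv4 (Seq (Basic (Guess 4 (\<lambda>s. snd s 1 * snd s 1)))
      (Seq (Basic (Test (\<lambda>s. reach_step (fst s) (snd s 0) (snd s 1) (snd s 2) (snd s 3) (snd s 4))))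
        (Basic (Assign 3 (\<lambda>s. snd s 4))))) inv4"
  proof (intro hoare_Seq)
    show "hoare (hsem w) good inv4 (Basic (Guess 4 (\<lambda>s. snd s 1 * snd s 1))) inv4"
    proof (rule hoare_Basic)
      fix \<rho> \<rho>' assume "inv4 \<rho>" "hsem w (Guess 4 (\<lambda>s. snd s 1 * snd s 1)) \<rho> \<rho>'"
      \<comment> \<open>Register 4 only holds a candidate, about which the invariant says no more
        than its bound.\<close>
      then have "inv4 \<rho>'" unfolding inv4_def by fastforce
      then show "good \<rho>' \<and> inv4 \<rho>'" using inv4_good by blast
    qed (rule inv4_good)
    show "hoare (hsem w) good inv4
       (Basic (Test (\<lambda>s. reach_step (fst s) (snd s 0) (snd s 1) (snd s 2) (snd s 3) (snd s 4))))
       (\<lambda>\<rho>. inv4 \<rho> \<and> C.reach (\<rho> 2) (\<rho> 3) (\<rho> 4))"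
    proof (rule hoare_Basic)
      fix \<rho> \<rho>' assume *: "inv4 \<rho>"
        "hsem w (Test (\<lambda>s. reach_step (fst s) (snd s 0) (snd s 1) (snd s 2) (snd s 3) (snd s 4))) \<rho> \<rho>'"
      then have "\<rho> 0 = M0" "\<rho> 1 = L0" unfolding inv4_def by auto
      with * show "good \<rho>' \<and> inv4 \<rho>' \<and> C.reach (\<rho>' 2) (\<rho>' 3) (\<rho>' 4)"
        using inv4_good by (simp add: reach_step_eq)
    qed (rule inv4_good)
    show "hoare (hsem w) good (\<lambda>\<rho>. inv4 \<rho> \<and> C.reach (\<rho> 2) (\<rho> 3) (\<rho> 4)) (Basic (Assign 3 (\<lambda>s. snd s 4))) inv4"
    proof (rule hoare_Basic)
      fix \<rho> \<rho>' assume *: "inv4 \<rho> \<and> C.reach (\<rho> 2) (\<rho> 3) (\<rho> 4)" "hsem w (Assign 3 (\<lambda>s. snd s 4)) \<rho> \<rho>'"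
      then obtain p c C d x where I: "\<rho> = st M0 L0 p C d" "p \<le> L0" "d \<le> L0 * L0"
        "code_valid (nQ w) M0 p c" "x \<in> lists (alphabet (aut w))" "C.confs p c (word @ x) C"
        unfolding inv4_def by blast
      with * have r: "(C.reach p)\<^sup>*\<^sup>* C d" by auto
      have "is_tree M0 (C.par p)" using I(4) C.code_valid_iff by blast
      from C.reach_sound[OF this I(6) r] obtain x' where
        "x' \<in> lists (alphabet (aut w))" "C.confs p c (word @ x @ x') d" by auto
      with I(5) have "\<exists>x\<in>lists (alphabet (aut w)). C.confs p c (word @ x) d"
        by (intro bexI[of _ "x @ x'"]) auto
      then have "inv4 \<rho>'" unfolding inv4_def using * I by auto
      then show "good \<rho>' \<and> inv4 \<rho>'" using inv4_good by blast
    qed (use inv4_good in blast)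
  qed
  show "hoare (hsem w) good inv4 (Basic (Test (\<lambda>s. code_distinct (snd s 0) (snd s 1) (snd s 3))))
     (\<lambda>_. \<exists>x\<in>lists (alphabet (aut w)). M0 \<le> card (orbit (aut w) (word @ x)))"
  proof (rule hoare_Basic)
    fix \<rho> \<rho>' assume *: "inv4 \<rho>" "hsem w (Test (\<lambda>s. code_distinct (snd s 0) (snd s 1) (snd s 3))) \<rho> \<rho>'"
    then obtain p c C d x where I: "\<rho> = st M0 L0 p C d"
      "code_valid (nQ w) M0 p c" "x \<in> lists (alphabet (aut w))" "C.confs p c (word @ x) C"
      unfolding inv4_def by blast
    with * have "code_distinct M0 L0 C" by simp
    then have "M0 \<le> card (orbit (aut w) (word @ x))"
      using C.confs_imp_orbit_ge[OF _ I(2,4)] I(3) word_lists by simp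
    then show "good \<rho>' \<and> (\<exists>x\<in>lists (alphabet (aut w)). M0 \<le> card (orbit (aut w) (word @ x)))"
      using * I(3) inv4_good by auto
  qed (rule inv4_good)
qed (rule inv4_good)

lemma hoare_prog: "hoare (hsem w) good (\<lambda>\<rho>. \<rho> = st 0 0 0 0 0) prog
   (\<lambda>_. \<exists>x\<in>lists (alphabet (aut w)). M0 \<le> card (orbit (aut w) (word @ x)))"
  unfolding prog_def
proof (rule hoare_Seq[OF _ hoare_Seq[OF hoare_phase1 hoare_Seq[OF _
        hoare_Seq[OF hoare_phase2 hoare_Seq[OF hoare_phase3 hoare_phase4]]]]])
  have 1: "inv1 (st 0 1 0 0 0)" unfolding inv1_def by (intro exI[of _ 0]) simp
  show "hoare (hsem w) good (\<lambda>\<rho>. \<rho> = st 0 0 0 0 0) (Basic (Assign 1 (\<lambda>_. 1))) inv1"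
    by (rule hoare_Basic) (use 1 inv1_good in \<open>auto intro!: good_st\<close>)
  have "ex (Suc n0) \<le> ex M0" using inp by (intro expo_mono) auto
  then have 2: "inv2 (st M0 (2 ^ ex (Suc n0)) 0 0 0)" unfolding inv2_def by blast
  have 3: "inv1 (st n0 (2 ^ ex (Suc n0)) 0 0 0)" unfolding inv1_def by blast
  show "hoare (hsem w) good (\<lambda>\<rho>. \<rho> = st n0 (2 ^ ex (Suc n0)) 0 0 0)
      (Basic (Assign 0 (\<lambda>s. snd s 0 + kk (fst s)))) inv2"
    by (rule hoare_Basic) (use 2 3 inv1_good inv2_good in auto)
qed

section \<open>Completeness: existence of an accepting computation\<close>

lemma sem_phase1: "sem (hsem w) phase1 (st 0 1 0 0 0) (st n0 (2 ^ ex (Suc n0)) 0 0 0)"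
proof -
  let ?b1 = "Seq (Basic (Test (\<lambda>s. grow (fst s) (Suc (snd s 0)) (snd s 1)))) (Basic (Assign 1 (\<lambda>s. 2 * snd s 1)))"
  let ?b2 = "Seq (Basic (Test (\<lambda>s. \<not> grow (fst s) (Suc (snd s 0)) (snd s 1) \<and> big (fst s) (Suc (snd s 0)) (snd s 1))))
           (Basic (Assign 0 (\<lambda>s. Suc (snd s 0))))"
  let ?r = "sem (hsem w) (Alt ?b1 ?b2)"
  have double: "?r (st N (2 ^ j) 0 0 0) (st N (2 ^ Suc j) 0 0 0)" if "j < ex (Suc N)" for N j
    using that by (auto simp: grow_iff OO_def)
  have up: "?r\<^sup>*\<^sup>* (st N (2 ^ i) 0 0 0) (st N (2 ^ m) 0 0 0)" if "i \<le> m" "m \<le> ex (Suc N)" for N i m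
    using that
  proof (induction m rule: dec_induct)
    case (step m)
    have "?r\<^sup>*\<^sup>* (st N (2 ^ i) 0 0 0) (st N (2 ^ m) 0 0 0)"
      by (rule step.IH) (use step.prems in simp)
    then show ?case by (rule rtranclp.rtrancl_into_rtrancl) (rule double, use step.prems in simp)
  qed simp
  have "?r\<^sup>*\<^sup>* (st 0 1 0 0 0) (st N (2 ^ ex (Suc N)) 0 0 0)" if "N \<le> n0" for N
    using that
  proof (induction N)
    case 0
    show ?case using up[of 0 "ex (Suc 0)" 0] by (simp only: power_0 le0 order_refl)
  next
    case (Suc N)
    have "?r\<^sup>*\<^sup>* (st 0 1 0 0 0) (st N (2 ^ ex (Suc N)) 0 0 0)"
      by (rule Suc.IH) (use Suc.prems in simp)
    moreover have "?r (st N (2 ^ ex (Suc N)) 0 0 0) (st (Suc N) (2 ^ ex (Suc N)) 0 0 0)"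
      using Suc.prems by (auto simp: grow_iff big_iff OO_def)
    moreover have "?r\<^sup>*\<^sup>* (st (Suc N) (2 ^ ex (Suc N)) 0 0 0) (st (Suc N) (2 ^ ex (Suc (Suc N))) 0 0 0)"
      by (rule up) (simp_all add: expo_mono)
    ultimately show ?case
      by (rule rtranclp_trans[OF rtranclp.rtrancl_into_rtrancl])
  qed
  from this[OF order_refl] show ?thesis
    unfolding phase1_def by (rule sem_Star_Basic) (simp add: grow_iff big_iff)
qed

lemma sem_phase2: "j \<le> ex M0 \<Longrightarrow> sem (hsem w) phase2 (st M0 (2 ^ j) 0 0 0) (st M0 L0 0 0 0)"
proof -
  let ?r = "sem (hsem w) (Seq (Basic (Test (\<lambda>s. grow (fst s) (snd s 0) (snd s 1)))) (Basic (Assign 1 (\<lambda>s. 2 * snd s 1))))"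
  assume j: "j \<le> ex M0"
  have double: "?r (st M0 (2 ^ i) 0 0 0) (st M0 (2 ^ Suc i) 0 0 0)" if "i < ex M0" for i
    using that by (auto simp: grow_iff OO_def)
  have "?r\<^sup>*\<^sup>* (st M0 (2 ^ j) 0 0 0) (st M0 (2 ^ m) 0 0 0)" if "j \<le> m" "m \<le> ex M0" for m
    using that
  proof (induction m rule: dec_induct)
    case (step m)
    have "?r\<^sup>*\<^sup>* (st M0 (2 ^ j) 0 0 0) (st M0 (2 ^ m) 0 0 0)"
      by (rule step.IH) (use step.prems in simp)
    then show ?case by (rule rtranclp.rtrancl_into_rtrancl) (rule double, use step.prems in simp)
  qed simp
  note star = this[OF j order_refl]
  have "hsem w (Test (\<lambda>s. \<not> grow (fst s) (snd s 0) (snd s 1))) (st M0 L0 0 0 0) (st M0 L0 0 0 0)"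
    using grow_iff[of M0 "ex M0"] by simp
  then show ?thesis unfolding phase2_def by (rule sem_Star_Basic[OF star])
qed

lemma sem_phase4:
  assumes "(C.reach p)\<^sup>*\<^sup>* C C'" "code_distinct M0 L0 C'"
  shows "\<exists>\<rho>. sem (hsem w) phase4 (st M0 L0 p C 0) \<rho>"
proof -
  define R where "R = sem (hsem w) (Seq (Basic (Guess 4 (\<lambda>s. snd s 1 * snd s 1)))
      (Seq (Basic (Test (\<lambda>s. reach_step (fst s) (snd s 0) (snd s 1) (snd s 2) (snd s 3) (snd s 4))))
        (Basic (Assign 3 (\<lambda>s. snd s 4)))))"
  have move: "R (st M0 L0 p C d) (st M0 L0 p C' C')" if "C.reach p C C'" for C C' d
  proof -
    have C': "C' \<le> L0 * L0" using that unfolding C.reach_def code_step_def by auto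
    show ?thesis
      unfolding R_def sem.simps
    proof (intro relcomppI)
      show "hsem w (Guess 4 (\<lambda>s. snd s 1 * snd s 1)) (st M0 L0 p C d) (st M0 L0 p C C')"
        using C' by auto
      show "hsem w (Test (\<lambda>s. reach_step (fst s) (snd s 0) (snd s 1) (snd s 2) (snd s 3) (snd s 4)))
         (st M0 L0 p C C') (st M0 L0 p C C')"
        using that by (simp add: reach_step_eq)
      show "hsem w (Assign 3 (\<lambda>s. snd s 4)) (st M0 L0 p C C') (st M0 L0 p C' C')" by simp
    qed
  qed
  from assms(1) have "\<exists>d. R\<^sup>*\<^sup>* (st M0 L0 p C 0) (st M0 L0 p C' d)"
  proof induction
    case (step y z)
    then obtain d where "R\<^sup>*\<^sup>* (st M0 L0 p C 0) (st M0 L0 p y d)" by blast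
    moreover have "R (st M0 L0 p y d) (st M0 L0 p z z)" by (rule move[OF step(2)])
    ultimately have "R\<^sup>*\<^sup>* (st M0 L0 p C 0) (st M0 L0 p z z)"
      by (rule rtranclp.rtrancl_into_rtrancl[where r = R])
    then show ?case by blast
  qed blast
  then obtain d where "R\<^sup>*\<^sup>* (st M0 L0 p C 0) (st M0 L0 p C' d)" by blast
  then have "sem (hsem w) phase4 (st M0 L0 p C 0) (st M0 L0 p C' d)"
    unfolding phase4_def R_def by (rule sem_Star_Basic) (simp add: assms(2))
  then show ?thesis by blast
qed

lemma sem_phase3:
  assumes "p < L0" "c < L0" "code_valid (nQ w) M0 p c" "run_u w M0 L0 p c < L0 * L0"
  shows "sem (hsem w) phase3 (st M0 L0 0 0 0) (st M0 L0 p (run_u w M0 L0 p c) 0)"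
  unfolding phase3_def sem.simps
proof (intro relcomppI)
  show "hsem w (Guess 2 (\<lambda>s. snd s 1)) (st M0 L0 0 0 0) (st M0 L0 p 0 0)" using assms by auto
  show "hsem w (Guess 3 (\<lambda>s. snd s 1)) (st M0 L0 p 0 0) (st M0 L0 p c 0)" using assms by auto
  show "hsem w (Assign 3 (\<lambda>s. run_u (fst s) (snd s 0) (snd s 1) (snd s 2) (snd s 3))) (st M0 L0 p c 0)
     (st M0 L0 p (run_u w M0 L0 p c) 0)" by simp
qed (use assms in simp_all)

text \<open>A tree that separates \<open>n + k\<close> words on the extended input also has a
  configuration after its prefix \<open>word\<close>. The deterministic run finds a code of it, and
  the letters of \<open>x\<close> then lead on to a configuration with distinct words.\<close>

lemma sem_prog:
  assumes x: "x \<in> lists (alphabet (aut w))" and big: "M0 \<le> card (orbit (aut w) (word @ x))"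
  shows "\<exists>\<rho>. sem (hsem w) prog (st 0 0 0 0 0) \<rho>"
proof -
  have y: "word @ x \<in> lists (alphabet (aut w))" using x word_lists by simp
  obtain p c S D where pc: "p < L0" "c < L0" "code_valid (nQ w) M0 p c"
    "tree_conf (aut w) M0 (C.par p) (digit (Suc (nQ w)) c) (word @ x) S D" "\<forall>i<M0. \<forall>j<M0. i \<noteq> j \<longrightarrow> D i j"
    by (rule C.orbit_ge_imp_code[OF y big])
  have P: "is_tree M0 (C.par p)" using pc(3) C.code_valid_iff by blast
  have ls: "\<And>i. i < ul w \<Longrightarrow> letter w i < nS w" using inp by blast
  have pre: "\<exists>S D. tree_conf (aut w) M0 (C.par p) (digit (Suc (nQ w)) c) y S D"
    if "tree_conf (aut w) M0 (C.par p) (digit (Suc (nQ w)) c) (y @ z) S D" for y z S D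
    using that
  proof (induction z arbitrary: S D rule: rev_induct)
    case (snoc a z)
    then have "tree_conf (aut w) M0 (C.par p) (digit (Suc (nQ w)) c) ((y @ z) @ [a]) S D" by simp
    then show ?case using snoc.IH unfolding tree_conf_snoc[OF P] by blast
  qed auto
  from pre[OF pc(4)] obtain S' D' where
    "tree_conf (aut w) M0 (C.par p) (digit (Suc (nQ w)) c) word S' D'" by blast
  then have run: "C.confs p c word (run_u w M0 L0 p c)"
    unfolding run_u_def by (intro C.crun_exists[OF P pc(2) ls])
  from C.reach_complete[OF P run x pc(4)] obtain C' where
    C': "(C.reach p)\<^sup>*\<^sup>* (run_u w M0 L0 p c) C'" "conf_eq M0 S D (C.cS C') (C.cD C')" by blast
  have "code_distinct M0 L0 C'" using C.code_distinct_cong[OF C'(2)] pc(5) by blast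
  from sem_phase4[OF C'(1) this] obtain \<rho> where
    4: "sem (hsem w) phase4 (st M0 L0 p (run_u w M0 L0 p c) 0) \<rho>" by blast
  have 3: "sem (hsem w) phase3 (st M0 L0 0 0 0) (st M0 L0 p (run_u w M0 L0 p c) 0)"
    by (rule sem_phase3) (use pc run in \<open>auto simp: C.confs_def\<close>)
  have "ex (Suc n0) \<le> ex M0" using inp by (intro expo_mono) auto
  note 2 = sem_phase2[OF this]
  have "sem (hsem w) prog (st 0 0 0 0 0) \<rho>"
    unfolding prog_def
    by (rule sem_Seq[OF _ sem_Seq[OF sem_phase1 sem_Seq[OF _ sem_Seq[OF 2 sem_Seq[OF 3 4]]]]]) simp_all
  then show ?thesis by blast
qed

lemma prog_accepts_iff: "(\<exists>\<rho>. sem (hsem w) prog (\<lambda>_. 0) \<rho>) \<longleftrightarrow> expandable (aut w) (kk w) word"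
proof -
  \<comment> \<open>The integer difference turns into a comparison with \<open>n0 + k\<close>, which
    needs no upper bound for the orbit of the extended word.\<close>
  have "expandable (aut w) (kk w) word \<longleftrightarrow>
      (\<exists>x\<in>lists (alphabet (aut w)). M0 \<le> card (orbit (aut w) (word @ x)))"
    unfolding expandable_def expandable_by_def by (intro bex_cong refl) linarith
  then show ?thesis
    unfolding st_0 using sem_prog hoare_prog unfolding hoare_def by blast
qed

lemma prog_space: "vis (hsem w) prog (\<lambda>_. 0) \<rho> \<Longrightarrow> \<rho> i \<le> 4 ^ ex M0"
  unfolding st_0 using hoare_prog unfolding hoare_def good_def by blast

end

text \<open>The values stored by the program are below \<open>4 ^ e x\<close>, while
  \<open>b x\<close> bounds what is read from the input; their sum serves for both.\<close>

theorem expandable_ntm: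
  assumes "\<And>x. x \<in> I \<Longrightarrow> (enc x, b x) \<in> X"
    and "\<And>x. x \<in> I \<Longrightarrow> P x \<longleftrightarrow> expandable (aut (enc x)) (kk (enc x)) (map (letter (enc x)) [0..<ul (enc x)])"
    and "\<And>x. x \<in> I \<Longrightarrow> e x = expo (nQ (enc x)) (nS (enc x))
       (card (orbit (aut (enc x)) (map (letter (enc x)) [0..<ul (enc x)])) + kk (enc x))"
  shows "\<exists>(M :: 'i ntm) C. C \<ge> 0 \<and>
     decides_in_nspace M I enc P (\<lambda>x. C * log 2 (real (b x + 4 ^ e x) + 2))"
proof (rule program_to_ntm[where m = 5 and c = prog and b = b])
  show "\<forall>b\<in>basics prog. hinstr_ok 5 b" using prog_ok by blast
  fix x assume x: "x \<in> I"
  show "(enc x, b x) \<in> X \<and> b x \<le> b x + 4 ^ e x \<and>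
      (\<forall>\<rho>. vis (hsem (enc x)) prog (\<lambda>_. 0) \<rho> \<longrightarrow> (\<forall>i. \<rho> i \<le> b x + 4 ^ e x)) \<and>
      (P x \<longleftrightarrow> (\<exists>\<rho>. sem (hsem (enc x)) prog (\<lambda>_. 0) \<rho>))"
    using prog_accepts_iff[OF assms(1)[OF x]] prog_space[OF assms(1)[OF x]] assms[OF x]
    by (auto intro: trans_le_add2)
qed

end

section \<open>The automaton as part of the input\<close>

fun symb_code :: "symb \<Rightarrow> nat" where
  "symb_code (Bit b) = of_bool b"
| "symb_code Sep = 2"

abbreviation "symb_at \<equiv> input_code symb_code"

text \<open>The number of separators before a position is the index of the field containing
  it.\<close>

definition seps :: "symb list \<Rightarrow> nat \<Rightarrow> nat" where
  "seps w i = (\<Sum>j<i. of_bool (symb_at w j = 2))"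

definition fval_step :: "symb list \<Rightarrow> nat \<Rightarrow> nat \<Rightarrow> nat \<Rightarrow> nat" where
  "fval_step w m i v = (if seps w i = m \<and> symb_at w i < 2 then 2 * v + symb_at w i else v)"

definition fval :: "symb list \<Rightarrow> nat \<Rightarrow> nat" where
  "fval w m = rec_nat 0 (fval_step w m) (length w)"

definition flen :: "symb list \<Rightarrow> nat \<Rightarrow> nat" where
  "flen w m = (\<Sum>i<length w. of_bool (seps w i = m \<and> symb_at w i < 2))"

definition bval :: "bool list \<Rightarrow> nat" where
  "bval = foldl (\<lambda>v b. 2 * v + of_bool b) 0"

lemma bval_Nil [simp]: "bval [] = 0"
  by (simp add: bval_def)

lemma bval_bin: "bval (bin n) = n"
proof (induction n rule: bin.induct)
  case (1 n)
  show ?case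
  proof (cases "n < 2")
    case True
    then show ?thesis by (subst bin.simps) (auto simp: bval_def)
  next
    case False
    then have "bval (bin n) = 2 * bval (bin (n div 2)) + of_bool (odd n)"
      by (subst bin.simps) (simp add: bval_def)
    also have "\<dots> = n" using 1 False by simp
    finally show ?thesis .
  qed
qed

lemma bin_neq_Nil: "bin n \<noteq> []"
  by (subst bin.simps) auto

lemma length_bin_le: "length (bin n) \<le> Suc n"
proof (induction n rule: bin.induct)
  case (1 n)
  show ?case
  proof (cases "n < 2")
    case True
    then show ?thesis by (subst bin.simps) auto
  next
    case False
    then have "length (bin n) = Suc (length (bin (n div 2)))"
      by (subst bin.simps) simp
    also have "\<dots> \<le> Suc (Suc (n div 2))" using 1 False by simp
    also have "\<dots> \<le> Suc n" using False by simp
    finally show ?thesis .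
  qed
qed

lemma rec_nat_cong:
  "(\<And>i v. i < n \<Longrightarrow> f i v = g i v) \<Longrightarrow> rec_nat a f n = rec_nat a g n"
  by (induction n) auto

lemma symb_at_append: "i < length w \<Longrightarrow> symb_at (w @ w') i = symb_at w i"
  by (simp add: input_code_def nth_append)

lemma symb_at_last: "symb_at (w @ [x]) (length w) = symb_code x"
  by (simp add: input_code_def)

lemma seps_append: "i \<le> length w \<Longrightarrow> seps (w @ w') i = seps w i"
  unfolding seps_def by (intro sum.cong) (auto simp: symb_at_append)

lemma seps_snoc: "seps (w @ [x]) (Suc (length w)) = seps w (length w) + of_bool (x = Sep)"
proof -
  have "symb_code x = 2 \<longleftrightarrow> x = Sep" by (cases x) (auto simp: of_bool_def)
  then show ?thesis
    using seps_append[of "length w" w "[x]"] by (simp add: seps_def symb_at_last)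
qed

lemma fval_snoc: "fval (w @ [x]) m =
    (if seps w (length w) = m \<and> x \<noteq> Sep then 2 * fval w m + symb_code x else fval w m)"
proof -
  have "rec_nat 0 (fval_step (w @ [x]) m) (length w) = fval w m"
    unfolding fval_def by (rule rec_nat_cong) (simp add: fval_step_def symb_at_append seps_append)
  moreover have "symb_code x < 2 \<longleftrightarrow> x \<noteq> Sep" by (cases x) (auto simp: of_bool_def)
  ultimately show ?thesis
    by (simp add: fval_def fval_step_def symb_at_last seps_append)
qed

lemma flen_snoc: "flen (w @ [x]) m = flen w m + of_bool (seps w (length w) = m \<and> x \<noteq> Sep)"
proof -
  have "(\<Sum>i<length w. of_bool (seps (w @ [x]) i = m \<and> symb_at (w @ [x]) i < 2)) = flen w m"
    unfolding flen_def by (rule sum.cong) (auto simp: symb_at_append seps_append)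
  moreover have "symb_code x < 2 \<longleftrightarrow> x \<noteq> Sep" by (cases x) (auto simp: of_bool_def)
  ultimately show ?thesis
    by (simp add: flen_def symb_at_last seps_append del: sum_of_bool_eq)
qed

lemma bits_append:
  "seps (w @ map Bit bs) (length (w @ map Bit bs)) = seps w (length w)"
  "fval (w @ map Bit bs) m =
    (if seps w (length w) = m then foldl (\<lambda>v b. 2 * v + of_bool b) (fval w m) bs else fval w m)"
  "flen (w @ map Bit bs) m = flen w m + (if seps w (length w) = m then length bs else 0)"
proof (induction bs rule: rev_induct)
  case (snoc b bs)
  {
    case 1
    then show ?case using snoc(1) seps_snoc[of "w @ map Bit bs" "Bit b"] by simp
  next
    case 2
    show ?case using snoc(1,2) fval_snoc[of "w @ map Bit bs" "Bit b" m] by simp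
  next
    case 3
    show ?case using snoc(1,3) flen_snoc[of "w @ map Bit bs" "Bit b" m] by simp
  }
qed simp_all

definition join :: "bool list list \<Rightarrow> symb list" where
  "join bss = concat (map (\<lambda>bs. map Bit bs @ [Sep]) bss)"

lemma join_append [simp]: "join (xs @ ys) = join xs @ join ys"
  by (simp add: join_def)

lemma join_Nil [simp]: "join [] = []"
  by (simp add: join_def)

lemma join_Cons [simp]: "join (bs # bss) = map Bit bs @ Sep # join bss"
  by (simp add: join_def)

lemma length_join: "length bss \<le> length (join bss)"
  by (induction bss) (auto simp: join_def)

lemma join_fields:
  "seps (join bss) (length (join bss)) = length bss"
  "fval (join bss) m = (if m < length bss then bval (bss ! m) else 0)"
  "flen (join bss) m = (if m < length bss then length (bss ! m) else 0)"
proof (induction bss rule: rev_induct)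
  case Nil
  {
    case 1 show ?case by (simp add: join_def seps_def)
  next
    case 2 show ?case by (simp add: join_def fval_def)
  next
    case 3 show ?case by (simp add: join_def flen_def)
  }
next
  case (snoc bs bss)
  let ?w = "join bss @ map Bit bs"
  have w: "join (bss @ [bs]) = ?w @ [Sep]" by (simp add: join_def)
  {
    case 1
    show ?case unfolding w using seps_snoc[of ?w Sep] bits_append(1)[of "join bss" bs] snoc(1) by simp
  next
    case 2
    show ?case unfolding w fval_snoc bits_append snoc
      using snoc(2) by (auto simp: bval_def nth_append less_Suc_eq)
  next
    case 3
    show ?case unfolding w flen_snoc bits_append snoc
      using snoc(3) by (auto simp: nth_append less_Suc_eq)
  }
qed

lemma bmin_le_witness:
  assumes "v < n" "P v"
  shows "bmin n P \<le> v"
proof -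
  have "bmin n P \<le> (\<Sum>i<n. of_bool (i < v))"
    unfolding bmin_def
  proof (rule sum_mono)
    fix i
    have "\<not> (\<forall>j<Suc i. \<not> P j)" if "\<not> i < v" using assms(2) that by (intro notI) (meson not_less_eq)
    then show "of_bool (\<forall>j<Suc i. \<not> P j) \<le> (of_bool (i < v) :: nat)" by auto
  qed
  also have "\<dots> = card ({..<n} \<inter> {i. i < v})" by simp
  also have "{..<n} \<inter> {i. i < v} = {..<v}" using assms(1) by auto
  finally show ?thesis by simp
qed

text \<open>Binary numerals are nonempty, so on an encoded instance this finds the delimiter between
  the transitions and the word.\<close>

definition first_empty :: "symb list \<Rightarrow> nat" where
  "first_empty w = bmin (length w) (\<lambda>m. flen w m = 0)"

definition u_nQ :: "symb list \<Rightarrow> nat" where "u_nQ w = fval w 0"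
definition u_nS :: "symb list \<Rightarrow> nat" where "u_nS w = fval w 1"
definition u_kk :: "symb list \<Rightarrow> nat" where "u_kk w = fval w 2"
definition u_len :: "symb list \<Rightarrow> nat" where "u_len w = seps w (length w) - Suc (first_empty w)"
definition u_letter :: "symb list \<Rightarrow> nat \<Rightarrow> nat" where "u_letter w t = fval w (Suc (first_empty w) + t)"

text \<open>The length of the input is a crude but definable bound for the number of
  transitions.\<close>

definition u_del :: "symb list \<Rightarrow> nat \<Rightarrow> nat \<Rightarrow> nat \<Rightarrow> nat \<Rightarrow> bool" where
  "u_del w q a b p \<longleftrightarrow> (\<exists>j<length w. 3 + 4 * j < first_empty w \<and> fval w (3 + 4 * j) = q \<and>
     fval w (4 + 4 * j) = a \<and> fval w (5 + 4 * j) = b \<and> fval w (6 + 4 * j) = p)"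

definition u_aut :: "symb list \<Rightarrow> (nat, nat) automaton" where
  "u_aut w = \<lparr>states = {..<u_nQ w}, alphabet = {..<u_nS w}, transitions = {(q, a, b, p). u_del w q a b p}\<rparr>"

definition u_fields :: "(nat, nat) automaton \<times> nat \<times> nat list \<Rightarrow> bool list list" where
  "u_fields = (\<lambda>(T, k, u). [bin (card (states T)), bin (card (alphabet T)), bin k] @
     concat (map (\<lambda>(q, a, b, p). [bin q, bin a, bin b, bin p]) (transition_list T)) @ [[]] @ map bin u)"

lemma encode_uniform_join: "encode_uniform x = join (u_fields x)"
proof -
  have "concat (map (\<lambda>(q, a, b, p). field q @ field a @ field b @ field p) xs) =
    join (concat (map (\<lambda>(q, a, b, p). [bin q, bin a, bin b, bin p]) xs))" for xs
    by (induction xs) (auto simp: field_def)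
  moreover have "concat (map field u) = join (map bin u)" for u
    by (induction u) (auto simp: field_def)
  ultimately show ?thesis
    by (cases x) (auto simp: u_fields_def field_def)
qed

lemma nth_append_mem: "m < length xs \<Longrightarrow> (xs @ ys) ! m \<in> set xs"
  by (simp add: nth_append)

lemma length_quads: "length (concat (map (\<lambda>(q, a, b, p). [f q, f a, f b, f p]) xs)) = 4 * length xs"
  by (induction xs) auto

lemma nth_quads:
  "j < length xs \<Longrightarrow> xs ! j = (q, a, b, p) \<Longrightarrow>
    (let ys = concat (map (\<lambda>(q, a, b, p). [f q, f a, f b, f p]) xs) in
      ys ! (4 * j) = f q \<and> ys ! (4 * j + 1) = f a \<and> ys ! (4 * j + 2) = f b \<and> ys ! (4 * j + 3) = f p)"
proof (induction xs arbitrary: j)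
  case (Cons x xs)
  then show ?case
    by (cases x; cases j) (auto simp: Let_def numeral_eq_Suc)
qed simp

lemma set_transition_list:
  assumes "(T, k, u) \<in> uniform_instances"
  shows "set (transition_list T) = transitions T"
proof -
  have "transitions T \<subseteq> states T \<times> alphabet T \<times> alphabet T \<times> states T"
    "states T = {..<card (states T)}" "alphabet T = {..<card (alphabet T)}"
    using assms by (auto simp: uniform_instances_def s_automaton_def)
  then have "transitions T \<subseteq> {..<card (states T)} \<times> {..<card (alphabet T)} \<times>
      {..<card (alphabet T)} \<times> {..<card (states T)}" by metis
  then show ?thesis unfolding transition_list_def by auto
qed

context
  fixes T k u w
  assumes inst: "(T, k, u) \<in> uniform_instances" and w: "w = encode_uniform (T, k, u)"
begin

lemma w_join: "w = join (u_fields (T, k, u))"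
  by (simp add: w encode_uniform_join)

abbreviation "trl \<equiv> transition_list T"
abbreviation "quads \<equiv> concat (map (\<lambda>(q, a, b, p). [bin q, bin a, bin b, bin p]) trl)"

lemma fval_w: "fval w m = (if m < length (u_fields (T, k, u)) then bval (u_fields (T, k, u) ! m) else 0)"
  unfolding w_join by (rule join_fields)

lemma first_empty_w: "first_empty w = 3 + 4 * length trl"
proof -
  let ?F = "u_fields (T, k, u)" and ?E = "3 + 4 * length trl"
  have F: "?F = ([bin (card (states T)), bin (card (alphabet T)), bin k] @ quads) @ [[]] @ map bin u"
    by (simp add: u_fields_def)
  have lenE: "?E < length ?F" by (simp add: F length_quads)
  have E0: "?F ! ?E = []" unfolding F by (simp add: nth_append length_quads)
  have ne: "?F ! m \<noteq> []" if "m < ?E" for m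
  proof -
    let ?P = "[bin (card (states T)), bin (card (alphabet T)), bin k] @ quads"
    have "m < length ?P" using that by (simp add: length_quads)
    then have "?F ! m \<in> set ?P" unfolding F by (rule nth_append_mem)
    then show ?thesis by (auto simp: bin_neq_Nil)
  qed
  have "flen w ?E = 0" "\<And>m. m < ?E \<Longrightarrow> flen w m \<noteq> 0"
    unfolding w_join join_fields using lenE E0 ne by auto
  moreover have "?E < length w" using lenE length_join[of ?F] unfolding w_join by linarith
  ultimately show ?thesis
    unfolding first_empty_def using bmin_Some[of ?E "length w" "\<lambda>m. flen w m = 0"]
      bmin_le_witness[of ?E "length w" "\<lambda>m. flen w m = 0"]
    by (metis le_neq_implies_less)
qed

lemma u_nQ_w: "u_nQ w = card (states T)" and u_nS_w: "u_nS w = card (alphabet T)" and u_kk_w: "u_kk w = k"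
  unfolding u_nQ_def u_nS_def u_kk_def fval_w by (simp_all add: u_fields_def bval_bin)

lemma u_len_w: "u_len w = length u"
  unfolding u_len_def first_empty_w unfolding w_join join_fields by (simp add: u_fields_def length_quads)

lemma u_letter_w: "t < length u \<Longrightarrow> u_letter w t = u ! t"
  unfolding u_letter_def first_empty_w fval_w
  by (simp add: u_fields_def length_quads nth_append nth_Cons' bval_bin)

lemma map_u_letter_w: "map (u_letter w) [0..<u_len w] = u"
  by (intro nth_equalityI) (auto simp: u_len_w u_letter_w)

lemma fval_quad:
  assumes "j < length trl" "trl ! j = (q, a, b, p)"
  shows "fval w (3 + 4 * j) = q" "fval w (4 + 4 * j) = a" "fval w (5 + 4 * j) = b" "fval w (6 + 4 * j) = p"
proof -
  have F: "u_fields (T, k, u) ! (3 + 4 * j + i) = quads ! (4 * j + i)" if "i < 4" for i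
    using that assms(1) by (simp add: u_fields_def nth_append length_quads nth_Cons')
  have len: "3 + 4 * j + i < length (u_fields (T, k, u))" if "i < 4" for i
    using that assms(1) by (simp add: u_fields_def length_quads)
  note n = nth_quads[OF assms, of bin, unfolded Let_def]
  show "fval w (3 + 4 * j) = q" "fval w (4 + 4 * j) = a" "fval w (5 + 4 * j) = b" "fval w (6 + 4 * j) = p"
    using F[of 0] F[of 1] F[of 2] F[of 3] len[of 0] len[of 1] len[of 2] len[of 3] n
    unfolding fval_w by (simp_all add: bval_bin add.commute add.left_commute)
qed

lemma u_del_w: "u_del w q a b p \<longleftrightarrow> (q, a, b, p) \<in> transitions T"
proof -
  have len: "length trl \<le> length w"
    using length_join[of "u_fields (T, k, u)"] unfolding w_join by (simp add: u_fields_def length_quads)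
  have "u_del w q a b p \<longleftrightarrow> (\<exists>j<length trl. trl ! j = (q, a, b, p))"
  proof
    assume "u_del w q a b p"
    then obtain j where j: "j < length trl" "fval w (3 + 4 * j) = q" "fval w (4 + 4 * j) = a"
      "fval w (5 + 4 * j) = b" "fval w (6 + 4 * j) = p"
      unfolding u_del_def first_empty_w by auto
    obtain q' a' b' p' where "trl ! j = (q', a', b', p')" by (metis prod_cases4)
    with fval_quad[OF j(1) this] j show "\<exists>j<length trl. trl ! j = (q, a, b, p)" by auto
  next
    assume "\<exists>j<length trl. trl ! j = (q, a, b, p)"
    then obtain j where j: "j < length trl" "trl ! j = (q, a, b, p)" by blast
    then show "u_del w q a b p"
      unfolding u_del_def first_empty_w using fval_quad[OF j] len by (intro exI[of _ j]) auto
  qed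
  also have "\<dots> \<longleftrightarrow> (q, a, b, p) \<in> set trl" by (metis in_set_conv_nth)
  finally show ?thesis unfolding set_transition_list[OF inst] .
qed

lemma u_aut_w: "u_aut w = T"
proof -
  have "states T = {..<u_nQ w}" "alphabet T = {..<u_nS w}"
    unfolding u_nQ_w u_nS_w using inst by (simp_all add: uniform_instances_def)
  moreover have "{(q, a, b, p). u_del w q a b p} = transitions T"
    using u_del_w by auto
  ultimately show ?thesis unfolding u_aut_def by simp
qed

text \<open>A numeral can have a value exponential in its length, so the input length alone would
  not bound the decoded numbers polynomially. This is why the number attached to an input also
  contains the sizes of the automaton and the value of \<open>k\<close>.\<close>

lemma fval_le: "fval w m \<le> card (states T) + card (alphabet T) + k"
proof (cases "m < length (u_fields (T, k, u))")
  case True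
  have T: "s_automaton T" "states T = {..<card (states T)}" "alphabet T = {..<card (alphabet T)}"
    "u \<in> lists (alphabet T)"
    using inst by (simp_all add: uniform_instances_def)
  have tr: "q < card (states T) \<and> a < card (alphabet T) \<and> b < card (alphabet T) \<and> p < card (states T)"
    if "(q, a, b, p) \<in> set trl" for q a b p
    using that unfolding transition_list_def by auto
  have "bval bs \<le> card (states T) + card (alphabet T) + k" if "bs \<in> set (u_fields (T, k, u))" for bs
  proof -
    from that consider "bs \<in> {bin (card (states T)), bin (card (alphabet T)), bin k, []}"
      | q a b p where "(q, a, b, p) \<in> set trl" "bs \<in> {bin q, bin a, bin b, bin p}"
      | x where "x \<in> set u" "bs = bin x"
      unfolding u_fields_def by auto
    then show ?thesis
    proof cases
      case 1
      then show ?thesis by (auto simp: bval_bin)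
    next
      case 2
      then show ?thesis using tr[of q a b p] by (auto simp: bval_bin)
    next
      case 3
      then have "x \<in> {..<card (alphabet T)}" using T(3,4) by auto
      then show ?thesis using 3 by (simp add: bval_bin)
    qed
  qed
  from this[OF nth_mem[OF True]] have "bval (u_fields (T, k, u) ! m) \<le> card (states T) + card (alphabet T) + k" .
  then show ?thesis using True by (simp add: fval_w)
next
  case False
  then show ?thesis unfolding fval_w by simp
qed

end

section \<open>The algorithm for automata given as input\<close>

definition u_base :: "(nat, nat) automaton \<times> nat \<times> nat list \<Rightarrow> nat" where
  "u_base = (\<lambda>(T, k, u). length (encode_uniform (T, k, u)) + (card (states T) + card (alphabet T) + k))"

definition u_inputs :: "(symb list \<times> nat) set" where
  "u_inputs = (\<lambda>x. (encode_uniform x, u_base x)) ` uniform_instances"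

interpretation U: inputs UNIV u_inputs symb_code
proof
  have "x \<in> range Bit \<union> {Sep}" for x by (cases x) auto
  then have "(UNIV :: symb set) = range Bit \<union> {Sep}" by blast
  then show "finite (UNIV :: symb set)" by (metis finite.simps finite_UnI finite_imageI finite)
  show "w \<in> lists UNIV \<and> length w \<le> b" if "(w, b) \<in> u_inputs" for w b
    using that by (auto simp: u_inputs_def u_base_def simp del: encode_uniform.simps)
qed

lemma u_inputsE:
  assumes "(w, b) \<in> u_inputs"
  obtains T k u where "(T, k, u) \<in> uniform_instances" "w = encode_uniform (T, k, u)" "b = u_base (T, k, u)"
proof -
  from assms obtain x where "x \<in> uniform_instances" "w = encode_uniform x" "b = u_base x"
    unfolding u_inputs_def by blast
  then show thesis using that by (cases x) blast
qed

lemma tdef_seps: "U.tdef d f \<Longrightarrow> U.tdef d (\<lambda>s. seps (fst s) (f s))"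
  unfolding seps_def by (rule U.tdef_intros | assumption)+

lemma fval_step_mono: "v \<le> fval_step w m i v"
  by (simp add: fval_step_def)

lemma rec_fval_le: "j \<le> length w \<Longrightarrow> rec_nat 0 (fval_step w m) j \<le> fval w m"
proof -
  have "rec_nat 0 (fval_step w m) j \<le> rec_nat 0 (fval_step w m) i" if "j \<le> i" for i
    using that
  proof (induction i rule: dec_induct)
    case (step i)
    then show ?case using fval_step_mono le_trans by fastforce
  qed simp
  then show "j \<le> length w \<Longrightarrow> ?thesis" unfolding fval_def .
qed

lemma fval_le_u_base:
  assumes "(w, b) \<in> u_inputs"
  shows "fval w m \<le> b"
  using assms
proof (rule u_inputsE)
  fix T k u assume "(T, k, u) \<in> uniform_instances" "w = encode_uniform (T, k, u)" and b: "b = u_base (T, k, u)"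
  from fval_le[OF this(1,2), of m] show ?thesis unfolding b u_base_def case_prod_conv by linarith
qed

text \<open>Horner evaluation never decreases, so all intermediate values are below the final one,
  which is bounded by the number attached to the input.\<close>

lemma tdef_fval:
  assumes "U.tdef d f"
  shows "U.tdef d (\<lambda>s. fval (fst s) (f s))"
  unfolding fval_def
proof (rule U.tdef_rec[where h = "\<lambda>s. fval (fst s) (f s)"])
  show "U.polyb d (\<lambda>s. fval (fst s) (f s))"
  proof (rule U.polybI[where e = 1])
    fix w b B and \<rho> :: "nat \<Rightarrow> nat" assume "(w, b) \<in> u_inputs" "b \<le> B"
    then have "fval w (f (w, \<rho>)) \<le> B" using fval_le_u_base le_trans by blast
    then show "fval (fst (w, \<rho>)) (f (w, \<rho>)) \<le> (B + 2) ^ 1" by simp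
  qed
  show "rec_nat 0 (fval_step (fst (w, \<rho>)) (f (w, \<rho>))) j \<le> fval (fst (w, \<rho>)) (f (w, \<rho>))"
    if "j \<le> length (fst (w, \<rho>))" for w \<rho> j
    using that by (intro rec_fval_le)
  show "U.tdef k (\<lambda>s. fval_step (fst s) (f s) (x s) (y s))"
    if "d \<le> k" "U.tdef k x" "U.tdef k y" for k x y
    unfolding fval_step_def
    by (rule U.tdef_intros tdef_seps that U.tdef_weaken[OF assms])+
qed (rule U.tdef_intros)+

lemma tdef_flen: "U.tdef d f \<Longrightarrow> U.tdef d (\<lambda>s. flen (fst s) (f s))"
  unfolding flen_def by (rule U.tdef_intros tdef_seps | assumption | (rule U.tdef_weaken, assumption, assumption))+

lemma tdef_first_empty: "U.tdef d (\<lambda>s. first_empty (fst s))"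
  unfolding first_empty_def by (rule U.tdef_intros tdef_flen | assumption)+

interpretation UA: algorithm UNIV u_inputs symb_code u_nQ u_nS u_kk u_len u_letter u_del u_aut
proof
  show "U.tdef d (\<lambda>s. u_nQ (fst s))" "U.tdef d (\<lambda>s. u_nS (fst s))" "U.tdef d (\<lambda>s. u_kk (fst s))" for d
    unfolding u_nQ_def u_nS_def u_kk_def by (rule tdef_fval U.tdef_const)+
  show "U.tdef d (\<lambda>s. u_len (fst s))" for d
    unfolding u_len_def by (rule U.tdef_intros tdef_seps tdef_first_empty)+
  show "U.tdef d (\<lambda>s. u_letter (fst s) (f s))" if "U.tdef d f" for d f
    unfolding u_letter_def by (rule U.tdef_intros tdef_fval tdef_first_empty that)+
  show "U.pdef d (\<lambda>s. u_del (fst s) (f1 s) (f2 s) (f3 s) (f4 s))"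
    if "U.tdef d f1" "U.tdef d f2" "U.tdef d f3" "U.tdef d f4" for d f1 f2 f3 f4
    unfolding u_del_def
    by (rule U.tdef_intros tdef_fval tdef_first_empty | assumption
        | (rule U.tdef_weaken, rule that, assumption))+
  fix w b assume "(w, b) \<in> u_inputs"
  then obtain T k u where inst: "(T, k, u) \<in> uniform_instances" and w: "w = encode_uniform (T, k, u)"
    by (rule u_inputsE)
  have "letter < card (alphabet T)" if "letter \<in> set u" for letter
    using inst that by (auto simp: uniform_instances_def)
  moreover have "s_automaton T" "states T = {..<card (states T)}" "alphabet T = {..<card (alphabet T)}" "k \<ge> 1"
    using inst by (simp_all add: uniform_instances_def)
  ultimately show "s_automaton (u_aut w) \<and> states (u_aut w) = {..<u_nQ w} \<and> alphabet (u_aut w) = {..<u_nS w} \<and>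
     (\<forall>q a b p. u_del w q a b p = ((q, a, b, p) \<in> transitions (u_aut w))) \<and>
     (\<forall>t<u_len w. u_letter w t < u_nS w) \<and> 1 \<le> u_kk w"
    unfolding u_aut_w[OF inst w] u_nQ_w[OF inst w] u_nS_w[OF inst w] u_kk_w[OF inst w]
      u_len_w[OF inst w] u_del_w[OF inst w] using u_letter_w[OF inst w] by simp
qed

definition u_expo :: "(nat, nat) automaton \<times> nat \<times> nat list \<Rightarrow> nat" where
  "u_expo = (\<lambda>(T, k, u). expo (card (states T)) (card (alphabet T)) (card (orbit T u) + k))"

lemma uniform_ntm:
  "\<exists>(M :: symb ntm) C. C \<ge> 0 \<and> decides_in_nspace M uniform_instances encode_uniform
     (\<lambda>(T, k, u). expandable T k u) (\<lambda>x. C * log 2 (real (u_base x + 4 ^ u_expo x) + 2))"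
proof (rule UA.expandable_ntm)
  fix x assume x: "x \<in> uniform_instances"
  obtain T k u where x': "x = (T, k, u)" by (cases x)
  note inst = x[unfolded x']
  show "(encode_uniform x, u_base x) \<in> u_inputs" using x by (simp add: u_inputs_def)
  show "(case x of (T, k, u) \<Rightarrow> expandable T k u) =
      expandable (u_aut (encode_uniform x)) (u_kk (encode_uniform x))
       (map (u_letter (encode_uniform x)) [0..<u_len (encode_uniform x)])"
    unfolding x' u_aut_w[OF inst refl] u_kk_w[OF inst refl] map_u_letter_w[OF inst refl] by simp
  show "u_expo x = expo (u_nQ (encode_uniform x)) (u_nS (encode_uniform x))
     (card (orbit (u_aut (encode_uniform x)) (map (u_letter (encode_uniform x)) [0..<u_len (encode_uniform x)]))
       + u_kk (encode_uniform x))"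
    unfolding x' u_aut_w[OF inst refl] u_kk_w[OF inst refl] map_u_letter_w[OF inst refl]
      u_nQ_w[OF inst refl] u_nS_w[OF inst refl] by (simp add: u_expo_def)
qed

section \<open>Estimate of the space bound\<close>

lemma length_concat_map_le:
  "(\<And>x. x \<in> set xs \<Longrightarrow> length (f x) \<le> c) \<Longrightarrow> length (concat (map f xs)) \<le> length xs * c"
proof (induction xs)
  case (Cons x xs)
  then have "length (f x) \<le> c" "length (concat (map f xs)) \<le> length xs * c" by auto
  then show ?case by simp
qed simp

lemma length_transition_list:
  "length (transition_list T) \<le>
    card (states T) * (card (alphabet T) * (card (alphabet T) * (card (states T) * 1)))"
proof -
  have *: "length (concat (map f [0..<n])) \<le> n * c" if "\<And>x. length (f x) \<le> c" for f :: "nat \<Rightarrow> 'b list" and n c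
    using length_concat_map_le[of "[0..<n]" f c] that by simp
  show ?thesis unfolding transition_list_def by (intro *) simp
qed

lemma length_field: "length (field n) \<le> n + 2"
  using length_bin_le[of n] by (simp add: field_def)

text \<open>Only a polynomial in the four parameters matters, as its logarithm is taken. The
  transitions dominate and lead to the cube; 32 leaves a margin and is a power of two.\<close>

lemma u_base_le:
  assumes inst: "(T, k, u) \<in> uniform_instances"
  defines "Z \<equiv> (card (states T) + 1) * (card (alphabet T) + 1) * (k + 1) * (length u + 1)"
  shows "u_base (T, k, u) + 2 \<le> 32 * Z ^ 3"
proof -
  define q s where "q = card (states T)" and "s = card (alphabet T)"
  define x y z v where "x = q + 1" and "y = s + 1" and "z = k + 1" and "v = length u + 1"
  note defs = q_def[symmetric] s_def[symmetric]
  have Z: "Z = x * y * z * v" by (simp add: Z_def x_def y_def z_def v_def q_def s_def)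
  have pos: "1 \<le> x" "1 \<le> y" "1 \<le> z" "1 \<le> v" by (simp_all add: x_def y_def z_def v_def)
  have al: "alphabet T = {..<s}" "u \<in> lists (alphabet T)"
    using inst by (simp_all add: uniform_instances_def s_def)
  let ?q4 = "\<lambda>(q, a, b, p). field q @ field a @ field b @ field p"
  have "length (concat (map ?q4 (transition_list T))) \<le> length (transition_list T) * (2 * x + 2 * y)"
  proof (rule length_concat_map_le)
    fix t assume t: "t \<in> set (transition_list T)"
    obtain q' a b p where t': "t = (q', a, b, p)" by (metis prod_cases4)
    with t have "q' < q" "a < s" "b < s" "p < q" unfolding transition_list_def q_def s_def by auto
    then show "length (?q4 t) \<le> 2 * x + 2 * y"
      using length_field[of q'] length_field[of a] length_field[of b] length_field[of p]
      unfolding t' x_def y_def by simp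
  qed
  also have "\<dots> \<le> (q * (s * (s * (q * 1)))) * (2 * x + 2 * y)"
    using length_transition_list[of T] unfolding defs by (intro mult_right_mono) auto
  also have "\<dots> \<le> (x * (y * (y * (x * 1)))) * (2 * x + 2 * y)"
    unfolding x_def y_def by (intro mult_le_mono) auto
  also have "\<dots> = 2 * ((x * y) * (x * y) * x) + 2 * ((x * y) * (x * y) * y)"
    by (simp add: algebra_simps)
  also have "\<dots> \<le> 2 * (Z * Z * Z) + 2 * (Z * Z * Z)"
  proof -
    have "x * y \<le> Z" "x \<le> Z" "y \<le> Z" using pos unfolding Z by simp_all
    then show ?thesis by (intro add_mono mult_le_mono) auto
  qed
  finally have 1: "length (concat (map ?q4 (transition_list T))) \<le> 4 * (Z * Z * Z)" by simp
  have "length (concat (map field u)) \<le> length u * y"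
  proof (rule length_concat_map_le)
    fix a assume "a \<in> set u"
    then have "a < s" using al by auto
    then show "length (field a) \<le> y" using length_field[of a] by (simp add: y_def)
  qed
  also have "\<dots> \<le> v * y" by (simp add: v_def)
  also have "\<dots> \<le> Z" using pos unfolding Z by simp
  finally have 2: "length (concat (map field u)) \<le> Z" .
  have zs: "x \<le> Z" "y \<le> Z" "z \<le> Z" "1 \<le> Z" using pos unfolding Z by simp_all
  have "Z \<le> Z * Z * Z" using zs(4) by simp
  moreover have "u_base (T, k, u) + 2 \<le> (x + 1) + (y + 1) + (z + 1) + 4 * (Z * Z * Z) + 1 + Z + (x + y + z) + 2"
    using 1 2 length_field[of q] length_field[of s] length_field[of k]
    unfolding u_base_def by (simp add: defs x_def y_def z_def)
  ultimately have "u_base (T, k, u) + 2 \<le> 32 * (Z * Z * Z)" using zs by linarith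
  then show ?thesis by (simp add: power3_eq_cube)
qed

lemma log2_Suc_le: "log 2 (real n + 1) \<le> real n"
proof -
  have "n + 1 \<le> 2 ^ n" by (simp add: Suc_le_eq)
  then have "real (n + 1) \<le> real (2 ^ n)" by (simp only: of_nat_le_iff)
  then have "real n + 1 \<le> 2 ^ n" by simp
  then have "log 2 (real n + 1) \<le> log 2 (2 ^ n)" by (subst log_le_cancel_iff) auto
  then show ?thesis by simp
qed

lemma log2_nonneg: "0 \<le> log 2 (real n)"
  by (cases "n = 0") (auto simp: log_def)

lemma log2_Suc_le_log2: "log 2 (real n + 1) \<le> 1 + log 2 (real n)"
proof (cases "n = 0")
  case True
  then show ?thesis by (simp add: log_def)
next
  case False
  then have "log 2 (real n + 1) \<le> log 2 (2 * real n)" by (subst log_le_cancel_iff) auto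
  also have "\<dots> = 1 + log 2 (real n)" using False by (simp add: log_mult)
  finally show ?thesis .
qed

text \<open>The sum is bounded by twice a product, whose logarithm splits: \<open>4 ^ e\<close>
  contributes \<open>2 * e\<close> and the factor 2 contributes 1.\<close>

lemma log2_base_expo_le:
  "log 2 (real (b + 4 ^ e) + 2) \<le> log 2 (real b + 2) + 2 * real e + 1"
proof -
  have "real (b + 4 ^ e) + 2 \<le> (real b + 2) * (2 * 4 ^ e)"
  proof -
    define y where "y = (4::real) ^ e"
    have y: "1 \<le> y" by (simp add: y_def)
    then have "real b * 1 \<le> real b * y" by (intro mult_left_mono) auto
    moreover have "(real b + 2) * (2 * y) = 2 * (real b * y) + 4 * y" by (simp add: algebra_simps)
    ultimately have "real b + y + 2 \<le> (real b + 2) * (2 * y)" using y by linarith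
    then show ?thesis by (simp add: y_def)
  qed
  then have "log 2 (real (b + 4 ^ e) + 2) \<le> log 2 ((real b + 2) * (2 * 4 ^ e))"
    by (subst log_le_cancel_iff) (auto intro: add_nonneg_pos)
  also have "\<dots> = log 2 (real b + 2) + (1 + log 2 (4 ^ e))"
    by (simp add: log_mult)
  also have "log 2 ((4::real) ^ e) = 2 * real e"
  proof -
    have "(4::real) ^ e = 2 ^ (2 * e)" by (simp add: power_mult)
    then show ?thesis by simp
  qed
  finally show ?thesis by simp
qed

text \<open>Since \<open>N\<close>, \<open>s\<close> and \<open>l\<close> are all at least 1, each
  of them is at most \<open>P\<close>. The constant 21 collects 14 from the input, twice 3 from the
  exponent, and 1 absorbed by \<open>1 \<le> P\<close>; the length of \<open>u\<close> needs only
  \<open>3 * U\<close>.\<close>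

lemma uniform_bound_ge:
  assumes inst: "(T, k, u) \<in> uniform_instances"
  shows "log 2 (real (u_base (T, k, u) + 4 ^ u_expo (T, k, u)) + 2) \<le> 21 * uniform_bound (T, k, u)"
proof -
  define q s n where "q = card (states T)" and "s = card (alphabet T)" and "n = card (orbit T u)"
  have T: "s_automaton T" "u \<in> lists (alphabet T)" "1 \<le> k"
    using inst by (simp_all add: uniform_instances_def)
  have s1: "1 \<le> s"
    using T(1) unfolding s_automaton_def s_def by (metis One_nat_def Suc_leI card_gt_0_iff)
  define N where "N = real n + real k"
  define l where "l = 1 + log 2 (real q)"
  define P where "P = N\<^sup>2 * real s * l"
  define U where "U = real (length u) * (1 + log 2 (real s))"
  have l1: "1 \<le> l" unfolding l_def using log2_nonneg[of q] by simp
  have N1: "1 \<le> N" "real k \<le> N" using T(3) by (simp_all add: N_def)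
  have rs: "1 \<le> real s" using s1 by simp
  have P1: "N * N * real s * l = P" by (simp add: P_def power2_eq_square)
  have sl: "1 \<le> real s * l" using mult_mono[OF rs l1] by simp
  have Ns: "N \<le> N * real s * l" using mult_left_mono[OF sl, of N] N1 by (simp add: mult.assoc)
  have sN: "real s \<le> N * real s * l"
    using mult_mono[OF N1(1) l1] rs N1(1) by (simp add: mult_left_mono mult.commute mult.left_commute)
  have lN: "l \<le> N * real s * l"
    using mult_mono[OF N1(1) rs] l1 N1(1) by (simp add: mult_right_mono)
  have up: "N * real s * l \<le> P"
    unfolding P1[symmetric] using mult_right_mono[OF N1(1), of "N * real s * l"] N1 rs l1
    by (simp add: mult.assoc)
  have e: "real (u_expo (T, k, u)) \<le> 3 * P"
  proof -
    have "real (u_expo (T, k, u)) = N * (N + real s + real (bitlen q))"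
      by (simp add: u_expo_def expo_def N_def n_def s_def q_def)
    also have "\<dots> \<le> N * (N + real s + l)"
      using bitlen_le[of q] N1 by (intro mult_left_mono) (auto simp: l_def)
    also have "\<dots> \<le> N * (3 * (N * real s * l))"
    proof (rule mult_left_mono)
      show "N + real s + l \<le> 3 * (N * real s * l)" using Ns sN lN by linarith
    qed (use N1 in simp)
    also have "\<dots> = 3 * P" by (simp add: P1[symmetric])
    finally show ?thesis .
  qed
  have b: "log 2 (real (u_base (T, k, u)) + 2) \<le> 14 * P + 3 * U"
  proof -
    define Z where "Z = (q + 1) * (s + 1) * (k + 1) * (length u + 1)"
    have Z: "0 < Z" by (simp add: Z_def)
    have "real (u_base (T, k, u) + 2) \<le> real (32 * Z ^ 3)"
      using u_base_le[OF inst] unfolding Z_def q_def s_def by (simp only: of_nat_le_iff)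
    then have "real (u_base (T, k, u)) + 2 \<le> 32 * real Z ^ 3"
      by (simp only: of_nat_add of_nat_mult of_nat_power of_nat_numeral)
    then have "log 2 (real (u_base (T, k, u)) + 2) \<le> log 2 (32 * real Z ^ 3)"
      using Z by (subst log_le_cancel_iff) auto
    also have "\<dots> = log 2 32 + 3 * log 2 (real Z)"
      using Z by (subst log_mult) (auto simp: log_nat_power)
    also have "log 2 32 = (5::real)" using log_pow_cancel[of 2 5] by simp
    also have "log 2 (real Z) = log 2 (real q + 1) + log 2 (real s + 1) + log 2 (real k + 1) + log 2 (real (length u) + 1)"
      by (simp only: Z_def of_nat_mult of_nat_add of_nat_1) (subst log_mult, auto)+
    also have "5 + 3 * \<dots> \<le> 5 + 3 * (l + real s + real k + real (length u))"
      using log2_Suc_le_log2[of q] log2_Suc_le[of s] log2_Suc_le[of k] log2_Suc_le[of "length u"]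
      by (simp add: l_def)
    \<comment> \<open>Here 14 is 5, the logarithm of 32, plus three times the three parameters
      \<open>l\<close>, \<open>s\<close> and \<open>k\<close>, each of which is at most
      \<open>P\<close>.\<close>
    also have "\<dots> \<le> 14 * P + 3 * U"
    proof -
      have "real (length u) \<le> U"
        unfolding U_def using mult_left_mono[of 1 "1 + log 2 (real s)" "real (length u)"] log2_nonneg[of s] by simp
      then show ?thesis using lN sN Ns N1 up by (smt (verit))
    qed
    finally show ?thesis by simp
  qed
  have "1 \<le> P" using Ns N1 up by linarith
  moreover have "0 \<le> U" unfolding U_def using log2_nonneg[of s] by simp
  moreover have "uniform_bound (T, k, u) = P + U"
    by (simp add: P_def U_def N_def l_def n_def s_def q_def)
  ultimately show ?thesis
    using log2_base_expo_le[of "u_base (T, k, u)" "u_expo (T, k, u)"] e b by linarith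
qed

lemma decides_in_nspace_mono:
  "decides_in_nspace M X enc P s \<Longrightarrow> (\<And>x. x \<in> X \<Longrightarrow> s x \<le> s' x) \<Longrightarrow> decides_in_nspace M X enc P s'"
  unfolding decides_in_nspace_def by (meson order_trans)

theorem uniform_decidable:
  "\<exists>(M :: symb ntm) c. decides_in_nspace M uniform_instances encode_uniform
     (\<lambda>(T, k, u). expandable T k u) (\<lambda>(T, k, u). c * uniform_bound (T, k, u))"
proof -
  obtain M :: "symb ntm" and C where C: "C \<ge> 0" and
    M: "decides_in_nspace M uniform_instances encode_uniform
     (\<lambda>(T, k, u). expandable T k u) (\<lambda>x. C * log 2 (real (u_base x + 4 ^ u_expo x) + 2))"
    using uniform_ntm by blast
  have "decides_in_nspace M uniform_instances encode_uniform
     (\<lambda>(T, k, u). expandable T k u) (\<lambda>(T, k, u). (C * 21) * uniform_bound (T, k, u))"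
  proof (rule decides_in_nspace_mono[OF M])
    fix x assume "x \<in> uniform_instances"
    moreover obtain T k u where x: "x = (T, k, u)" by (cases x)
    ultimately have "log 2 (real (u_base x + 4 ^ u_expo x) + 2) \<le> 21 * uniform_bound (T, k, u)"
      using uniform_bound_ge by blast
    from mult_left_mono[OF this C]
    show "C * log 2 (real (u_base x + 4 ^ u_expo x) + 2) \<le> (case x of (T, k, u) \<Rightarrow> C * 21 * uniform_bound (T, k, u))"
      unfolding x by (simp add: mult.assoc del: uniform_bound.simps)
  qed
  then show ?thesis by blast
qed

section \<open>Fixed automata\<close>

text \<open>A fixed automaton may have states and letters of any type, while the algorithm works
  with numbers. Injective renaming preserves the sizes of all orbits and hence
  expandability.\<close>

definition rename :: "('q \<Rightarrow> 'p) \<Rightarrow> ('a \<Rightarrow> 'b) \<Rightarrow> ('q, 'a) automaton \<Rightarrow> ('p, 'b) automaton" where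
  "rename f g T = \<lparr>states = f ` states T, alphabet = g ` alphabet T,
     transitions = (\<lambda>(q, a, b, p). (f q, g a, g b, f p)) ` transitions T\<rparr>"

context
  fixes T :: "('q, 'a) automaton" and f :: "'q \<Rightarrow> 'p" and g :: "'a \<Rightarrow> 'b"
  assumes T: "s_automaton T" and f: "inj_on f (states T)" and g: "inj_on g (alphabet T)"
begin

lemma transition_in:
  "(q, a, b, p) \<in> transitions T \<Longrightarrow> q \<in> states T \<and> a \<in> alphabet T \<and> b \<in> alphabet T \<and> p \<in> states T"
  using T unfolding s_automaton_def by blast

lemma transitions_rename: "transitions (rename f g T) = (\<lambda>(q, a, b, p). (f q, g a, g b, f p)) ` transitions T"
  by (simp add: rename_def)

lemma rename_transitionE:
  assumes "(f q, g a, b', p') \<in> transitions (rename f g T)" "q \<in> states T" "a \<in> alphabet T"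
  obtains b p where "(q, a, b, p) \<in> transitions T" "b' = g b" "p' = f p"
proof -
  from assms(1) obtain q1 a1 b p where 1: "(q1, a1, b, p) \<in> transitions T"
    "f q = f q1" "g a = g a1" "b' = g b" "p' = f p"
    unfolding transitions_rename by auto
  then have "q = q1" "a = a1"
    using transition_in[OF 1(1)] assms(2,3) inj_onD[OF f] inj_onD[OF g] by blast+
  then show thesis using that 1 by blast
qed

lemma s_automaton_rename: "s_automaton (rename f g T)"
  unfolding s_automaton_def
proof (intro conjI allI impI)
  show "finite (states (rename f g T))" "finite (alphabet (rename f g T))" "alphabet (rename f g T) \<noteq> {}"
    using T by (auto simp: rename_def s_automaton_def)
  show "transitions (rename f g T) \<subseteq> states (rename f g T) \<times> alphabet (rename f g T) \<times>
      alphabet (rename f g T) \<times> states (rename f g T)"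
    using transition_in by (fastforce simp: rename_def)
  fix q a b p b' p'
  assume 1: "(q, a, b, p) \<in> transitions (rename f g T)" and 2: "(q, a, b', p') \<in> transitions (rename f g T)"
  from 1 obtain q0 a0 b0 p0 where 3: "(q0, a0, b0, p0) \<in> transitions T"
    "q = f q0" "a = g a0" "b = g b0" "p = f p0"
    unfolding transitions_rename by auto
  from 2 obtain b1 p1 where 4: "(q0, a0, b1, p1) \<in> transitions T" "b' = g b1" "p' = f p1"
    unfolding 3(2,3) by (rule rename_transitionE) (use transition_in[OF 3(1)] in auto)
  have "b0 = b1 \<and> p0 = p1" using T 3(1) 4(1) unfolding s_automaton_def by blast
  then show "b = b'" "p = p'" using 3 4 by auto
qed

lemma run_rename: "run T q u v p \<Longrightarrow> run (rename f g T) (f q) (map g u) (map g v) (f p)"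
proof (induction rule: run.induct)
  case (run_Cons q a b r u v p)
  then have "(f q, g a, g b, f r) \<in> transitions (rename f g T)"
    unfolding transitions_rename by force
  then show ?case using run_Cons.IH by (auto intro: run.run_Cons)
qed simp

text \<open>Injectivity recovers the original state and letter at each step, so a run of the renamed
  automaton cannot glue together pieces of different runs.\<close>

lemma run_rename_inv:
  "run (rename f g T) (f q) (map g u) v' p' \<Longrightarrow> q \<in> states T \<Longrightarrow> u \<in> lists (alphabet T) \<Longrightarrow>
    \<exists>v p. run T q u v p \<and> v' = map g v"
proof (induction u arbitrary: q v')
  case (Cons a u)
  from Cons.prems(1) obtain b' r' w' where w': "v' = b' # w'"
    "(f q, g a, b', r') \<in> transitions (rename f g T)" "run (rename f g T) r' (map g u) w' p'"
    by (auto simp: run_Cons_iff)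
  from w'(2) obtain b r where r: "(q, a, b, r) \<in> transitions T" "b' = g b" "r' = f r"
    by (rule rename_transitionE) (use Cons.prems in auto)
  from Cons.IH[of r w'] w'(3) r transition_in[OF r(1)] Cons.prems(3)
  obtain v p where "run T r u v p" "w' = map g v" by auto
  then have "run T q (a # u) (b # v) p" "v' = map g (b # v)" using r w' by (auto simp: run_Cons_iff)
  then show ?case by blast
qed auto

lemma orbit_rename:
  assumes u: "u \<in> lists (alphabet T)"
  shows "orbit (rename f g T) (map g u) = map g ` orbit T u"
proof (intro equalityI subsetI)
  fix v assume "v \<in> orbit (rename f g T) (map g u)"
  then show "v \<in> map g ` orbit T u"
  proof (induction rule: orbit_induct)
    case refl
    then show ?case using orbit_refl by blast
  next
    case (act v q v')
    then obtain x q0 where x: "x \<in> orbit T u" "v = map g x" and q0: "q0 \<in> states T" "q = f q0"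
      by (auto simp: rename_def)
    have "x \<in> lists (alphabet T)" using orbit_subset[OF T u] x(1) by auto
    moreover obtain p' where "run (rename f g T) (f q0) (map g x) v' p'"
      using act(3) unfolding act_eq_Some_iff[OF s_automaton_rename] x(2) q0(2) by blast
    ultimately obtain y p where "run T q0 x y p" "v' = map g y" using run_rename_inv q0(1) by blast
    then have "y \<in> orbit T u" using orbit_act[OF x(1) q0(1)] act_eq_Some_iff[OF T] by blast
    then show ?case using \<open>v' = map g y\<close> by blast
  qed
next
  fix v assume "v \<in> map g ` orbit T u"
  then obtain x where x: "x \<in> orbit T u" "v = map g x" by blast
  from x(1) have "map g x \<in> orbit (rename f g T) (map g u)"
  proof (induction rule: orbit_induct)
    case refl
    then show ?case by (rule orbit_refl)
  next
    case (act v q v')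
    then obtain p where "run T q v v' p" unfolding act_eq_Some_iff[OF T] by blast
    from run_rename[OF this] have "act (rename f g T) (f q) (map g v) = Some (map g v')"
      unfolding act_eq_Some_iff[OF s_automaton_rename] by blast
    moreover have "f q \<in> states (rename f g T)" using act(2) by (simp add: rename_def)
    ultimately show ?case using act(1) by (metis orbit_act)
  qed
  then show "v \<in> orbit (rename f g T) (map g u)" using x(2) by simp
qed

lemma card_orbit_rename:
  assumes u: "u \<in> lists (alphabet T)"
  shows "card (orbit (rename f g T) (map g u)) = card (orbit T u)"
  unfolding orbit_rename[OF u]
proof (rule card_image, rule inj_onI)
  fix x y assume xy: "x \<in> orbit T u" "y \<in> orbit T u" "map g x = map g y"
  then have "set x \<union> set y \<subseteq> alphabet T" using orbit_subset[OF T u] by blast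
  then have "inj_on g (set x \<union> set y)" using g inj_on_subset by blast
  then show "x = y" using xy(3) inj_on_map_eq_map by blast
qed

lemma expandable_rename:
  assumes u: "u \<in> lists (alphabet T)"
  shows "expandable (rename f g T) k (map g u) \<longleftrightarrow> expandable T k u"
proof -
  have "lists (alphabet (rename f g T)) = map g ` lists (alphabet T)"
    by (simp add: rename_def lists_image)
  then have "expandable (rename f g T) k (map g u) \<longleftrightarrow>
      (\<exists>x\<in>lists (alphabet T). expandable_by (rename f g T) k (map g u) (map g x))"
    unfolding expandable_def by simp
  also have "\<dots> \<longleftrightarrow> expandable T k u"
    unfolding expandable_def expandable_by_def
  proof (intro bex_cong refl)
    fix x assume "x \<in> lists (alphabet T)"
    then have "u @ x \<in> lists (alphabet T)" using u by simp
    from card_orbit_rename[OF this] card_orbit_rename[OF u]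
    show "(int k \<le> int (card (orbit (rename f g T) (map g u @ map g x))) -
        int (card (orbit (rename f g T) (map g u)))) =
      (int k \<le> int (card (orbit T (u @ x))) - int (card (orbit T u)))"
      by simp
  qed
  finally show ?thesis .
qed

end

section \<open>Decoding for a fixed automaton\<close>

fun f_code :: "('a \<Rightarrow> nat) \<Rightarrow> bool + 'a \<Rightarrow> nat" where
  "f_code g (Inl b) = of_bool b"
| "f_code g (Inr a) = g a + 2"

definition f_step :: "('a \<Rightarrow> nat) \<Rightarrow> (bool + 'a) list \<Rightarrow> nat \<Rightarrow> nat \<Rightarrow> nat" where
  "f_step g w i v = (if input_code (f_code g) w i < 2 then 2 * v + input_code (f_code g) w i else v)"

definition f_kk :: "('a \<Rightarrow> nat) \<Rightarrow> (bool + 'a) list \<Rightarrow> nat" where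
  "f_kk g w = rec_nat 0 (f_step g w) (length w)"

definition f_off :: "('a \<Rightarrow> nat) \<Rightarrow> (bool + 'a) list \<Rightarrow> nat" where
  "f_off g w = (\<Sum>i<length w. of_bool (input_code (f_code g) w i < 2))"

text \<open>Codes 0 and 1 are taken by the bits of \<open>k\<close>, so letters are shifted by 2.
  The word begins after the bits, whose number is \<open>f_off\<close>.\<close>

definition f_letter :: "('a \<Rightarrow> nat) \<Rightarrow> (bool + 'a) list \<Rightarrow> nat \<Rightarrow> nat" where
  "f_letter g w t = input_code (f_code g) w (f_off g w + t) - 2"

lemma f_code_less_2: "f_code g x < 2 \<longleftrightarrow> isl x"
  by (cases x) (auto simp: of_bool_def)

lemma f_kk_snoc: "f_kk g (w @ [x]) = (if isl x then 2 * f_kk g w + f_code g x else f_kk g w)"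
proof -
  have "rec_nat 0 (f_step g (w @ [x])) (length w) = f_kk g w"
    unfolding f_kk_def by (rule rec_nat_cong) (simp add: f_step_def input_code_def nth_append)
  then show ?thesis
    by (simp add: f_kk_def f_step_def input_code_def f_code_less_2)
qed

lemma f_off_snoc: "f_off g (w @ [x]) = f_off g w + of_bool (isl x)"
proof -
  have "(\<Sum>i<length w. of_bool (input_code (f_code g) (w @ [x]) i < 2)) = f_off g w"
    unfolding f_off_def by (rule sum.cong) (auto simp: input_code_def nth_append)
  then show ?thesis
    by (simp add: f_off_def input_code_def f_code_less_2 del: sum_of_bool_eq)
qed

lemma f_bits: "f_kk g (map Inl bs) = bval bs" "f_off g (map Inl bs) = length bs"
proof (induction bs rule: rev_induct)
  case Nil
  {
    case 1 show ?case by (simp add: f_kk_def)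
  next
    case 2 show ?case by (simp add: f_off_def)
  }
next
  case (snoc b bs)
  {
    case 1 show ?case using snoc(1) by (simp add: f_kk_snoc bval_def)
  next
    case 2 show ?case using snoc(2) by (simp add: f_off_snoc)
  }
qed

lemma f_encode: "f_kk g (map Inl bs @ map Inr u) = bval bs" "f_off g (map Inl bs @ map Inr u) = length bs"
proof (induction u rule: rev_induct)
  case Nil
  {
    case 1 show ?case by (simp add: f_bits)
  next
    case 2 show ?case by (simp add: f_bits)
  }
next
  case (snoc a u)
  {
    case 1 show ?case using snoc(1) f_kk_snoc[of g "map Inl bs @ map Inr u" "Inr a"] by simp
  next
    case 2 show ?case using snoc(2) f_off_snoc[of g "map Inl bs @ map Inr u" "Inr a"] by simp
  }
qed

lemma f_letters:
  assumes "w = map Inl bs @ map Inr u"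
  shows "map (f_letter g w) [0..<length w - f_off g w] = map g u"
  unfolding f_letter_def assms f_encode
  by (intro nth_equalityI) (auto simp: input_code_def nth_append)

text \<open>The value of \<open>k\<close> is included because it is stored in a register and is not
  polynomially bounded by the length of its numeral.\<close>

definition f_base :: "nat \<times> 'a list \<Rightarrow> nat" where
  "f_base = (\<lambda>(k, u). length (bin k) + length u + k)"

definition f_inputs :: "('q, 'a) automaton \<Rightarrow> ((bool + 'a) list \<times> nat) set" where
  "f_inputs T = (\<lambda>x. (encode_fixed x, f_base x)) ` fixed_instances T"

definition f_expo :: "('q, 'a) automaton \<Rightarrow> nat \<times> 'a list \<Rightarrow> nat" where
  "f_expo T = (\<lambda>(k, u). expo (card (states T)) (card (alphabet T)) (card (orbit T u) + k))"

lemma fixed_ntm: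
  fixes T :: "('q, 'a) automaton"
  assumes T: "s_automaton T"
  shows "\<exists>(M :: (bool + 'a) ntm) C. C \<ge> 0 \<and> decides_in_nspace M (fixed_instances T) encode_fixed
     (\<lambda>(k, u). expandable T k u) (\<lambda>x. C * log 2 (real (f_base x + 4 ^ f_expo T x) + 2))"
proof -
  have fin: "finite (states T)" "finite (alphabet T)" using T by (simp_all add: s_automaton_def)
  obtain f :: "'q \<Rightarrow> nat" where f: "bij_betw f (states T) {0..<card (states T)}"
    using ex_bij_betw_finite_nat[OF fin(1)] by blast
  obtain g :: "'a \<Rightarrow> nat" where g: "bij_betw g (alphabet T) {0..<card (alphabet T)}"
    using ex_bij_betw_finite_nat[OF fin(2)] by blast
  note inj = bij_betw_imp_inj_on[OF f] bij_betw_imp_inj_on[OF g]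
  define T' where "T' = rename f g T"
  have T': "s_automaton T'" "states T' = {..<card (states T)}" "alphabet T' = {..<card (alphabet T)}"
    using s_automaton_rename[OF T inj] bij_betw_imp_surj_on[OF f] bij_betw_imp_surj_on[OF g]
    unfolding T'_def by (auto simp: rename_def)
  let ?A = "range Inl \<union> Inr ` alphabet T :: (bool + 'a) set"
  let ?c = "f_code g"
  have decode: "\<exists>k u. k \<ge> 1 \<and> u \<in> lists (alphabet T) \<and> w = map Inl (bin k) @ map Inr u \<and> b = f_base (k, u)"
    if "(w, b) \<in> f_inputs T" for w b
    using that by (auto simp: f_inputs_def fixed_instances_def)
  interpret inputs ?A "f_inputs T" ?c
  proof
    show "finite ?A" using fin by simp
    show "w \<in> lists ?A \<and> length w \<le> b" if "(w, b) \<in> f_inputs T" for w b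
      using decode[OF that] by (auto simp: f_base_def)
  qed
  have tdef_off: "tdef d (\<lambda>s. f_off g (fst s))" for d
    unfolding f_off_def by (rule tdef_intros | assumption)+
  have fin': "finite (transitions T')"
    using T' unfolding s_automaton_def
    by (metis (no_types, lifting) finite_SigmaI finite_lessThan finite_subset)
  interpret algorithm ?A "f_inputs T" ?c "\<lambda>_. card (states T)" "\<lambda>_. card (alphabet T)" "f_kk g"
    "\<lambda>w. length w - f_off g w" "f_letter g" "\<lambda>_ q a b p. (q, a, b, p) \<in> transitions T'" "\<lambda>_. T'"
  proof
    show "tdef d (\<lambda>s. card (states T))" "tdef d (\<lambda>s. card (alphabet T))" for d
      by (rule tdef_const)+
    show "tdef d (\<lambda>s. f_kk g (fst s))" for d
      unfolding f_kk_def
    proof (rule tdef_rec[where h = "\<lambda>s. f_kk g (fst s)"])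
      show "polyb d (\<lambda>s. f_kk g (fst s))"
        by (rule polyb_input) (auto dest!: decode simp: f_encode bval_bin f_base_def)
      have "rec_nat 0 (f_step g w) j \<le> rec_nat 0 (f_step g w) i" if "j \<le> i" for w i j
        using that
      proof (induction i rule: dec_induct)
        case (step i)
        have "v \<le> f_step g w i v" for v by (simp add: f_step_def)
        then show ?case using step(3) le_trans by fastforce
      qed simp
      then show "rec_nat 0 (f_step g (fst (w, \<rho>))) j \<le> f_kk g (fst (w, \<rho>))"
        if "j \<le> length (fst (w, \<rho>))" for w \<rho> j
        using that unfolding f_kk_def by blast
      show "tdef k (\<lambda>s. f_step g (fst s) (x s) (y s))" if "tdef k x" "tdef k y" for k x y
        unfolding f_step_def by (rule tdef_intros that)+
    qed (rule tdef_intros)+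
    show "tdef d (\<lambda>s. length (fst s) - f_off g (fst s))" for d
      by (rule tdef_intros tdef_off)+
    show "tdef d (\<lambda>s. f_letter g (fst s) (x s))" if "tdef d x" for d x
      unfolding f_letter_def by (rule tdef_intros tdef_off that)+
    show "pdef d (\<lambda>s. (f1 s, f2 s, f3 s, f4 s) \<in> transitions T')"
      if t: "tdef d f1" "tdef d f2" "tdef d f3" "tdef d f4" for d f1 f2 f3 f4
    proof -
      \<comment> \<open>The transition table is a constant here: membership is a finite disjunction
        of comparisons with constants, hardwired into the program.\<close>
      have "pdef d (\<lambda>s. (f1 s, f2 s, f3 s, f4 s) \<in> F)" if "finite F" for F
        using that
      proof induction
        case empty
        then show ?case using tdef_const[of d 0] by simp
      next
        case (insert t F)
        obtain q a b p where t': "t = (q, a, b, p)" by (metis prod_cases4)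
        have "pdef d (\<lambda>s. (f1 s = q \<and> f2 s = a \<and> f3 s = b \<and> f4 s = p) \<or> (f1 s, f2 s, f3 s, f4 s) \<in> F)"
          by (intro pdef_disj pdef_conj pdef_eq t tdef_const insert.IH)
        then show ?case by (simp add: t')
      qed
      then show ?thesis using fin' .
    qed
    fix w b assume "(w, b) \<in> f_inputs T"
    then obtain k u where ku: "k \<ge> 1" "u \<in> lists (alphabet T)" "w = map Inl (bin k) @ map Inr u" using decode by blast
    have "f_letter g w t < card (alphabet T)" if "t < length w - f_off g w" for t
    proof -
      have "f_letter g w t = map (f_letter g w) [0..<length w - f_off g w] ! t" using that by simp
      also have "\<dots> = g (u ! t)"
        unfolding f_letters[OF ku(3)] using that unfolding ku(3) f_encode by simp
      also have "u ! t \<in> alphabet T" using that ku(2) unfolding ku(3) f_encode by auto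
      then have "g (u ! t) < card (alphabet T)" using bij_betw_apply[OF g] by fastforce
      finally show ?thesis .
    qed
    then show "s_automaton T' \<and> states T' = {..<card (states T)} \<and> alphabet T' = {..<card (alphabet T)} \<and>
       (\<forall>q a b p. ((q, a, b, p) \<in> transitions T') = ((q, a, b, p) \<in> transitions T')) \<and>
       (\<forall>t<length w - f_off g w. f_letter g w t < card (alphabet T)) \<and> 1 \<le> f_kk g w"
      using T' ku by (simp add: f_encode bval_bin)
  qed
  show ?thesis
  proof (rule expandable_ntm)
    fix x assume x: "x \<in> fixed_instances T"
    obtain k u where x': "x = (k, u)" by (cases x)
    have u: "u \<in> lists (alphabet T)" using x unfolding x' by (simp add: fixed_instances_def)
    have w: "encode_fixed x = map Inl (bin k) @ map Inr u" by (simp add: x')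
    have kk: "f_kk g (encode_fixed x) = k" unfolding w f_encode by (rule bval_bin)
    show "(encode_fixed x, f_base x) \<in> f_inputs T" using x by (simp add: f_inputs_def)
    show "(case x of (k, u) \<Rightarrow> expandable T k u) = expandable T' (f_kk g (encode_fixed x))
       (map (f_letter g (encode_fixed x)) [0..<length (encode_fixed x) - f_off g (encode_fixed x)])"
      unfolding kk f_letters[OF w] T'_def expandable_rename[OF T inj u] by (simp add: x')
    show "f_expo T x = expo (card (states T)) (card (alphabet T)) (card (orbit T'
       (map (f_letter g (encode_fixed x)) [0..<length (encode_fixed x) - f_off g (encode_fixed x)])) +
       f_kk g (encode_fixed x))"
      unfolding kk f_letters[OF w] T'_def card_orbit_rename[OF T inj u] by (simp add: x' f_expo_def)
  qed
qed

section \<open>Estimate of the space bound for fixed automata\<close>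

lemma powr_pow: "(2 powr x) ^ n = (2::real) powr (real n * x)"
  by (simp add: powr_realpow[symmetric] powr_powr mult.commute)

text \<open>With the automaton fixed, the space is quadratic in \<open>n + k\<close> up to
  constants, and \<open>n\<close> is at most exponential in the length of \<open>u\<close>. All of
  this is expressed by powers of \<open>Y\<close>; the summand 1 in the exponent ensures
  \<open>Y \<ge> 2\<close> even for the empty word and \<open>k = 1\<close>, so that constants
  become powers of \<open>Y\<close>.\<close>

theorem fixed_decidable:
  fixes T :: "('q, 'a) automaton"
  assumes T: "s_automaton T"
  shows "\<exists>(M :: (bool + 'a) ntm) c. decides_in_nspace M (fixed_instances T) encode_fixed
     (\<lambda>(k, u). expandable T k u) (\<lambda>(k, u). 2 powr (c * (1 + real (length u) + log 2 (real k))))"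
proof -
  obtain M :: "(bool + 'a) ntm" and C where C: "C \<ge> 0" and
    M: "decides_in_nspace M (fixed_instances T) encode_fixed
     (\<lambda>(k, u). expandable T k u) (\<lambda>x. C * log 2 (real (f_base x + 4 ^ f_expo T x) + 2))"
    using fixed_ntm[OF T] by blast
  define s where "s = card (alphabet T)"
  define K where "K = 1 + real s + real (bitlen (card (states T)))"
  have s1: "1 \<le> s"
    using T unfolding s_automaton_def s_def by (metis One_nat_def Suc_leI card_gt_0_iff)
  have K0: "0 \<le> K" by (simp add: K_def)
  obtain m where m: "C * (3 + 2 * K) < 2 ^ m"
    using real_arch_pow[of 2 "C * (3 + 2 * K)"] by auto
  \<comment> \<open>\<open>m\<close> absorbs the constant factor, and \<open>2 * s\<close> comes
    from \<open>N \<le> Y ^ s\<close>, squared in \<open>expo\<close>.\<close>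
  let ?c = "real (m + 2 * s)"
  have "C * log 2 (real (f_base (k, u) + 4 ^ f_expo T (k, u)) + 2) \<le>
      2 powr (?c * (1 + real (length u) + log 2 (real k)))"
    if ku: "(k, u) \<in> fixed_instances T" for k u
  proof -
    have k: "1 \<le> k" and u: "u \<in> lists (alphabet T)" using ku by (simp_all add: fixed_instances_def)
    define Y where "Y = (2::real) powr (1 + real (length u) + log 2 (real k))"
    have Y: "Y = 2 * 2 ^ length u * real k"
      using k by (simp add: Y_def powr_add powr_realpow)
    have "real (length u) + 1 \<le> 2 ^ length u"
      using log2_Suc_le[of "length u"] by (metis Suc_leI less_exp of_nat_Suc of_nat_le_iff of_nat_numeral of_nat_power add.commute)
    then have Y2: "2 * (real (length u) + 1) \<le> Y" "2 * real k \<le> Y" "2 \<le> Y"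
    proof -
      assume l: "real (length u) + 1 \<le> 2 ^ length u"
      have k': "1 \<le> real k" using k by simp
      show "2 * (real (length u) + 1) \<le> Y"
        unfolding Y using mult_mono[OF l k'] by simp
      show "2 * real k \<le> Y" unfolding Y using k' by simp
      then show "2 \<le> Y" using k' by linarith
    qed
    define N where "N = real (card (orbit T u)) + real k"
    have N1: "1 \<le> N" using k by (simp add: N_def)
    have "card (orbit T u) \<le> s ^ length u" unfolding s_def by (rule card_orbit_le[OF T u])
    also have "\<dots> \<le> (2 ^ s) ^ length u" by (rule power_mono) (auto intro: less_imp_le less_exp)
    finally have "real (card (orbit T u)) \<le> real ((2 ^ s) ^ length u)" by (simp only: of_nat_le_iff)
    then have cY: "real (card (orbit T u)) \<le> 2 ^ (s * length u)" by (simp add: power_mult)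
    have NY: "N \<le> Y ^ s"
    proof -
      let ?a = "2 ^ (s * length u) :: real"
      have a1: "1 \<le> ?a" by simp
      have "N \<le> ?a + real k" using cY by (simp add: N_def)
      also have "\<dots> \<le> ?a * real k + ?a * real k"
      proof -
        have "?a * 1 \<le> ?a * real k" using k by (intro mult_left_mono) auto
        moreover have "1 * real k \<le> ?a * real k" using a1 by (rule mult_right_mono) simp
        ultimately show ?thesis by linarith
      qed
      \<comment> \<open>The exponents 1 are written out so that both can be raised to
        \<open>s\<close>, which is at least 1.\<close>
      also have "\<dots> = 2 ^ 1 * ?a * real k ^ 1" by simp
      also have "\<dots> \<le> 2 ^ s * ?a * real k ^ s"
        using k s1 by (intro mult_mono power_increasing) auto
      also have "\<dots> = Y ^ s" by (simp add: Y power_mult_distrib power_mult[symmetric] mult.commute)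
      finally show ?thesis .
    qed
    have e: "real (f_expo T (k, u)) \<le> K * Y ^ (2 * s)"
    proof -
      have "real (f_expo T (k, u)) = N * (N + real s + real (bitlen (card (states T))))"
        by (simp add: f_expo_def expo_def N_def s_def)
      also have "\<dots> \<le> N * (K * N)"
      proof (rule mult_left_mono)
        have "real s + real (bitlen (card (states T))) \<le> (real s + real (bitlen (card (states T)))) * N"
          using mult_left_mono[OF N1, of "real s + real (bitlen (card (states T)))"] by simp
        then show "N + real s + real (bitlen (card (states T))) \<le> K * N"
          by (simp add: K_def algebra_simps)
      qed (use N1 in simp)
      also have "\<dots> = K * (N * N)" by simp
      also have "\<dots> \<le> K * (Y ^ s * Y ^ s)"
        using NY N1 K0 by (intro mult_left_mono mult_mono) auto
      finally show ?thesis by (simp add: mult_2 power_add)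
    qed
    have "log 2 (real (f_base (k, u)) + 2) \<le> real (f_base (k, u)) + 1"
      using log2_Suc_le[of "f_base (k, u) + 1"] by (simp add: add.commute)
    also have "\<dots> \<le> 2 * real k + real (length u) + 2"
      using length_bin_le[of k] by (simp add: f_base_def)
    also have "\<dots> \<le> 2 * Y"
    proof -
      have "real (length u) + 2 \<le> Y" by (rule order_trans[OF _ Y2(1)]) simp
      from add_mono[OF Y2(2) this] show ?thesis by simp
    qed
    finally have b: "log 2 (real (f_base (k, u)) + 2) \<le> 2 * Y" .
    have YY: "Y \<le> Y ^ (2 * s)"
      using power_increasing[of 1 "2 * s" Y] s1 Y2 by simp
    have "log 2 (real (f_base (k, u) + 4 ^ f_expo T (k, u)) + 2) \<le> 3 * Y + 2 * (K * Y ^ (2 * s))"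
      using log2_base_expo_le[of "f_base (k, u)" "f_expo T (k, u)"] b e Y2 by linarith
    also have "\<dots> \<le> (3 + 2 * K) * Y ^ (2 * s)" using YY by (simp add: algebra_simps)
    finally have "C * log 2 (real (f_base (k, u) + 4 ^ f_expo T (k, u)) + 2) \<le> C * ((3 + 2 * K) * Y ^ (2 * s))"
      using C by (rule mult_left_mono)
    also have "\<dots> = C * (3 + 2 * K) * Y ^ (2 * s)" by simp
    also have "\<dots> \<le> Y ^ m * Y ^ (2 * s)"
    proof (rule mult_right_mono)
      have "(2::real) ^ m \<le> Y ^ m" using Y2 by (intro power_mono) auto
      then show "C * (3 + 2 * K) \<le> Y ^ m" using m by linarith
    qed (use Y2 in simp)
    also have "\<dots> = Y ^ (m + 2 * s)" by (simp add: power_add)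
    also have "\<dots> = 2 powr (?c * (1 + real (length u) + log 2 (real k)))"
      unfolding Y_def powr_pow ..
    finally show ?thesis .
  qed
  then have "decides_in_nspace M (fixed_instances T) encode_fixed (\<lambda>(k, u). expandable T k u)
      (\<lambda>(k, u). 2 powr (?c * (1 + real (length u) + log 2 (real k))))"
    by (intro decides_in_nspace_mono[OF M]) auto
  then show ?thesis by blast
qed

theorem theorem3p2:
  shows
    "(\<forall>(T, k, u) \<in> uniform_instances. card (orbit T u) \<le> card (alphabet T) ^ length u) \<and>
     (\<exists>(M :: symb ntm) (c :: real).
        decides_in_nspace M uniform_instances encode_uniform
          (\<lambda>(T, k, u). expandable T k u)
          (\<lambda>(T, k, u). c * uniform_bound (T, k, u))) \<and>
     (\<forall>T :: ('q, 'a) automaton. s_automaton T \<longrightarrow>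
        (\<exists>(M :: (bool + 'a) ntm) (c :: real).
           decides_in_nspace M (fixed_instances T) encode_fixed
             (\<lambda>(k, u). expandable T k u)
             (\<lambda>(k, u). 2 powr (c * (1 + real (length u) + log 2 (real k))))))"
proof (intro conjI ballI allI impI)
  fix x assume "x \<in> uniform_instances"
  then show "case x of (T, k, u) \<Rightarrow> card (orbit T u) \<le> card (alphabet T) ^ length u"
    by (cases x) (auto simp: uniform_instances_def intro: card_orbit_le)
qed (use uniform_decidable fixed_decidable in blast)+

end
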